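(* Every $H^1$-projective Banach space $X$ has the property U.H.M.D. (Unconditionality of Hardy Martingale Differences).
   Context: All Banach spaces are complex. Let $\mathbb{T}$ be the unit circle with normalized Haar measure $dm$. For a Banach space $X$, $\widetilde H^1(X)$ is the closure in the Bochner space $L^1(\mathbb{T};X)$ of the set of $X$-valued analytic polynomials $\sum_{k=0}^n z^k x_k$ ($n\in\mathbb{N}$, $x_k\in X$), with the $L^1(\mathbb{T};X)$-norm; $H^1=\widetilde H^1(\mathbb{C})$ is the scalar Hardy space. $\hat\otimes$ denotes the (completed) projective tensor product. There is a canonical norm-one inclusion map $H^1\hat\otimes X\hookrightarrow\widetilde H^1(X)$ sending $h\otimes x$ to $h(\cdot)x$. $X$ is called $H^1$-projective if this map is surjective; equivalently, if there is a constant $c$ such that $\|F\|_{H^1\hat\otimes X}\le c\,\|F\|_{\widetilde H^1(X)}$ for all $F\in H^1\hat\otimes X$. Let $(\Omega,\mathcal{A},\mathbb{P})$ be $\mathbb{T}^{\mathbb{N}}$ with its normalized Haar measure, $\theta_n$ ($n\ge1$) the $n$-th coordinate, and $\mathcal{A}_n$ the $\sigma$-algebra generated by $(\theta_1,\dots,\theta_n)$ ($\mathcal{A}_0$ trivial). An $X$-valued Hardy martingale is a sequence $(M_n)_{n\ge0}$ in $L^1(\Omega,\mathcal{A},\mathbb{P};X)$ which is a martingale with respect to $(\mathcal{A}_n)_{n\ge0}$ and such that, for each $n\ge1$ and (almost) every fixed $\theta_1,\dots,\theta_{n-1}$, the function $\theta\mapsto M_n(\theta_1,\dots,\theta_{n-1},\theta)$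 belongs to $\widetilde H^1(X)$. Its differences are $dM_0=M_0$ and $dM_n=M_n-M_{n-1}$ for $n\ge1$. $X$ has the property U.H.M.D. if there exists a constant $K$ such that for every $X$-valued Hardy martingale $(M_n)_{n\ge0}$ and every choice of signs $(\varepsilon_n)_{n\ge0}\in\{+1,-1\}^{\mathbb{N}}$, $$\forall m,\qquad \mathbb{E}\left\|\sum_{n=0}^m\varepsilon_n\,dM_n\right\|_X\le K\,\mathbb{E}\|M_m\|_X .$$ *)

theory Defs
  imports "HOL-Probability.Probability"
begin

section \<open>Complex Banach spaces\<close>

class complex_banach = banach +
  fixes scaleC :: "complex \<Rightarrow> 'a \<Rightarrow> 'a"  (infixr \<open>*\<^sub>C\<close> 75)
  assumes scaleC_add_right: "c *\<^sub>C (x + y) = c *\<^sub>C x + c *\<^sub>C y"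
    and scaleC_add_left: "(c + d) *\<^sub>C x = c *\<^sub>C x + d *\<^sub>C x"
    and scaleC_scaleC: "c *\<^sub>C d *\<^sub>C x = (c * d) *\<^sub>C x"
    and scaleC_of_real: "complex_of_real r *\<^sub>C x = r *\<^sub>R x"
    and norm_scaleC: "norm (c *\<^sub>C x) = norm c * norm x"

instantiation complex :: complex_banach
begin

definition scaleC_complex_def: "c *\<^sub>C (z::complex) = c * z"

instance
  by standard (auto simp: scaleC_complex_def algebra_simps norm_mult scaleR_conv_of_real)

end


section \<open>Bochner integration without separability\<close>

(* The library's Bochner integral requires a second countable target type, which would restrict
   the development to separable spaces. The definitions below are the library's ones, with Borel
   measurability replaced by strong measurability. Elements of the Bochner space are represented
   by functions; every class has a representative that is an everywhere limit of simple
   functions. *)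

definition strongly_measurable :: "'a measure \<Rightarrow> ('a \<Rightarrow> 'x::real_normed_vector) \<Rightarrow> bool" where
  "strongly_measurable M f \<longleftrightarrow>
     (\<exists>s. (\<forall>i. simple_function M (s i)) \<and> (\<forall>\<omega>\<in>space M. (\<lambda>i. s i \<omega>) \<longlonglongrightarrow> f \<omega>))"

definition bochner_L1 :: "'a measure \<Rightarrow> ('a \<Rightarrow> 'x::real_normed_vector) set" where
  "bochner_L1 M = {f. strongly_measurable M f \<and> integrable M (\<lambda>\<omega>. norm (f \<omega>))}"

definition L1_norm :: "'a measure \<Rightarrow> ('a \<Rightarrow> 'x::real_normed_vector) \<Rightarrow> real" where
  "L1_norm M f = (LINT \<omega>|M. norm (f \<omega>))"

definition has_strong_integral ::
    "'a measure \<Rightarrow> ('a \<Rightarrow> 'x::real_normed_vector) \<Rightarrow> 'x \<Rightarrow> bool" where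
  "has_strong_integral M f I \<longleftrightarrow> strongly_measurable M f \<and>
     (\<exists>s. (\<forall>i. Bochner_Integration.simple_bochner_integrable M (s i)) \<and>
          (\<lambda>i. \<integral>\<^sup>+ \<omega>. ennreal (norm (f \<omega> - s i \<omega>)) \<partial>M) \<longlonglongrightarrow> 0 \<and>
          (\<lambda>i. Bochner_Integration.simple_bochner_integral M (s i)) \<longlonglongrightarrow> I)"

(* F is a sub-sigma-algebra of M, given as a measure of which only space and sets matter;
   g is a version of the conditional expectation of f given F. *)
definition is_cond_exp ::
    "'a measure \<Rightarrow> 'a measure \<Rightarrow> ('a \<Rightarrow> 'x::real_normed_vector) \<Rightarrow> ('a \<Rightarrow> 'x) \<Rightarrow> bool" where
  "is_cond_exp M F f g \<longleftrightarrow> g \<in> bochner_L1 M \<and> strongly_measurable F g \<and>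
     (\<forall>A\<in>sets F. \<exists>I. has_strong_integral M (\<lambda>\<omega>. indicator A \<omega> *\<^sub>R f \<omega>) I \<and>
                      has_strong_integral M (\<lambda>\<omega>. indicator A \<omega> *\<^sub>R g \<omega>) I)"


section \<open>The circle and vector-valued Hardy spaces\<close>

(* normalized arc length, i.e. normalized Haar measure *)
definition circle :: "complex measure" where
  "circle = distr (uniform_measure lborel {0..<2 * pi}) (restrict_space borel (sphere 0 1)) cis"

lemma space_circle: "space circle = sphere 0 1"
  by (simp add: circle_def space_restrict_space)

lemma prob_space_circle: "prob_space circle"
proof -
  have meas: "cis \<in> measurable (uniform_measure lborel {0..<2 * pi}) (restrict_space borel (sphere 0 1))"
  proof (rule measurable_restrict_space2)
    have "cis \<in> borel_measurable borel"
      by (intro borel_measurable_continuous_onI continuous_intros)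
    then show "cis \<in> borel_measurable (uniform_measure lborel {0..<2 * pi})"
      by (simp add: measurable_def)
  qed auto
  have "prob_space (uniform_measure lborel {0..<2 * pi})"
    by (rule prob_space_uniform_measure) auto
  then show ?thesis
    unfolding circle_def by (rule prob_space.prob_space_distr) (rule meas)
qed

definition analytic_polynomials :: "(complex \<Rightarrow> 'x::complex_banach) set" where
  "analytic_polynomials = {p. \<exists>n x. p = (\<lambda>z. \<Sum>k\<le>n. (z ^ k) *\<^sub>C x k)}"

definition H1_tilde :: "(complex \<Rightarrow> 'x::complex_banach) set" where
  "H1_tilde = {F \<in> bochner_L1 circle.
     \<forall>e>0. \<exists>p\<in>analytic_polynomials. L1_norm circle (\<lambda>z. F z - p z) < e}"

abbreviation H1 :: "(complex \<Rightarrow> complex) set" where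
  "H1 \<equiv> H1_tilde"


section \<open>The projective tensor product of the scalar Hardy space with X\<close>

(* The list [(h1, x1), ..., (hn, xn)] stands for the sum of the hi \<otimes> xi. *)
type_synonym 'x formal_sum = "((complex \<Rightarrow> complex) \<times> 'x) list"

definition formal_sums :: "'x::complex_banach formal_sum set" where
  "formal_sums = {s. set s \<subseteq> H1 \<times> UNIV}"

(* Two formal sums represent the same element of the algebraic tensor product. Rule ae is there
   because elements of the Hardy space are functions modulo equality almost everywhere. *)
inductive tensor_eq :: "'x::complex_banach formal_sum \<Rightarrow> 'x formal_sum \<Rightarrow> bool" where
  refl: "s \<in> formal_sums \<Longrightarrow> tensor_eq s s"
| sym: "tensor_eq s t \<Longrightarrow> tensor_eq t s"
| trans: "tensor_eq s t \<Longrightarrow> tensor_eq t u \<Longrightarrow> tensor_eq s u"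
| append: "tensor_eq s s' \<Longrightarrow> tensor_eq t t' \<Longrightarrow> tensor_eq (s @ t) (s' @ t')"
| commute: "s \<in> formal_sums \<Longrightarrow> t \<in> formal_sums \<Longrightarrow> tensor_eq (s @ t) (t @ s)"
| zero: "h \<in> H1 \<Longrightarrow> tensor_eq [(h, 0)] []"
| add_left: "h \<in> H1 \<Longrightarrow> k \<in> H1 \<Longrightarrow> tensor_eq [(\<lambda>z. h z + k z, x)] [(h, x), (k, x)]"
| add_right: "h \<in> H1 \<Longrightarrow> tensor_eq [(h, x + y)] [(h, x), (h, y)]"
| scale: "h \<in> H1 \<Longrightarrow> tensor_eq [(\<lambda>z. c * h z, x)] [(h, c *\<^sub>C x)]"
| ae: "h \<in> H1 \<Longrightarrow> k \<in> H1 \<Longrightarrow> (AE z in circle. h z = k z) \<Longrightarrow> tensor_eq [(h, x)] [(k, x)]"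

definition tensor_diff :: "'x::complex_banach formal_sum \<Rightarrow> 'x formal_sum \<Rightarrow> 'x formal_sum" where
  "tensor_diff s t = s @ map (\<lambda>(h, x). (h, - x)) t"

definition proj_norm :: "'x::complex_banach formal_sum \<Rightarrow> real" where
  "proj_norm s = Inf {(\<Sum>(h, x)\<leftarrow>t. L1_norm circle h * norm x) | t. tensor_eq s t}"

(* Elements of the completion are represented by Cauchy sequences for the projective norm. *)
definition proj_tensor :: "(nat \<Rightarrow> 'x::complex_banach formal_sum) set" where
  "proj_tensor = {u. (\<forall>n. u n \<in> formal_sums) \<and>
     (\<forall>e>0. \<exists>N. \<forall>m\<ge>N. \<forall>n\<ge>N. proj_norm (tensor_diff (u m) (u n)) < e)}"

definition tensor_fun :: "'x::complex_banach formal_sum \<Rightarrow> complex \<Rightarrow> 'x" where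
  "tensor_fun s z = (\<Sum>(h, x)\<leftarrow>s. h z *\<^sub>C x)"

(* The canonical map on the completion is the continuous extension of tensor_fun; it is stated
   as a relation since its values are functions modulo equality almost everywhere. *)
definition canonical_image ::
    "(nat \<Rightarrow> 'x::complex_banach formal_sum) \<Rightarrow> (complex \<Rightarrow> 'x) \<Rightarrow> bool" where
  "canonical_image u F \<longleftrightarrow> (\<lambda>n. L1_norm circle (\<lambda>z. tensor_fun (u n) z - F z)) \<longlonglongrightarrow> 0"

definition H1_projective :: "'x::complex_banach itself \<Rightarrow> bool" where
  "H1_projective _ \<longleftrightarrow>
     (\<forall>F \<in> (H1_tilde :: (complex \<Rightarrow> 'x) set). \<exists>u\<in>proj_tensor. canonical_image u F)"


section \<open>Hardy martingales\<close>

(* The coordinates are indexed by the positive naturals. *)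
definition torus :: "(nat \<Rightarrow> complex) measure" where
  "torus = Pi\<^sub>M {1..} (\<lambda>_. circle)"

definition coord_algebra :: "nat \<Rightarrow> (nat \<Rightarrow> complex) measure" where
  "coord_algebra n =
     vimage_algebra (space torus) (\<lambda>\<omega>. restrict \<omega> {1..n}) (Pi\<^sub>M {1..n} (\<lambda>_. circle))"

definition torus_martingale :: "(nat \<Rightarrow> (nat \<Rightarrow> complex) \<Rightarrow> 'x::complex_banach) \<Rightarrow> bool" where
  "torus_martingale M \<longleftrightarrow>
     (\<forall>n. M n \<in> bochner_L1 torus \<and> strongly_measurable (coord_algebra n) (M n)) \<and>
     (\<forall>m n. m \<le> n \<longrightarrow> is_cond_exp torus (coord_algebra m) (M n) (M m))"

(* Since M n depends on the first n coordinates only, the condition below is one on almost every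
   choice of the first n - 1 coordinates. *)
definition hardy_martingale :: "(nat \<Rightarrow> (nat \<Rightarrow> complex) \<Rightarrow> 'x::complex_banach) \<Rightarrow> bool" where
  "hardy_martingale M \<longleftrightarrow> torus_martingale M \<and>
     (\<forall>n\<ge>1. AE \<omega> in torus. (\<lambda>\<theta>. M n (fun_upd \<omega> n \<theta>)) \<in> H1_tilde)"

definition mart_diff :: "(nat \<Rightarrow> 'a \<Rightarrow> 'x::real_normed_vector) \<Rightarrow> nat \<Rightarrow> 'a \<Rightarrow> 'x" where
  "mart_diff M n \<omega> = (if n = 0 then M 0 \<omega> else M n \<omega> - M (n - 1) \<omega>)"

definition UHMD :: "'x::complex_banach itself \<Rightarrow> bool" where
  "UHMD _ \<longleftrightarrow>
     (\<exists>K::real. \<forall>M :: nat \<Rightarrow> (nat \<Rightarrow> complex) \<Rightarrow> 'x. hardy_martingale M \<longrightarrow>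
        (\<forall>\<epsilon> :: nat \<Rightarrow> real. (\<forall>n. \<epsilon> n \<in> {1, -1}) \<longrightarrow>
          (\<forall>m. L1_norm torus (\<lambda>\<omega>. \<Sum>n\<le>m. \<epsilon> n *\<^sub>R mart_diff M n \<omega>) \<le> K * L1_norm torus (M m))))"

end

theory Submission
  imports Defs
begin

text \<open>
  The theorem splits into a scalar statement, the unconditionality of the differences of
  complex-valued Hardy martingales, and a transference argument that reduces the vector-valued
  statement to it. The constant obtained is \<open>4 * c\<close>, where \<open>c\<close> bounds the inverse of the
  canonical map.

  \<^emph>\<open>Scalar case.\<close> Put \<open>U x y = 4 * sqrt (\<bar>x\<bar>\<^sup>2 + \<delta>\<^sup>2) - sqrt (\<bar>x\<bar>\<^sup>2 + \<bar>y\<bar>\<^sup>2 + \<delta>\<^sup>2)\<close>. For all complex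
  \<open>x\<close> and \<open>y\<close> the functions \<open>t \<mapsto> U (x + t) (y \<plusminus> t)\<close> are subharmonic, so \<open>U\<close> has the sub-mean value
  property along \<open>(x + h, y \<plusminus> h)\<close> for every analytic polynomial \<open>h\<close> that vanishes at the origin
  (\<open>burkholder_fun_submean\<close>). Hence \<open>U (g n) (T n)\<close> is a submartingale when \<open>g\<close> is a Hardy martingale
  and \<open>T\<close> its transform by signs. It starts with a nonnegative value, and
  \<open>U x y \<le> 4 * \<bar>x\<bar> + 4 * \<delta> - \<bar>y\<bar>\<close>; this gives the constant 4 (\<open>scalar_hardy_unconditional\<close>).

  \<^emph>\<open>Reduction to polynomials.\<close> A Hardy martingale stopped at time \<open>m\<close> is approximated in the Bochner
  space by polynomials whose frequencies are zero or have a positive last nonzero coordinate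
  (\<open>hardy_martingale_approx\<close>): its other Fourier coefficients vanish, and Fejer means are
  contractions. Conditional expectations are contractions too, so all the differences are
  approximated at the same time.

  \<^emph>\<open>Projectivity.\<close> A Baire category argument turns the surjectivity of the canonical map into a
  bound: every analytic polynomial \<open>F\<close> is a limit of tensors \<open>\<Sum>h\<^sub>i \<otimes> x\<^sub>i\<close> with
  \<open>\<Sum>\<parallel>h\<^sub>i\<parallel> * \<parallel>x\<^sub>i\<parallel>\<close> at most about \<open>c * \<parallel>F\<parallel>\<close> (\<open>H1_projective_imp_proj_approx_norm\<close>).

  \<^emph>\<open>Transference.\<close> Let \<open>f\<close> be a polynomial as above, in the variables \<open>\<theta>\<^sub>1, \<dots>, \<theta>\<^sub>m\<close>. The substitution
  \<open>\<theta>\<^sub>j = \<eta>\<^sub>j * z ^ B ^ j\<close> with a large base \<open>B\<close> turns \<open>f\<close> into an analytic polynomial \<open>F\<close> in \<open>z\<close>, and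
  for a suitable choice of \<open>\<eta>\<close> its norm is at most that of \<open>f\<close>, up to an arbitrarily small error.
  Convolution along the curve \<open>z \<mapsto> (z ^ B ^ j)\<close> with a Fejer kernel maps a scalar function
  \<open>h\<close> in the Hardy space to a scalar Hardy polynomial on the torus, does not increase the norm,
  and almost inverts the substitution. It is applied to each \<open>h\<^sub>i\<close> in an almost optimal
  representation of \<open>F\<close>; the scalar case then bounds the transform of \<open>f\<close> by signs
  (\<open>hardy_polynomial_unconditional\<close>).
\<close>

section \<open>Strong measurability and strong integrals\<close>

lemma scaleC_zero_left [simp]: "0 *\<^sub>C (x::'x::complex_banach) = 0"
  using scaleC_of_real[of 0 x] by simp

lemma scaleC_zero_right [simp]: "c *\<^sub>C (0::'x::complex_banach) = 0"
  using scaleC_add_right[of c 0 "0::'x"] by simp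

lemma scaleC_one [simp]: "1 *\<^sub>C (x::'x::complex_banach) = x"
  using scaleC_of_real[of 1 x] by simp

lemma scaleC_minus_left: "(- c) *\<^sub>C (x::'x::complex_banach) = - (c *\<^sub>C x)"
  using scaleC_add_left[of "-c" c x] by (simp add: eq_neg_iff_add_eq_0)

lemma scaleC_minus_right: "c *\<^sub>C (- x) = - (c *\<^sub>C (x::'x::complex_banach))"
  using scaleC_add_right[of c "-x" x] by (simp add: eq_neg_iff_add_eq_0)

lemma scaleC_diff_left: "(c - d) *\<^sub>C (x::'x::complex_banach) = c *\<^sub>C x - d *\<^sub>C x"
  using scaleC_add_left[of c "-d" x] by (simp add: scaleC_minus_left)

lemma scaleC_diff_right: "c *\<^sub>C (x - y) = c *\<^sub>C x - c *\<^sub>C (y::'x::complex_banach)"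
  using scaleC_add_right[of c x "-y"] by (simp add: scaleC_minus_right)

lemma scaleC_sum_left: "(\<Sum>i\<in>I. c i) *\<^sub>C (x::'x::complex_banach) = (\<Sum>i\<in>I. c i *\<^sub>C x)"
  by (induction I rule: infinite_finite_induct) (auto simp: scaleC_add_left)

lemma scaleC_sum_right: "c *\<^sub>C (\<Sum>i\<in>I. x i) = (\<Sum>i\<in>I. c *\<^sub>C (x i :: 'x::complex_banach))"
  by (induction I rule: infinite_finite_induct) (auto simp: scaleC_add_right)

lemma scaleR_eq_scaleC: "r *\<^sub>R (x::'x::complex_banach) = complex_of_real r *\<^sub>C x"
  by (simp add: scaleC_of_real)

lemma scaleC_scaleR: "c *\<^sub>C r *\<^sub>R (x::'x::complex_banach) = r *\<^sub>R c *\<^sub>C x"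
  by (simp add: scaleR_eq_scaleC scaleC_scaleC mult.commute)

lemma bounded_bilinear_scaleC: "bounded_bilinear (\<lambda>c (x::'x::complex_banach). c *\<^sub>C x)"
proof
  show "(r *\<^sub>R a) *\<^sub>C b = r *\<^sub>R a *\<^sub>C (b::'x)" for r a b
    by (simp only: scaleR_eq_scaleC[of r "a *\<^sub>C b"] scaleC_scaleC scaleR_conv_of_real)
  show "\<exists>K. \<forall>a b. norm (a *\<^sub>C (b::'x)) \<le> norm a * norm b * K"
    by (rule exI[of _ 1]) (simp add: norm_scaleC)
qed (simp_all add: scaleC_add_left scaleC_add_right scaleC_scaleR)

lemmas tendsto_scaleC = bounded_bilinear.tendsto[OF bounded_bilinear_scaleC]

lemma strongly_measurable_simple:
  "simple_function M f \<Longrightarrow> strongly_measurable M f"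
  unfolding strongly_measurable_def by (intro exI[of _ "\<lambda>i. f"]) auto

text \<open>A binary operation that is sequentially continuous preserves strong measurability.\<close>

lemma strongly_measurable_compose2:
  assumes "strongly_measurable M f" "strongly_measurable M g"
    and p: "\<And>a b u v. (u \<longlonglongrightarrow> a) \<Longrightarrow> (v \<longlonglongrightarrow> b) \<Longrightarrow> (\<lambda>i. p (u i) (v i)) \<longlonglongrightarrow> p a b"
  shows "strongly_measurable M (\<lambda>\<omega>. p (f \<omega>) (g \<omega>))"
proof -
  obtain s t where s: "\<And>i. simple_function M (s i)" "\<And>\<omega>. \<omega>\<in>space M \<Longrightarrow> (\<lambda>i. s i \<omega>) \<longlonglongrightarrow> f \<omega>"
    and t: "\<And>i. simple_function M (t i)" "\<And>\<omega>. \<omega>\<in>space M \<Longrightarrow> (\<lambda>i. t i \<omega>) \<longlonglongrightarrow> g \<omega>"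
    using assms(1,2) unfolding strongly_measurable_def by blast
  show ?thesis unfolding strongly_measurable_def
  proof (intro exI[of _ "\<lambda>i \<omega>. p (s i \<omega>) (t i \<omega>)"] conjI allI ballI)
    show "simple_function M (\<lambda>\<omega>. p (s i \<omega>) (t i \<omega>))" for i
      by (rule simple_function_compose2[OF s(1) t(1)])
    show "(\<lambda>i. p (s i \<omega>) (t i \<omega>)) \<longlonglongrightarrow> p (f \<omega>) (g \<omega>)" if "\<omega> \<in> space M" for \<omega>
      by (rule p[OF s(2)[OF that] t(2)[OF that]])
  qed
qed

lemma strongly_measurable_const: "strongly_measurable M (\<lambda>_. c)"
  by (intro strongly_measurable_simple simple_function_const)

lemma strongly_measurable_add:
  "strongly_measurable M f \<Longrightarrow> strongly_measurable M g \<Longrightarrow> strongly_measurable M (\<lambda>\<omega>. f \<omega> + g \<omega>)"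
  by (rule strongly_measurable_compose2[where p="(+)"]) (simp_all add: tendsto_add)

lemma strongly_measurable_diff:
  "strongly_measurable M f \<Longrightarrow> strongly_measurable M g \<Longrightarrow> strongly_measurable M (\<lambda>\<omega>. f \<omega> - g \<omega>)"
  by (rule strongly_measurable_compose2[where p="(-)"]) (simp_all add: tendsto_diff)

lemma strongly_measurable_scaleC:
  "strongly_measurable M f \<Longrightarrow> strongly_measurable M g \<Longrightarrow> strongly_measurable M (\<lambda>\<omega>. f \<omega> *\<^sub>C g \<omega>)"
  by (rule strongly_measurable_compose2[where p="(*\<^sub>C)"]) (simp_all add: tendsto_scaleC)

lemma strongly_measurable_sum:
  "(\<And>i. i \<in> I \<Longrightarrow> strongly_measurable M (f i)) \<Longrightarrow> strongly_measurable M (\<lambda>\<omega>. \<Sum>i\<in>I. f i \<omega>)"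
  by (induction I rule: infinite_finite_induct)
     (auto intro: strongly_measurable_const strongly_measurable_add)

lemma strongly_measurable_norm:
  assumes "strongly_measurable M f" shows "(\<lambda>\<omega>. norm (f \<omega>)) \<in> borel_measurable M"
proof -
  obtain s where s: "\<And>i. simple_function M (s i)" "\<And>\<omega>. \<omega>\<in>space M \<Longrightarrow> (\<lambda>i. s i \<omega>) \<longlonglongrightarrow> f \<omega>"
    using assms unfolding strongly_measurable_def by blast
  show ?thesis
  proof (rule borel_measurable_LIMSEQ_real)
    show "(\<lambda>\<omega>. norm (s i \<omega>)) \<in> borel_measurable M" for i
      by (rule borel_measurable_simple_function[OF simple_function_compose1[OF s(1)]])
    show "(\<lambda>i. norm (s i \<omega>)) \<longlonglongrightarrow> norm (f \<omega>)" if "\<omega> \<in> space M" for \<omega>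
      by (intro tendsto_norm s that)
  qed
qed

lemma strongly_measurable_iff_borel:
  fixes f :: "'a \<Rightarrow> 'b::{second_countable_topology,real_normed_vector}"
  shows "strongly_measurable M f \<longleftrightarrow> f \<in> borel_measurable M"
proof
  assume "strongly_measurable M f"
  then obtain s where s: "\<And>i. simple_function M (s i)" "\<And>\<omega>. \<omega>\<in>space M \<Longrightarrow> (\<lambda>i. s i \<omega>) \<longlonglongrightarrow> f \<omega>"
    unfolding strongly_measurable_def by blast
  show "f \<in> borel_measurable M"
    by (rule borel_measurable_LIMSEQ_metric[OF borel_measurable_simple_function[OF s(1)] s(2)])
next
  assume "f \<in> borel_measurable M"
  from borel_measurable_implies_sequence_metric[OF this, of 0] 
  show "strongly_measurable M f" unfolding strongly_measurable_def by blast
qed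

lemma simple_function_subalgebra_mono:
  assumes "simple_function F f" "space F = space M" "sets F \<subseteq> sets M"
  shows "simple_function M f"
  using assms unfolding simple_function_def by auto

lemma strongly_measurable_scaleC_const:
  assumes "f \<in> borel_measurable M"
  shows "strongly_measurable M (\<lambda>\<omega>. f \<omega> *\<^sub>C x)"
  by (intro strongly_measurable_scaleC strongly_measurable_const)
     (use assms in \<open>simp add: strongly_measurable_iff_borel\<close>)

lemma bochner_L1_I:
  "strongly_measurable M f \<Longrightarrow> integrable M (\<lambda>\<omega>. norm (f \<omega>)) \<Longrightarrow> f \<in> bochner_L1 M"
  by (simp add: bochner_L1_def)

lemma bochner_L1_bounded:
  assumes "strongly_measurable M f" "integrable M g" "\<And>\<omega>. \<omega> \<in> space M \<Longrightarrow> norm (f \<omega>) \<le> g \<omega>"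
  shows "f \<in> bochner_L1 M"
proof (intro bochner_L1_I assms(1) Bochner_Integration.integrable_bound[OF assms(2)]
    strongly_measurable_norm AE_I2)
  show "norm (norm (f \<omega>)) \<le> norm (g \<omega>)" if "\<omega> \<in> space M" for \<omega>
    using assms(3)[OF that] by simp
qed

lemma bochner_L1_add:
  "f \<in> bochner_L1 M \<Longrightarrow> g \<in> bochner_L1 M \<Longrightarrow> (\<lambda>\<omega>. f \<omega> + g \<omega>) \<in> bochner_L1 M"
  by (rule bochner_L1_bounded[where g="\<lambda>\<omega>. norm (f \<omega>) + norm (g \<omega>)"])
     (auto simp: bochner_L1_def intro: strongly_measurable_add norm_triangle_ineq)

lemma bochner_L1_diff:
  "f \<in> bochner_L1 M \<Longrightarrow> g \<in> bochner_L1 M \<Longrightarrow> (\<lambda>\<omega>. f \<omega> - g \<omega>) \<in> bochner_L1 M"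
  by (rule bochner_L1_bounded[where g="\<lambda>\<omega>. norm (f \<omega>) + norm (g \<omega>)"])
     (auto simp: bochner_L1_def intro: strongly_measurable_diff norm_triangle_ineq4)

lemma bochner_L1_scaleC:
  "f \<in> bochner_L1 M \<Longrightarrow> (\<lambda>\<omega>. c *\<^sub>C f \<omega>) \<in> bochner_L1 M"
  by (rule bochner_L1_bounded[where g="\<lambda>\<omega>. norm c * norm (f \<omega>)"])
     (auto simp: bochner_L1_def norm_scaleC intro: strongly_measurable_scaleC strongly_measurable_const)

lemma bochner_L1_scaleR:
  fixes f :: "'a \<Rightarrow> 'x::complex_banach"
  shows "f \<in> bochner_L1 M \<Longrightarrow> (\<lambda>\<omega>. c *\<^sub>R f \<omega>) \<in> bochner_L1 M"
  unfolding scaleR_eq_scaleC by (rule bochner_L1_scaleC)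

lemma bochner_L1_zero: "(\<lambda>\<omega>. 0) \<in> bochner_L1 M"
  by (auto simp: bochner_L1_def intro: strongly_measurable_const)

lemma bochner_L1_sum:
  "(\<And>i. i \<in> I \<Longrightarrow> f i \<in> bochner_L1 M) \<Longrightarrow> (\<lambda>\<omega>. \<Sum>i\<in>I. f i \<omega>) \<in> bochner_L1 M"
  by (induction I rule: infinite_finite_induct) (auto intro: bochner_L1_zero bochner_L1_add)

lemma bochner_L1_scaleC_const:
  assumes "integrable M f" shows "(\<lambda>\<omega>. f \<omega> *\<^sub>C x) \<in> bochner_L1 M"
  by (rule bochner_L1_bounded[where g="\<lambda>\<omega>. norm (f \<omega>) * norm x"])
     (use assms in \<open>auto simp: norm_scaleC intro!: strongly_measurable_scaleC_const\<close>)

lemma bochner_L1_complex_iff: "f \<in> bochner_L1 M \<longleftrightarrow> integrable M (f :: 'a \<Rightarrow> complex)"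
  by (auto simp: bochner_L1_def strongly_measurable_iff_borel integrable_norm_iff)

lemma L1_norm_nonneg [simp]: "0 \<le> L1_norm M f"
  by (simp add: L1_norm_def)

lemma L1_norm_minus_commute: "L1_norm M (\<lambda>\<omega>. f \<omega> - g \<omega>) = L1_norm M (\<lambda>\<omega>. g \<omega> - f \<omega>)"
  by (simp add: L1_norm_def norm_minus_commute)

lemma L1_norm_add_le:
  assumes "f \<in> bochner_L1 M" "g \<in> bochner_L1 M"
  shows "L1_norm M (\<lambda>\<omega>. f \<omega> + g \<omega>) \<le> L1_norm M f + L1_norm M g"
proof -
  have "L1_norm M (\<lambda>\<omega>. f \<omega> + g \<omega>) \<le> (LINT \<omega>|M. norm (f \<omega>) + norm (g \<omega>))"
    unfolding L1_norm_def using assms bochner_L1_add[OF assms]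
    by (intro integral_mono) (auto simp: bochner_L1_def intro: norm_triangle_ineq)
  also have "\<dots> = L1_norm M f + L1_norm M g"
    unfolding L1_norm_def using assms by (intro Bochner_Integration.integral_add) (auto simp: bochner_L1_def)
  finally show ?thesis .
qed

lemma L1_norm_diff_le:
  assumes "f \<in> bochner_L1 M" "g \<in> bochner_L1 M"
  shows "L1_norm M (\<lambda>\<omega>. f \<omega> - g \<omega>) \<le> L1_norm M f + L1_norm M g"
proof -
  have "L1_norm M (\<lambda>\<omega>. f \<omega> - g \<omega>) \<le> (LINT \<omega>|M. norm (f \<omega>) + norm (g \<omega>))"
    unfolding L1_norm_def using assms bochner_L1_diff[OF assms]
    by (intro integral_mono) (auto simp: bochner_L1_def intro: norm_triangle_ineq4)
  also have "\<dots> = L1_norm M f + L1_norm M g"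
    unfolding L1_norm_def using assms by (intro Bochner_Integration.integral_add) (auto simp: bochner_L1_def)
  finally show ?thesis .
qed

lemma L1_norm_triangle:
  assumes "f \<in> bochner_L1 M" "g \<in> bochner_L1 M" "h \<in> bochner_L1 M"
  shows "L1_norm M (\<lambda>\<omega>. f \<omega> - h \<omega>) \<le> L1_norm M (\<lambda>\<omega>. f \<omega> - g \<omega>) + L1_norm M (\<lambda>\<omega>. g \<omega> - h \<omega>)"
  using L1_norm_add_le[OF bochner_L1_diff[OF assms(1,2)] bochner_L1_diff[OF assms(2,3)]] by simp

lemma L1_norm_le_add_diff:
  assumes "f \<in> bochner_L1 M" "g \<in> bochner_L1 M"
  shows "L1_norm M f \<le> L1_norm M g + L1_norm M (\<lambda>\<omega>. f \<omega> - g \<omega>)"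
  using L1_norm_add_le[OF assms(2) bochner_L1_diff[OF assms]] by simp

lemma L1_norm_scaleC: "L1_norm M (\<lambda>\<omega>. c *\<^sub>C f \<omega>) = norm c * L1_norm M f"
  by (simp add: L1_norm_def norm_scaleC)

lemma L1_norm_scaleC_const: "L1_norm M (\<lambda>\<omega>. f \<omega> *\<^sub>C x) = L1_norm M f * norm x"
  by (simp add: L1_norm_def norm_scaleC)

lemma L1_norm_scaleR: "L1_norm M (\<lambda>\<omega>. c *\<^sub>R f \<omega>) = \<bar>c\<bar> * L1_norm M f"
  by (simp add: L1_norm_def)

lemma L1_norm_sum_le:
  assumes "\<And>i. i \<in> I \<Longrightarrow> f i \<in> bochner_L1 M"
  shows "L1_norm M (\<lambda>\<omega>. \<Sum>i\<in>I. f i \<omega>) \<le> (\<Sum>i\<in>I. L1_norm M (f i))"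
  using assms
proof (induction I rule: infinite_finite_induct)
  case (insert i I)
  then show ?case
    using L1_norm_add_le[of "f i" M "\<lambda>\<omega>. \<Sum>i\<in>I. f i \<omega>"] bochner_L1_sum[of I f M] by fastforce
qed (auto simp: L1_norm_def)

lemma L1_norm_cong_AE:
  assumes "strongly_measurable M f" "strongly_measurable M g" "AE \<omega> in M. f \<omega> = g \<omega>"
  shows "L1_norm M f = L1_norm M g"
  unfolding L1_norm_def using assms(3)
  by (intro integral_cong_AE strongly_measurable_norm assms(1,2)) auto

lemma L1_norm_eq_nn_integral:
  "f \<in> bochner_L1 M \<Longrightarrow> ennreal (L1_norm M f) = (\<integral>\<^sup>+\<omega>. ennreal (norm (f \<omega>)) \<partial>M)"
  unfolding L1_norm_def bochner_L1_def by (intro nn_integral_eq_integral[symmetric]) auto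

lemma simple_bochner_integral_norm_le_nn_integral:
  fixes s :: "'a \<Rightarrow> 'x::real_normed_vector"
  assumes "Bochner_Integration.simple_bochner_integrable M s"
  shows "ennreal (norm (Bochner_Integration.simple_bochner_integral M s)) \<le> (\<integral>\<^sup>+\<omega>. ennreal (norm (s \<omega>)) \<partial>M)"
proof -
  have "ennreal (norm (Bochner_Integration.simple_bochner_integral M s)) \<le> ennreal (Bochner_Integration.simple_bochner_integral M (\<lambda>\<omega>. norm (s \<omega>)))"
    using simple_bochner_integral_norm_bound[OF assms] by (rule ennreal_leI)
  also have "\<dots> = (\<integral>\<^sup>+\<omega>. ennreal (norm (s \<omega>)) \<partial>M)"
    using simple_bochner_integrable_compose2[of "\<lambda>x y. norm x" M s s] assms
    by (intro simple_bochner_integral_eq_nn_integral) auto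
  finally show ?thesis .
qed

lemma simple_bochner_integrable_simple: "Bochner_Integration.simple_bochner_integrable M s \<Longrightarrow> simple_function M s"
  by (auto elim: simple_bochner_integrable.cases)

lemma has_strong_integral_norm_le_nn_integral:
  assumes "has_strong_integral M f I"
  shows "ennreal (norm I) \<le> (\<integral>\<^sup>+\<omega>. ennreal (norm (f \<omega>)) \<partial>M)"
proof -
  have f: "strongly_measurable M f" using assms by (simp add: has_strong_integral_def)
  obtain s where s: "\<And>i. Bochner_Integration.simple_bochner_integrable M (s i)"
      "(\<lambda>i. \<integral>\<^sup>+ \<omega>. ennreal (norm (f \<omega> - s i \<omega>)) \<partial>M) \<longlonglongrightarrow> 0"
      "(\<lambda>i. Bochner_Integration.simple_bochner_integral M (s i)) \<longlonglongrightarrow> I"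
    using assms unfolding has_strong_integral_def by blast
  have [measurable]: "(\<lambda>\<omega>. norm (f \<omega>)) \<in> borel_measurable M" by (rule strongly_measurable_norm[OF f])
  have m[measurable]: "(\<lambda>\<omega>. norm (f \<omega> - s i \<omega>)) \<in> borel_measurable M" for i
    by (intro strongly_measurable_norm strongly_measurable_diff f strongly_measurable_simple 
          simple_bochner_integrable_simple s)
  have "ennreal (norm (Bochner_Integration.simple_bochner_integral M (s i))) \<le> 
      (\<integral>\<^sup>+\<omega>. ennreal (norm (f \<omega>)) \<partial>M) + (\<integral>\<^sup>+ \<omega>. ennreal (norm (f \<omega> - s i \<omega>)) \<partial>M)" for i
  proof -
    have "ennreal (norm (Bochner_Integration.simple_bochner_integral M (s i))) \<le> (\<integral>\<^sup>+\<omega>. ennreal (norm (s i \<omega>)) \<partial>M)"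
      by (rule simple_bochner_integral_norm_le_nn_integral) fact
    also have "\<dots> \<le> (\<integral>\<^sup>+\<omega>. ennreal (norm (f \<omega>)) + ennreal (norm (f \<omega> - s i \<omega>)) \<partial>M)"
    proof (intro nn_integral_mono)
      fix \<omega>
      have "norm (s i \<omega>) \<le> norm (f \<omega>) + norm (f \<omega> - s i \<omega>)"
        using norm_triangle_ineq4[of "f \<omega>" "f \<omega> - s i \<omega>"] by simp
      then show "ennreal (norm (s i \<omega>)) \<le> ennreal (norm (f \<omega>)) + ennreal (norm (f \<omega> - s i \<omega>))"
        by (simp flip: ennreal_plus)
    qed
    also have "\<dots> = (\<integral>\<^sup>+\<omega>. ennreal (norm (f \<omega>)) \<partial>M) + (\<integral>\<^sup>+ \<omega>. ennreal (norm (f \<omega> - s i \<omega>)) \<partial>M)"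
      by (rule nn_integral_add) auto
    finally show ?thesis .
  qed
  moreover have "(\<lambda>i. (\<integral>\<^sup>+\<omega>. ennreal (norm (f \<omega>)) \<partial>M) + (\<integral>\<^sup>+ \<omega>. ennreal (norm (f \<omega> - s i \<omega>)) \<partial>M))
      \<longlonglongrightarrow> (\<integral>\<^sup>+\<omega>. ennreal (norm (f \<omega>)) \<partial>M) + 0"
    by (intro tendsto_add tendsto_const s)
  moreover have "(\<lambda>i. ennreal (norm (Bochner_Integration.simple_bochner_integral M (s i)))) \<longlonglongrightarrow> ennreal (norm I)"
    by (intro tendsto_ennrealI tendsto_norm s)
  ultimately show ?thesis
    using LIMSEQ_le[of "\<lambda>i. ennreal (norm (Bochner_Integration.simple_bochner_integral M (s i)))" "ennreal (norm I)"] by auto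
qed

lemma has_strong_integral_norm_le:
  assumes "has_strong_integral M f I" "integrable M (\<lambda>\<omega>. norm (f \<omega>))"
  shows "norm I \<le> L1_norm M f"
  using has_strong_integral_norm_le_nn_integral[OF assms(1)] nn_integral_eq_integral[OF assms(2)]
  by (simp add: L1_norm_def)

text \<open>Sums and differences of strong integrals, and products with a fixed vector, are instances of
  the following: \<open>p\<close> is Lipschitz and commutes with the integral of simple functions.\<close>

lemma has_strong_integral_compose2:
  fixes f :: "'a \<Rightarrow> 'x::real_normed_vector" and g :: "'a \<Rightarrow> 'x"
    and p :: "'x \<Rightarrow> 'x \<Rightarrow> 'z::real_normed_vector"
  assumes f: "has_strong_integral M f I" and g: "has_strong_integral M g J"
    and p0: "p 0 0 = 0"
    and lip: "\<And>a b a' b'. norm (p a b - p a' b') \<le> C * norm (a - a') + C * norm (b - b')"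
    and int: "\<And>s t. Bochner_Integration.simple_bochner_integrable M s \<Longrightarrow> Bochner_Integration.simple_bochner_integrable M t \<Longrightarrow>
       Bochner_Integration.simple_bochner_integral M (\<lambda>\<omega>. p (s \<omega>) (t \<omega>)) =
       p (Bochner_Integration.simple_bochner_integral M s) (Bochner_Integration.simple_bochner_integral M t)"
    and C: "C \<ge> 0"
  shows "has_strong_integral M (\<lambda>\<omega>. p (f \<omega>) (g \<omega>)) (p I J)"
proof -
  have lim: "(\<lambda>i. p (u i) (v i)) \<longlonglongrightarrow> p a b" if "u \<longlonglongrightarrow> a" "v \<longlonglongrightarrow> b" for u v a b
  proof -
    have "(\<lambda>i. C * norm (u i - a) + C * norm (v i - b)) \<longlonglongrightarrow> C * 0 + C * 0"
      by (intro tendsto_intros tendsto_norm_zero) (use that LIM_zero in auto)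
    then have "(\<lambda>i. C * norm (u i - a) + C * norm (v i - b)) \<longlonglongrightarrow> 0" by simp
    then have "(\<lambda>i. p (u i) (v i) - p a b) \<longlonglongrightarrow> 0"
      by (rule Lim_null_comparison[rotated]) (intro always_eventually allI lip)
    then show ?thesis by (rule LIM_zero_cancel)
  qed
  have fm: "strongly_measurable M f" and gm: "strongly_measurable M g" 
    using f g by (auto simp: has_strong_integral_def)
  obtain s where s: "\<And>i. Bochner_Integration.simple_bochner_integrable M (s i)"
      "(\<lambda>i. \<integral>\<^sup>+ \<omega>. ennreal (norm (f \<omega> - s i \<omega>)) \<partial>M) \<longlonglongrightarrow> 0"
      "(\<lambda>i. Bochner_Integration.simple_bochner_integral M (s i)) \<longlonglongrightarrow> I"
    using f unfolding has_strong_integral_def by blast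
  obtain t where t: "\<And>i. Bochner_Integration.simple_bochner_integrable M (t i)"
      "(\<lambda>i. \<integral>\<^sup>+ \<omega>. ennreal (norm (g \<omega> - t i \<omega>)) \<partial>M) \<longlonglongrightarrow> 0"
      "(\<lambda>i. Bochner_Integration.simple_bochner_integral M (t i)) \<longlonglongrightarrow> J"
    using g unfolding has_strong_integral_def by blast
  have m[measurable]: "(\<lambda>\<omega>. norm (f \<omega> - s i \<omega>)) \<in> borel_measurable M" for i
    by (intro strongly_measurable_norm strongly_measurable_diff fm strongly_measurable_simple 
          simple_bochner_integrable_simple s)
  have m'[measurable]: "(\<lambda>\<omega>. norm (g \<omega> - t i \<omega>)) \<in> borel_measurable M" for i
    by (intro strongly_measurable_norm strongly_measurable_diff gm strongly_measurable_simple 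
          simple_bochner_integrable_simple t)
  show ?thesis
    unfolding has_strong_integral_def
  proof (intro conjI exI[of _ "\<lambda>i \<omega>. p (s i \<omega>) (t i \<omega>)"] allI)
    show "strongly_measurable M (\<lambda>\<omega>. p (f \<omega>) (g \<omega>))"
      by (rule strongly_measurable_compose2[OF fm gm lim])
    show "Bochner_Integration.simple_bochner_integrable M (\<lambda>\<omega>. p (s i \<omega>) (t i \<omega>))" for i
      by (rule simple_bochner_integrable_compose2[of p, OF p0 s(1) t(1)])
    show "(\<lambda>i. Bochner_Integration.simple_bochner_integral M (\<lambda>\<omega>. p (s i \<omega>) (t i \<omega>))) \<longlonglongrightarrow> p I J"
      unfolding int[OF s(1) t(1)] by (rule lim[OF s(3) t(3)])
    have le: "(\<integral>\<^sup>+\<omega>. ennreal (norm (p (f \<omega>) (g \<omega>) - p (s i \<omega>) (t i \<omega>))) \<partial>M) \<le>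
        ennreal C * (\<integral>\<^sup>+\<omega>. ennreal (norm (f \<omega> - s i \<omega>)) \<partial>M) + ennreal C * (\<integral>\<^sup>+\<omega>. ennreal (norm (g \<omega> - t i \<omega>)) \<partial>M)" for i
    proof -
      have "(\<integral>\<^sup>+\<omega>. ennreal (norm (p (f \<omega>) (g \<omega>) - p (s i \<omega>) (t i \<omega>))) \<partial>M) \<le>
         (\<integral>\<^sup>+\<omega>. ennreal C * ennreal (norm (f \<omega> - s i \<omega>)) + ennreal C * ennreal (norm (g \<omega> - t i \<omega>)) \<partial>M)"
        using lip C by (intro nn_integral_mono) (simp flip: ennreal_plus ennreal_mult)
      also have "\<dots> = ennreal C * (\<integral>\<^sup>+\<omega>. ennreal (norm (f \<omega> - s i \<omega>)) \<partial>M) + ennreal C * (\<integral>\<^sup>+\<omega>. ennreal (norm (g \<omega> - t i \<omega>)) \<partial>M)"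
        by (simp add: nn_integral_add nn_integral_cmult)
      finally show ?thesis .
    qed
    have "(\<lambda>i. ennreal C * (\<integral>\<^sup>+\<omega>. ennreal (norm (f \<omega> - s i \<omega>)) \<partial>M) + ennreal C * (\<integral>\<^sup>+\<omega>. ennreal (norm (g \<omega> - t i \<omega>)) \<partial>M))
        \<longlonglongrightarrow> ennreal C * 0 + ennreal C * 0"
      by (intro tendsto_add ennreal_tendsto_cmult s t) auto
    then have lim0: "(\<lambda>i. ennreal C * (\<integral>\<^sup>+\<omega>. ennreal (norm (f \<omega> - s i \<omega>)) \<partial>M) + ennreal C * (\<integral>\<^sup>+\<omega>. ennreal (norm (g \<omega> - t i \<omega>)) \<partial>M))
        \<longlonglongrightarrow> 0" by simp
    show "(\<lambda>i. \<integral>\<^sup>+\<omega>. ennreal (norm (p (f \<omega>) (g \<omega>) - p (s i \<omega>) (t i \<omega>))) \<partial>M) \<longlonglongrightarrow> 0"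
      by (rule tendsto_sandwich[OF _ _ tendsto_const lim0]) (simp_all add: le)
  qed
qed

lemma has_strong_integral_add:
  assumes "has_strong_integral M f I" "has_strong_integral M g J"
  shows "has_strong_integral M (\<lambda>\<omega>. f \<omega> + g \<omega>) (I + J)"
  using assms
proof (rule has_strong_integral_compose2[where p="(+)" and C=1])
  show "norm (a + b - (a' + b')) \<le> 1 * norm (a - a') + 1 * norm (b - b')" for a b a' b' :: 'b
    using norm_triangle_ineq[of "a - a'" "b - b'"] by (simp add: algebra_simps)
qed (auto simp: simple_bochner_integral_add)

lemma has_strong_integral_diff:
  assumes "has_strong_integral M f I" "has_strong_integral M g J"
  shows "has_strong_integral M (\<lambda>\<omega>. f \<omega> - g \<omega>) (I - J)"
  using assms
proof (rule has_strong_integral_compose2[where p="(-)" and C=1])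
  show "norm (a - b - (a' - b')) \<le> 1 * norm (a - a') + 1 * norm (b - b')" for a b a' b' :: 'b
    using norm_triangle_ineq4[of "a - a'" "b - b'"] by (simp add: algebra_simps)
qed (auto simp: simple_bochner_integral_diff)

lemma has_strong_integral_zero: "has_strong_integral M (\<lambda>_. 0) 0"
  unfolding has_strong_integral_def
  by (intro conjI exI[of _ "\<lambda>i \<omega>. 0"] strongly_measurable_const) 
     (auto simp: simple_bochner_integral_def simple_bochner_integrable.simps intro!: tendsto_eventually sum.neutral)

lemma has_strong_integral_complex:
  fixes f :: "'a \<Rightarrow> complex"
  assumes "integrable M f"
  shows "has_strong_integral M f (integral\<^sup>L M f)"
proof -
  have "has_bochner_integral M f (integral\<^sup>L M f)"
    by (rule has_bochner_integral_integrable) fact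
  then show ?thesis
    by (cases rule: has_bochner_integral.cases)
       (auto simp: has_strong_integral_def strongly_measurable_iff_borel)
qed

lemma has_strong_integral_scaleC_const:
  fixes x :: "'x::complex_banach"
  assumes "integrable M f"
  shows "has_strong_integral M (\<lambda>\<omega>. f \<omega> *\<^sub>C x) (integral\<^sup>L M f *\<^sub>C x)"
  using has_strong_integral_complex[OF assms] has_strong_integral_complex[OF assms]
proof (rule has_strong_integral_compose2[where p="\<lambda>a b. a *\<^sub>C x" and C="norm x"])
  show "Bochner_Integration.simple_bochner_integral M (\<lambda>\<omega>. s \<omega> *\<^sub>C x) = Bochner_Integration.simple_bochner_integral M s *\<^sub>C x" 
    if "Bochner_Integration.simple_bochner_integrable M s" for s
  proof (rule simple_bochner_integral_linear[OF _ that])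
    show "linear (\<lambda>c. c *\<^sub>C x)" 
      using bounded_bilinear.bounded_linear_left[OF bounded_bilinear_scaleC, of x] 
      by (rule bounded_linear.linear)
  qed
qed (auto simp flip: scaleC_diff_left simp: norm_scaleC)

lemma has_strong_integral_sum:
  assumes "\<And>i. i \<in> I \<Longrightarrow> has_strong_integral M (f i) (J i)"
  shows "has_strong_integral M (\<lambda>\<omega>. \<Sum>i\<in>I. f i \<omega>) (\<Sum>i\<in>I. J i)"
  using assms
  by (induction I rule: infinite_finite_induct) (auto intro: has_strong_integral_zero has_strong_integral_add)

text \<open>The norm of a strong integral is at most the Bochner norm, in a form that mentions only scalar
  integrals; the estimates of Fourier coefficients below use it.\<close>

lemma norm_sum_integral_scaleC_le:
  fixes x :: "'i \<Rightarrow> 'x::complex_banach"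
  assumes "\<And>i. i \<in> I \<Longrightarrow> integrable M (f i)"
  shows "norm (\<Sum>i\<in>I. integral\<^sup>L M (f i) *\<^sub>C x i) \<le> L1_norm M (\<lambda>\<omega>. \<Sum>i\<in>I. f i \<omega> *\<^sub>C x i)"
proof (rule has_strong_integral_norm_le)
  show "has_strong_integral M (\<lambda>\<omega>. \<Sum>i\<in>I. f i \<omega> *\<^sub>C x i) (\<Sum>i\<in>I. integral\<^sup>L M (f i) *\<^sub>C x i)"
    by (intro has_strong_integral_sum has_strong_integral_scaleC_const assms)
  have "(\<lambda>\<omega>. \<Sum>i\<in>I. f i \<omega> *\<^sub>C x i) \<in> bochner_L1 M"
    by (intro bochner_L1_sum bochner_L1_scaleC_const assms)
  then show "integrable M (\<lambda>\<omega>. norm (\<Sum>i\<in>I. f i \<omega> *\<^sub>C x i))" by (simp add: bochner_L1_def)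
qed

section \<open>Haar measure on the circle and on the infinite torus\<close>

interpretation circle: prob_space circle by (rule prob_space_circle)

interpretation circle_product: product_prob_space "\<lambda>_::nat. circle" "{1..}"
  by unfold_locales

interpretation torus: prob_space torus
  unfolding torus_def by (rule prob_space_PiM) (rule prob_space_circle)

lemma sets_circle: "sets circle = sets (restrict_space borel (sphere 0 1))"
  by (simp add: circle_def)

lemma measurable_circle_borelI: "f \<in> borel_measurable borel \<Longrightarrow> f \<in> borel_measurable circle"
  by (subst measurable_cong_sets[OF sets_circle HOL.refl]) (rule measurable_restrict_space1)

lemma measurable_circle_ident [measurable]: "(\<lambda>z. z) \<in> borel_measurable circle"
  by (rule measurable_circle_borelI) simp

lemma space_torus: "space torus = ({1..} \<rightarrow>\<^sub>E sphere 0 1)"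
  by (simp add: torus_def space_PiM space_circle)

lemma measurable_into_circle:
  assumes "f \<in> borel_measurable M" "\<And>x. x \<in> space M \<Longrightarrow> norm (f x) = 1"
  shows "f \<in> measurable M circle"
  by (subst measurable_cong_sets[OF HOL.refl sets_circle], rule measurable_restrict_space2)
     (use assms in auto)

lemma measurable_cis_circle: "cis \<in> measurable borel circle"
  by (rule measurable_into_circle) (auto intro!: borel_measurable_continuous_onI continuous_intros)

lemma emeasure_circle:
  assumes "A \<in> sets circle"
  shows "emeasure circle A = emeasure lborel ({0..<2*pi} \<inter> cis -` A) / emeasure lborel {0..<2*pi}"
proof -
  have B: "cis -` A \<in> sets borel"
    using measurable_sets[OF measurable_cis_circle assms] by simp
  have "cis \<in> measurable (uniform_measure lborel {0..<2*pi}) (restrict_space borel (sphere 0 1))"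
    using measurable_cis_circle by (simp add: measurable_cong_sets[OF HOL.refl sets_circle, symmetric] 
        cong: measurable_cong_sets)
  then show ?thesis
    using assms B unfolding circle_def by (subst emeasure_distr) (auto simp: emeasure_uniform_measure)
qed

lemma emeasure_lborel_translate:
  assumes "B \<in> sets borel"
  shows "emeasure lborel ((\<lambda>x. x + c) -` B :: real set) = emeasure lborel B"
proof -
  have "emeasure lborel B = emeasure (distr lborel borel ((+) c)) B"
    by (simp add: lborel_distr_plus)
  also have "\<dots> = emeasure lborel ((+) c -` B)"
    using assms by (subst emeasure_distr) auto
  also have "(+) c -` B = (\<lambda>x. x + c) -` B" by (auto simp: add.commute)
  finally show ?thesis ..
qed

lemma emeasure_periodic_shift:
  assumes B: "B \<in> sets borel" and per: "\<And>t. t + p \<in> B \<longleftrightarrow> t \<in> B" and s: "0 \<le> s" "s < p"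
  shows "emeasure lborel ({0..<p} \<inter> (\<lambda>t. t + s) -` B) = emeasure lborel ({0..<p::real} \<inter> B)"
proof -
  have "emeasure lborel ({0..<p} \<inter> (\<lambda>t. t + s) -` B) = emeasure lborel ((\<lambda>t. t + s) -` ({s..<p+s} \<inter> B))"
    by (rule arg_cong[where f="emeasure lborel"]) auto
  also have "\<dots> = emeasure lborel ({s..<p+s} \<inter> B)"
    using B by (intro emeasure_lborel_translate) auto
  also have "{s..<p+s} \<inter> B = ({s..<p} \<inter> B) \<union> ({p..<p+s} \<inter> B)"
    using s by auto
  also have "emeasure lborel \<dots> = emeasure lborel ({s..<p} \<inter> B) + emeasure lborel ({p..<p+s} \<inter> B)"
    using B by (intro plus_emeasure[symmetric]) auto
  also have "emeasure lborel ({p..<p+s} \<inter> B) = emeasure lborel ((\<lambda>t. t + p) -` ({p..<p+s} \<inter> B))"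
    using B by (intro emeasure_lborel_translate[symmetric]) auto
  also have "(\<lambda>t. t + p) -` ({p..<p+s} \<inter> B) = {0..<s} \<inter> B" using per by auto
  also have "emeasure lborel ({s..<p} \<inter> B) + emeasure lborel ({0..<s} \<inter> B) =
      emeasure lborel (({s..<p} \<inter> B) \<union> ({0..<s} \<inter> B))"
    using B by (intro plus_emeasure) auto
  also have "({s..<p} \<inter> B) \<union> ({0..<s} \<inter> B) = {0..<p} \<inter> B" using s by auto
  finally show ?thesis .
qed

lemma measurable_circle_rotation: "norm c = 1 \<Longrightarrow> (\<lambda>z. c * z) \<in> measurable circle circle"
  by (rule measurable_into_circle) (auto simp: space_circle norm_mult)

lemma distr_circle_rotation:
  assumes c: "norm c = 1"
  shows "distr circle circle (\<lambda>z. c * z) = circle"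
proof (rule measure_eqI)
  fix A assume "A \<in> sets (distr circle circle (\<lambda>z. c * z))"
  then have A: "A \<in> sets circle" by simp
  obtain s where s: "0 \<le> s" "s < 2*pi" "c = cis s"
    using c Arg2pi_ge_0[of c] Arg2pi_lt_2pi[of c] Arg2pi_eq[of c] by (auto simp: cis_conv_exp)
  have B: "cis -` A \<in> sets borel"
    using measurable_sets[OF measurable_cis_circle A] by simp
  have A': "(\<lambda>z. c * z) -` A \<inter> space circle \<in> sets circle"
    by (rule measurable_sets[OF measurable_circle_rotation[OF c] A])
  have "emeasure (distr circle circle (\<lambda>z. c * z)) A = emeasure circle ((\<lambda>z. c * z) -` A \<inter> space circle)"
    by (rule emeasure_distr[OF measurable_circle_rotation[OF c] A])
  also have "\<dots> = emeasure lborel ({0..<2*pi} \<inter> cis -` ((\<lambda>z. c * z) -` A \<inter> space circle)) / emeasure lborel {0..<2*pi}"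
    by (rule emeasure_circle[OF A'])
  also have "cis -` ((\<lambda>z. c * z) -` A \<inter> space circle) = (\<lambda>t. t + s) -` (cis -` A)"
    by (auto simp: space_circle s cis_mult add.commute)
  also have "emeasure lborel ({0..<2*pi} \<inter> (\<lambda>t. t + s) -` (cis -` A)) = emeasure lborel ({0..<2*pi} \<inter> cis -` A)"
  proof (rule emeasure_periodic_shift[OF B _ s(1,2)])
    show "t + 2*pi \<in> cis -` A \<longleftrightarrow> t \<in> cis -` A" for t by (simp flip: cis_mult)
  qed
  also have "\<dots> / emeasure lborel {0..<2*pi} = emeasure circle A"
    by (rule emeasure_circle[OF A, symmetric])
  finally show "emeasure (distr circle circle (\<lambda>z. c * z)) A = emeasure circle A" .
qed simp

lemma borel_measurable_power_int [measurable (raw)]: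
  fixes f :: "'a \<Rightarrow> complex"
  assumes "f \<in> borel_measurable M" shows "(\<lambda>x. f x powi k) \<in> borel_measurable M"
  using assms by (cases "0 \<le> k") (simp_all add: power_int_def)

lemma integral_circle_power_int:
  assumes "k \<noteq> 0" shows "(LINT z|circle. z powi k) = 0"
proof -
  define c where "c = cis (pi / of_int k)"
  have c1: "norm c = 1" by (simp add: c_def)
  have ck: "c powi k = -1" using assms by (simp add: c_def cis_power_int)
  have m: "(\<lambda>z. z powi k) \<in> borel_measurable circle" by measurable
  have "(LINT z|circle. z powi k) = (LINT z|distr circle circle (\<lambda>z. c * z). z powi k)"
    by (simp add: distr_circle_rotation[OF c1])
  also have "\<dots> = (LINT z|circle. (c * z) powi k)"
    by (rule integral_distr[OF measurable_circle_rotation[OF c1] m])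
  also have "\<dots> = - (LINT z|circle. z powi k)"
    by (simp add: power_int_mult_distrib ck)
  finally show ?thesis by simp
qed

lemma integrable_circle_bounded:
  assumes "f \<in> borel_measurable circle" "\<And>z. norm z = 1 \<Longrightarrow> norm (f z) \<le> B"
  shows "integrable circle (f :: _ \<Rightarrow> 'b::{banach,second_countable_topology})"
  by (rule circle.integrable_const_bound[where B=B]) (use assms in \<open>auto simp: space_circle intro!: AE_I2\<close>)

lemma integrable_torus_bounded:
  assumes "f \<in> borel_measurable torus" "\<And>\<omega>. \<omega> \<in> space torus \<Longrightarrow> norm (f \<omega>) \<le> B"
  shows "integrable torus (f :: _ \<Rightarrow> 'b::{banach,second_countable_topology})"
  by (rule torus.integrable_const_bound[where B=B]) (use assms in \<open>auto intro!: AE_I2\<close>)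

lemma norm_torus_coordinate: "\<omega> \<in> space torus \<Longrightarrow> 1 \<le> j \<Longrightarrow> norm (\<omega> j) = 1"
  by (auto simp: space_torus PiE_iff)

lemma measurable_torus_coordinate_circle: "1 \<le> j \<Longrightarrow> (\<lambda>\<omega>. \<omega> j) \<in> measurable torus circle"
  unfolding torus_def by (rule measurable_component_singleton) auto

lemma measurable_torus_coordinate: "1 \<le> j \<Longrightarrow> (\<lambda>\<omega>. \<omega> j) \<in> borel_measurable torus"
  by (rule measurable_compose[OF measurable_torus_coordinate_circle measurable_circle_ident])

lemma measurable_into_torus:
  assumes "\<And>j. j \<ge> 1 \<Longrightarrow> (\<lambda>x. f x j) \<in> measurable M circle" "\<And>x. x \<in> space M \<Longrightarrow> f x \<in> extensional {1..}"
  shows "f \<in> measurable M torus"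
  unfolding torus_def
proof (rule measurable_PiM_single')
  show "f \<in> space M \<rightarrow> ({1..} \<rightarrow>\<^sub>E space circle)"
  proof
    fix x assume x: "x \<in> space M"
    show "f x \<in> {1..} \<rightarrow>\<^sub>E space circle"
      using measurable_space[OF assms(1) x] assms(2)[OF x] by (intro PiE_I) (auto simp: extensional_def)
  qed
qed (use assms in auto)

text \<open>Coordinatewise multiplication. The result is an element of the torus, so it has the default
  value \<open>undefined\<close> at the coordinate 0, which does not exist.\<close>

definition rotate_torus :: "(nat \<Rightarrow> complex) \<Rightarrow> (nat \<Rightarrow> complex) \<Rightarrow> nat \<Rightarrow> complex" where
  "rotate_torus \<eta> \<omega> = (\<lambda>j\<in>{1..}. \<eta> j * \<omega> j)"

lemma rotate_torus_apply [simp]: "1 \<le> j \<Longrightarrow> rotate_torus \<eta> \<omega> j = \<eta> j * \<omega> j"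
  by (simp add: rotate_torus_def)

lemma measurable_rotate_torus:
  assumes "\<And>j. 1 \<le> j \<Longrightarrow> norm (\<eta> j) = 1" 
  shows "rotate_torus \<eta> \<in> measurable torus torus"
proof (rule measurable_into_torus)
  fix j :: nat assume j: "1 \<le> j"
  show "(\<lambda>\<omega>. rotate_torus \<eta> \<omega> j) \<in> measurable torus circle"
    using measurable_compose[OF measurable_torus_coordinate_circle[OF j] measurable_circle_rotation[OF assms[OF j]]] j
    by simp
qed (auto simp: rotate_torus_def)

lemma distr_rotate_torus:
  assumes \<eta>: "\<And>j. 1 \<le> j \<Longrightarrow> norm (\<eta> j) = 1" 
  shows "distr torus torus (rotate_torus \<eta>) = torus"
proof -
  have "distr torus torus (rotate_torus \<eta>) = Pi\<^sub>M {1..} (\<lambda>_. circle)"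
  proof (rule circle_product.PiM_eq)
    show "sets (distr torus torus (rotate_torus \<eta>)) = sets (Pi\<^sub>M {1..} (\<lambda>_. circle))"
      by (simp add: torus_def)
    fix J :: "nat set" and F assume J: "finite J" "J \<subseteq> {1..}" and F: "\<And>j. j \<in> J \<Longrightarrow> F j \<in> sets circle"
    define F' where "F' j = (\<lambda>z. \<eta> j * z) -` F j \<inter> space circle" for j
    have F': "F' j \<in> sets circle" if "j \<in> J" for j
      unfolding F'_def using that J by (intro measurable_sets[OF measurable_circle_rotation F] \<eta>) auto
    have eq: "rotate_torus \<eta> -` prod_emb {1..} (\<lambda>_. circle) J (Pi\<^sub>E J F) \<inter> space torus =
          prod_emb {1..} (\<lambda>_. circle) J (Pi\<^sub>E J F')" (is "?L = ?R")
    proof -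
      have "\<omega> \<in> ?L \<longleftrightarrow> \<omega> \<in> ?R" for \<omega>
      proof (cases "\<omega> \<in> space torus")
        case True
        have r: "rotate_torus \<eta> \<omega> \<in> space torus"
          by (rule measurable_space[OF measurable_rotate_torus[OF \<eta>] True])
        have sp: "space torus = ({1..} \<rightarrow>\<^sub>E space circle)" by (simp add: torus_def space_PiM)
        have "\<omega> \<in> ?L \<longleftrightarrow> (\<forall>j\<in>J. rotate_torus \<eta> \<omega> j \<in> F j)"
          using True r J unfolding sp by (auto simp: prod_emb_def PiE_iff)
        also have "\<dots> \<longleftrightarrow> (\<forall>j\<in>J. \<omega> j \<in> F' j)"
          using True J unfolding sp F'_def by (intro ball_cong) (auto simp: PiE_iff)
        also have "\<dots> \<longleftrightarrow> \<omega> \<in> ?R"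
          using True J unfolding sp by (auto simp: prod_emb_def PiE_iff)
        finally show ?thesis .
      next
        case False
        then show ?thesis by (auto simp: prod_emb_def torus_def space_PiM)
      qed
      then show ?thesis by blast
    qed
    have "emeasure (distr torus torus (rotate_torus \<eta>)) (prod_emb {1..} (\<lambda>_. circle) J (Pi\<^sub>E J F)) =
       emeasure torus (prod_emb {1..} (\<lambda>_. circle) J (Pi\<^sub>E J F'))"
      unfolding eq[symmetric]
      by (intro emeasure_distr measurable_rotate_torus \<eta>)
         (use J F in \<open>auto simp: torus_def intro!: sets_PiM_I\<close>)
    also have "\<dots> = (\<Prod>j\<in>J. emeasure circle (F' j))"
      unfolding torus_def by (rule circle_product.emeasure_PiM_emb) (use J F' in auto)
    also have "\<dots> = (\<Prod>j\<in>J. emeasure circle (F j))"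
    proof (rule prod.cong[OF HOL.refl])
      fix j assume j: "j \<in> J"
      then have c: "norm (\<eta> j) = 1" using J by (intro \<eta>) auto
      show "emeasure circle (F' j) = emeasure circle (F j)"
        unfolding F'_def using emeasure_distr[OF measurable_circle_rotation[OF c] F[OF j]]
        by (simp add: distr_circle_rotation[OF c])
    qed
    finally show "emeasure (distr torus torus (rotate_torus \<eta>)) (prod_emb {1..} (\<lambda>_. circle) J (Pi\<^sub>E J F)) =
       (\<Prod>j\<in>J. emeasure circle (F j))" .
  qed
  then show ?thesis by (simp add: torus_def)
qed

lemma integral_rotate_torus:
  assumes "\<And>j. 1 \<le> j \<Longrightarrow> norm (\<eta> j) = 1" "f \<in> borel_measurable torus"
  shows "(LINT \<omega>|torus. f (rotate_torus \<eta> \<omega>)) = (LINT \<omega>|torus. f \<omega> :: 'b::{banach,second_countable_topology})"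
  using integral_distr[OF measurable_rotate_torus[OF assms(1)] assms(2)] distr_rotate_torus[OF assms(1)]
  by simp

lemma measurable_fun_upd_torus:
  assumes "1 \<le> n" shows "(\<lambda>(u, \<omega>). (fun_upd \<omega> n u)) \<in> measurable (circle \<Otimes>\<^sub>M torus) torus"
proof -
  have "insert n {1..} = {1..}" using assms by auto
  then show ?thesis
    using measurable_fun_upd[of "{1..}" "{1..}" n snd "circle \<Otimes>\<^sub>M torus" "\<lambda>_. circle" fst]
    by (simp add: case_prod_beta' torus_def insert_absorb)
qed

lemma distr_fun_upd_torus:
  assumes "1 \<le> n" shows "distr (circle \<Otimes>\<^sub>M torus) torus (\<lambda>(u, \<omega>). (fun_upd \<omega> n u)) = torus"
proof -
  have "insert n {1..} = {1..}" using assms by auto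
  then show ?thesis
    using distr_pair_PiM_eq_PiM[of "{1..}" "\<lambda>_. circle" n] prob_space_circle by (simp add: torus_def)
qed

interpretation pair_circle_torus: pair_prob_space circle torus ..

text \<open>Integration over the torus may start with any single coordinate.\<close>

lemma integral_torus_update:
  fixes f :: "(nat \<Rightarrow> complex) \<Rightarrow> 'b::{banach,second_countable_topology}"
  assumes "1 \<le> n" "integrable torus f"
  shows "integrable torus (\<lambda>\<omega>. LINT u|circle. f (fun_upd \<omega> n u))"
    and "(LINT \<omega>|torus. LINT u|circle. f (fun_upd \<omega> n u)) = (LINT \<omega>|torus. f \<omega>)"
    and "AE \<omega> in torus. integrable circle (\<lambda>u. f (fun_upd \<omega> n u))"
proof -
  have "integrable (distr (circle \<Otimes>\<^sub>M torus) torus (\<lambda>(u, \<omega>). (fun_upd \<omega> n u))) f"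
    using assms(2) distr_fun_upd_torus[OF assms(1)] by simp
  then have i: "integrable (circle \<Otimes>\<^sub>M torus) (\<lambda>(u, \<omega>). f (fun_upd \<omega> n u))"
    using integrable_distr_eq[OF measurable_fun_upd_torus[OF assms(1)], of f] assms(2)
    by (simp add: case_prod_beta')
  show "integrable torus (\<lambda>\<omega>. LINT u|circle. f (fun_upd \<omega> n u))"
    using pair_circle_torus.integrable_snd[OF i] .
  show "AE \<omega> in torus. integrable circle (\<lambda>u. f (fun_upd \<omega> n u))"
    using pair_circle_torus.AE_integrable_snd[OF i] .
  have "(LINT \<omega>|torus. LINT u|circle. f (fun_upd \<omega> n u)) = (LINT x|(circle \<Otimes>\<^sub>M torus). f (fun_upd (snd x) n (fst x)))"
    using pair_circle_torus.integral_snd[OF i] by (simp add: case_prod_beta')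
  also have "\<dots> = integral\<^sup>L (distr (circle \<Otimes>\<^sub>M torus) torus (\<lambda>(u, \<omega>). fun_upd \<omega> n u)) f"
    using integral_distr[OF measurable_fun_upd_torus[OF assms(1)], of f] assms(2)
    by (simp add: case_prod_beta')
  finally show "(LINT \<omega>|torus. LINT u|circle. f (fun_upd \<omega> n u)) = (LINT \<omega>|torus. f \<omega>)"
    using distr_fun_upd_torus[OF assms(1)] by simp
qed

section \<open>Characters and trigonometric polynomials on the torus\<close>

text \<open>The character \<open>\<theta> \<mapsto> \<theta>\<^sub>1 ^ a\<^sub>1 * \<dots> * \<theta>\<^sub>m ^ a\<^sub>m\<close>. A frequency is a function on all naturals;
  only its values at \<open>1, \<dots>, m\<close> matter for \<open>chi m\<close>.\<close>

definition chi :: "nat \<Rightarrow> (nat \<Rightarrow> int) \<Rightarrow> (nat \<Rightarrow> complex) \<Rightarrow> complex" where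
  "chi m a \<omega> = (\<Prod>j\<in>{1..m}. \<omega> j powi a j)"

text \<open>The frequencies of the characters that depend on the first \<open>m\<close> coordinates only, extended by 0
  to make the frequency of a character unique.\<close>

definition freqs :: "nat \<Rightarrow> (nat \<Rightarrow> int) set" where
  "freqs m = {a. \<forall>j. j \<notin> {1..m} \<longrightarrow> a j = 0}"

lemma measurable_chi [measurable]: "chi m a \<in> borel_measurable torus"
proof -
  have "(\<lambda>\<omega>. \<omega> j powi a j) \<in> borel_measurable torus" if "j \<in> {1..m}" for j
    using measurable_torus_coordinate[of j] that by (intro borel_measurable_power_int) auto
  then show ?thesis unfolding chi_def by (intro borel_measurable_prod) auto
qed

lemma norm_chi:
  assumes "\<And>j. 1 \<le> j \<Longrightarrow> norm (\<omega> j) = 1" shows "norm (chi m a \<omega>) = 1"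
proof -
  have "norm (chi m a \<omega>) = (\<Prod>j\<in>{1..m}. norm (\<omega> j) powi a j)"
    unfolding chi_def by (subst prod_norm[symmetric]) (simp only: norm_power_int)
  also have "\<dots> = (\<Prod>j\<in>{1..m}. 1)" by (intro prod.cong HOL.refl) (simp add: assms)
  finally show ?thesis by simp
qed

lemma norm_chi_torus [simp]: "\<omega> \<in> space torus \<Longrightarrow> norm (chi m a \<omega>) = 1"
  by (intro norm_chi norm_torus_coordinate)

lemma chi_add:
  assumes "\<And>j. 1 \<le> j \<Longrightarrow> \<omega> j \<noteq> 0" shows "chi m (\<lambda>j. a j + b j) \<omega> = chi m a \<omega> * chi m b \<omega>"
  unfolding chi_def prod.distrib[symmetric] by (intro prod.cong HOL.refl power_int_add) (use assms in auto)

lemma chi_diff: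
  assumes "\<And>j. 1 \<le> j \<Longrightarrow> norm (\<omega> j) = 1" shows "chi m (\<lambda>j. a j - b j) \<omega> = chi m a \<omega> * cnj (chi m b \<omega>)"
proof -
  have eq: "\<omega> j powi (a j - b j) = \<omega> j powi a j * cnj (\<omega> j powi b j)" if "j \<in> {1..m}" for j
  proof -
    have n: "norm (\<omega> j) = 1" using that assms by auto
    then have "\<omega> j \<noteq> 0" by auto
    have "norm (\<omega> j powi b j) = 1" by (simp add: norm_power_int n)
    then have "inverse (\<omega> j powi b j) = cnj (\<omega> j powi b j)"
      using complex_div_cnj[of 1 "\<omega> j powi b j"] unfolding inverse_eq_divide by simp
    then show ?thesis
      using power_int_diff[of "\<omega> j" "a j" "b j"] \<open>\<omega> j \<noteq> 0\<close> unfolding divide_inverse by simp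
  qed
  show ?thesis unfolding chi_def cnj_prod prod.distrib[symmetric]
    by (rule prod.cong[OF HOL.refl eq])
qed

lemma chi_rotate: "chi m a (rotate_torus \<eta> \<omega>) = chi m a \<eta> * chi m a \<omega>"
  unfolding chi_def prod.distrib[symmetric]
proof (rule prod.cong[OF HOL.refl])
  fix j assume "j \<in> {1..m}"
  then have "rotate_torus \<eta> \<omega> j = \<eta> j * \<omega> j" by (intro rotate_torus_apply) auto
  then show "rotate_torus \<eta> \<omega> j powi a j = \<eta> j powi a j * \<omega> j powi a j"
    by (simp only: power_int_mult_distrib)
qed

lemma chi_0 [simp]: "chi m (\<lambda>_. 0) \<omega> = 1"
  by (simp add: chi_def)

lemma chi_freqs_mono:
  assumes "a \<in> freqs n" "n \<le> m" shows "chi m a \<omega> = chi n a \<omega>"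
  unfolding chi_def using assms by (intro prod.mono_neutral_right) (auto simp: freqs_def)

lemma chi_fun_upd_other:
  assumes "a n = 0" shows "chi m a (fun_upd \<omega> n u) = chi m a \<omega>"
  unfolding chi_def using assms by (intro prod.cong) auto

lemma chi_fun_upd:
  assumes "1 \<le> n" "n \<le> m" shows "chi m a (fun_upd \<omega> n u) = chi m (fun_upd a n 0) \<omega> * u powi a n"
proof -
  have *: "{1..m} = insert n ({1..m} - {n})" using assms by auto
  show ?thesis unfolding chi_def
    by (subst (1 2) *, subst (1 2) prod.insert) (auto intro!: prod.cong simp: mult.commute)
qed

lemma freqs_mono: "n \<le> m \<Longrightarrow> freqs n \<subseteq> freqs m"
  by (force simp: freqs_def)

lemma freqs_0: "freqs 0 = {\<lambda>_. 0}"
  by (auto simp: freqs_def)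

lemma integrable_chi: "integrable torus (chi m a)"
  by (rule integrable_torus_bounded[where B=1]) auto

lemma integral_torus_eq_0_rotation:
  fixes f :: "(nat \<Rightarrow> complex) \<Rightarrow> complex"
  assumes "\<And>j. 1 \<le> j \<Longrightarrow> norm (\<eta> j) = 1" "f \<in> borel_measurable torus"
    and "\<And>\<omega>. \<omega> \<in> space torus \<Longrightarrow> f (rotate_torus \<eta> \<omega>) = c * f \<omega>" "c \<noteq> 1"
  shows "(LINT \<omega>|torus. f \<omega>) = 0"
proof -
  have "(LINT \<omega>|torus. f \<omega>) = (LINT \<omega>|torus. f (rotate_torus \<eta> \<omega>))"
    using integral_rotate_torus[OF assms(1,2)] by simp
  also have "\<dots> = (LINT \<omega>|torus. c * f \<omega>)"
    by (intro Bochner_Integration.integral_cong HOL.refl assms)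
  finally show ?thesis using assms(4) by simp
qed

text \<open>Characters with nonzero frequency at the \<open>n\<close>-th coordinate are orthogonal to the functions that do
  not depend on this coordinate.\<close>

lemma integral_torus_chi_mult_eq_0:
  fixes g :: "(nat \<Rightarrow> complex) \<Rightarrow> complex"
  assumes n: "1 \<le> n" "n \<le> m" "a n \<noteq> 0" and [measurable]: "g \<in> borel_measurable torus"
    and g: "\<And>\<omega> u. \<omega> \<in> space torus \<Longrightarrow> norm u = 1 \<Longrightarrow> g (fun_upd \<omega> n u) = g \<omega>"
  shows "(LINT \<omega>|torus. g \<omega> * chi m a \<omega>) = 0"
proof (rule integral_torus_eq_0_rotation)
  \<comment> \<open>Rotating the \<open>n\<close>-th coordinate by this angle changes the sign of the character.\<close>
  define \<eta> where "\<eta> = (\<lambda>j. if j = n then cis (pi / of_int (a n)) else 1)"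
  show "norm (\<eta> j) = 1" for j by (simp add: \<eta>_def)
  show "(\<lambda>\<omega>. g \<omega> * chi m a \<omega>) \<in> borel_measurable torus" by measurable
  have c: "chi m a \<eta> = -1"
  proof -
    have "chi m a \<eta> = (\<Prod>j\<in>{1..m}. if j = n then -1 else 1)"
      unfolding chi_def by (intro prod.cong HOL.refl) (use n in \<open>auto simp: \<eta>_def cis_power_int\<close>)
    then show ?thesis using n by simp
  qed
  show "-1 \<noteq> (1::complex)" by simp
  fix \<omega> assume \<omega>: "\<omega> \<in> space torus"
  have "rotate_torus \<eta> \<omega> = (fun_upd \<omega> n (cis (pi / of_int (a n)) * \<omega> n))"
    using n \<omega> by (auto simp: rotate_torus_def \<eta>_def fun_eq_iff space_torus PiE_iff extensional_def)
  then have "g (rotate_torus \<eta> \<omega>) = g \<omega>"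
    using \<omega> n by (simp add: g norm_mult norm_torus_coordinate)
  then show "g (rotate_torus \<eta> \<omega>) * chi m a (rotate_torus \<eta> \<omega>) = - 1 * (g \<omega> * chi m a \<omega>)"
    by (simp add: chi_rotate c)
qed

lemma integral_chi:
  assumes "a \<in> freqs m" shows "(LINT \<omega>|torus. chi m a \<omega>) = (if a = (\<lambda>_. 0) then 1 else 0)"
proof (cases "a = (\<lambda>_. 0)")
  case True
  then show ?thesis by (simp add: torus.prob_space)
next
  case False
  then obtain n where n0: "a n \<noteq> 0" by blast
  then have n: "1 \<le> n" "n \<le> m" "a n \<noteq> 0" using assms by (auto simp: freqs_def)
  show ?thesis using integral_torus_chi_mult_eq_0[where a=a and g="\<lambda>_. 1", OF n] False by simp
qed

section \<open>Unconditionality of scalar Hardy martingale differences\<close>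

lemma convex_bounded_left_imp_deriv_nonneg:
  fixes I I' I'' :: "real \<Rightarrow> real"
  assumes I: "\<And>s. (I has_real_derivative I' s) (at s)"
    and I': "\<And>s. (I' has_real_derivative I'' s) (at s)" "\<And>s. 0 \<le> I'' s"
    and B: "\<And>s. s \<le> 0 \<Longrightarrow> I s \<le> B"
  shows "0 \<le> I' s0"
proof (rule ccontr)
  assume "\<not> 0 \<le> I' s0"
  define d where "d = - I' s0"
  have d: "d > 0" using \<open>\<not> 0 \<le> I' s0\<close> by (simp add: d_def)
  have mono: "I' a \<le> I' b" if "a \<le> b" for a b
  proof (rule DERIV_nonneg_imp_nondecreasing[OF that])
    show "\<exists>y. DERIV I' x :> y \<and> 0 \<le> y" for x using I'(1)[of x] I'(2)[of x] by blast
  qed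
  \<comment> \<open>Far to the left of \<open>s0\<close>, a negative slope at \<open>s0\<close> would push \<open>I\<close> above its bound \<open>B\<close>.\<close>
  define C where "C = \<bar>B\<bar> + \<bar>I s0\<bar> + 1"
  define s where "s = min 0 s0 - C / d"
  have C: "C > 0" by (simp add: C_def)
  have s: "s \<le> 0" "s < s0" "C / d \<le> s0 - s" 
    using divide_pos_pos[OF C d] by (auto simp: s_def min_def)
  obtain z where z: "s < z" "z < s0" "I s0 - I s = (s0 - s) * I' z"
    using MVT2[OF s(2), of I I'] I by blast
  have "(s0 - s) * I' z \<le> (s0 - s) * (- d)"
    using mono[of z s0] z s by (intro mult_left_mono) (auto simp: d_def)
  also have "\<dots> \<le> (C / d) * (- d)"
    using s(3) d by (intro mult_right_mono_neg) auto
  also have "\<dots> = - C" using d by simp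
  finally have "I s \<ge> I s0 + C" using z(3) by simp
  moreover have "I s \<le> B" by (rule B[OF s(1)])
  ultimately show False unfolding C_def by linarith
qed

text \<open>In logarithmic polar coordinates \<open>z = exp (s + i * t)\<close> the circular mean of a subharmonic function is
  a convex function of \<open>s\<close>, because its second derivative is the mean of \<open>v\<^sub>s\<^sub>s \<ge> - v\<^sub>t\<^sub>t\<close> and the
  periodic function \<open>v\<^sub>t\<close> has mean derivative 0. As it is bounded above near \<open>-\<infinity>\<close>, it is increasing.\<close>

lemma subharmonic_integral_mono:
  fixes v vs vss vt vtt :: "real \<Rightarrow> real \<Rightarrow> real"
  assumes vs: "\<And>s t. ((\<lambda>s. v s t) has_real_derivative vs s t) (at s)"
    and vss: "\<And>s t. ((\<lambda>s. vs s t) has_real_derivative vss s t) (at s)"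
    and vtt: "\<And>s t. ((\<lambda>t. vt s t) has_real_derivative vtt s t) (at t)"
    and c: "continuous_on UNIV (\<lambda>(s, t). v s t)" "continuous_on UNIV (\<lambda>(s, t). vs s t)"
      "continuous_on UNIV (\<lambda>(s, t). vss s t)"
    and lap: "\<And>s t. 0 \<le> vss s t + vtt s t"
    and per: "\<And>s. vt s (2*pi) = vt s 0"
    and B: "\<And>s. s \<le> 0 \<Longrightarrow> integral {0..2*pi} (v s) \<le> B"
    and s: "s \<le> 0"
  shows "integral {0..2*pi} (v s) \<le> integral {0..2*pi} (v 0)"
proof -
  have int: "f s integrable_on cbox 0 (2*pi)" if "continuous_on UNIV (\<lambda>(s, t). f s t)" 
    for f :: "real \<Rightarrow> real \<Rightarrow> real" and s
  proof (rule integrable_continuous)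
    have "continuous_on (cbox 0 (2*pi)) ((\<lambda>(s, t). f s t) \<circ> (\<lambda>t. (s, t)))"
      by (intro continuous_on_compose[OF _ continuous_on_subset[OF that]] continuous_intros) auto
    then show "continuous_on (cbox 0 (2*pi)) (f s)" by (simp add: o_def)
  qed
  have deriv: "((\<lambda>s. integral (cbox 0 (2*pi)) (f s)) has_real_derivative integral (cbox 0 (2*pi)) (f' s)) (at s)"
    if "\<And>s t. ((\<lambda>s. f s t) has_real_derivative f' s t) (at s)"
      "continuous_on UNIV (\<lambda>(s, t). f s t)" "continuous_on UNIV (\<lambda>(s, t). f' s t)" for f f' s
  proof (rule leibniz_rule_field_derivative[where U=UNIV])
    show "continuous_on (UNIV \<times> cbox 0 (2*pi)) (\<lambda>(s, t). f' s t)"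
      by (rule continuous_on_subset[OF that(3)]) simp
  qed (use that(1) int[OF that(2)] in simp_all)
  define I where "I s = integral (cbox 0 (2*pi)) (v s)" for s
  define I' where "I' s = integral (cbox 0 (2*pi)) (vs s)" for s
  define I'' where "I'' s = integral (cbox 0 (2*pi)) (vss s)" for s
  have D: "(I has_real_derivative I' s) (at s)" "(I' has_real_derivative I'' s) (at s)" for s
    unfolding I_def I'_def I''_def using deriv[OF vs c(1,2)] deriv[OF vss c(2,3)] by simp_all
  have I'': "0 \<le> I'' s" for s
  proof -
    have "(vtt s has_integral (vt s (2*pi) - vt s 0)) {0..2*pi}"
      by (intro fundamental_theorem_of_calculus has_field_derivative_at_within[OF vtt, 
            unfolded has_real_derivative_iff_has_vector_derivative]) simp
    from has_integral_neg[OF this] have h1: "((\<lambda>t. - vtt s t) has_integral 0) {0..2*pi}"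
      by (simp add: per)
    have h2: "(vss s has_integral I'' s) {0..2*pi}"
      using int[OF c(3), of s] by (simp add: I''_def integrable_integral)
    show ?thesis
    proof (rule has_integral_le[OF h1 h2])
      show "- vtt s t \<le> vss s t" for t using lap[of s t] by simp
    qed
  qed
  have I'_nonneg: "0 \<le> I' s" for s
    by (rule convex_bounded_left_imp_deriv_nonneg[of I I' I'' B]) (use D I'' B in \<open>auto simp: I_def\<close>)
  have "\<exists>y. DERIV I x :> y \<and> 0 \<le> y" for x
    using D(1)[of x] I'_nonneg[of x] by blast
  then have "I s \<le> I 0" using DERIV_nonneg_imp_nondecreasing[OF s, of I] by simp
  then show ?thesis by (simp add: I_def)
qed

lemma integral_circle_eq_integral:
  fixes f :: "complex \<Rightarrow> real"
  assumes f: "continuous_on UNIV f"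
  shows "(LINT z|circle. f z) = integral {0..2*pi} (\<lambda>t. f (cis t)) / (2*pi)"
proof -
  have cis: "cis \<in> measurable (uniform_measure lborel {0..<2*pi}) (restrict_space borel (sphere 0 1))"
    using measurable_cis_circle by (simp add: measurable_cong_sets[OF HOL.refl sets_circle, symmetric] 
        cong: measurable_cong_sets)
  have fm: "f \<in> borel_measurable (restrict_space borel (sphere 0 1))"
    by (intro measurable_restrict_space1 borel_measurable_continuous_onI f)
  have c: "continuous_on UNIV (\<lambda>t. f (cis t))"
    by (rule continuous_on_compose2[OF f]) (auto intro!: continuous_intros)
  have d: "uniform_measure lborel {0..<2*pi} = density lborel (\<lambda>t. ennreal (indicator {0..<2*pi} t / (2*pi)))"
    unfolding uniform_measure_def
    by (rule density_cong) (auto simp: indicator_def divide_ennreal[symmetric] ennreal_1[symmetric] simp del: ennreal_1)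
  have "(LINT z|circle. f z) = (LINT t|uniform_measure lborel {0..<2*pi}. f (cis t))"
    unfolding circle_def by (rule integral_distr[OF cis fm])
  also have "\<dots> = (LINT t|lborel. (indicator {0..<2*pi} t / (2*pi)) *\<^sub>R f (cis t))"
    unfolding d by (rule integral_density) (auto intro!: borel_measurable_continuous_onI c AE_I2)
  also have "\<dots> = (LINT t|lborel. (indicator {0..2*pi} t *\<^sub>R f (cis t)) / (2*pi))"
  proof (rule integral_cong_AE)
    have "AE t in lborel. t \<noteq> 2*pi" by (rule AE_lborel_singleton)
    then show "AE t in lborel. (indicator {0..<2*pi} t / (2*pi)) *\<^sub>R f (cis t) = (indicator {0..2*pi} t *\<^sub>R f (cis t)) / (2*pi)"
      by eventually_elim (auto simp: indicator_def)
  qed (use borel_measurable_continuous_onI[OF c] in measurable)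
  also have "\<dots> = (LINT t:{0..2*pi}|lborel. f (cis t)) / (2*pi)"
    by (simp add: set_lebesgue_integral_def)
  also have "(LINT t:{0..2*pi}|lborel. f (cis t)) = integral {0..2*pi} (\<lambda>t. f (cis t))"
    by (intro set_borel_integral_eq_integral borel_integrable_atLeastAtMost' continuous_on_subset[OF c]) auto
  finally show ?thesis .
qed


text \<open>A special function in the sense of Burkholder's method, for the \<open>L\<^sup>1\<close> inequality between a
  Hardy martingale and its transforms by signs. The parameter \<open>\<delta>\<close> makes it smooth.\<close>

definition burkholder_fun :: "real \<Rightarrow> complex \<Rightarrow> complex \<Rightarrow> real" where
  "burkholder_fun \<delta> x y = 4 * sqrt ((cmod x)\<^sup>2 + \<delta>\<^sup>2) - sqrt ((cmod x)\<^sup>2 + (cmod y)\<^sup>2 + \<delta>\<^sup>2)"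

lemma continuous_burkholder_fun:
  "continuous_on S f \<Longrightarrow> continuous_on S g \<Longrightarrow> continuous_on S (\<lambda>x. burkholder_fun \<delta> (f x) (g x))"
  unfolding burkholder_fun_def by (intro continuous_intros)

lemma sqrt_deriv_twice:
  fixes A A1 A2 :: "real \<Rightarrow> real"
  assumes "(A has_real_derivative A1 s) (at s)" "(A1 has_real_derivative A2 s) (at s)" "A s > 0"
  shows "((\<lambda>s. sqrt (A s)) has_real_derivative A1 s / (2 * sqrt (A s))) (at s)"
    and "((\<lambda>s. A1 s / (2 * sqrt (A s))) has_real_derivative
           A2 s / (2 * sqrt (A s)) - (A1 s)\<^sup>2 / (4 * A s * sqrt (A s))) (at s)"
proof -
  show *: "((\<lambda>s. sqrt (A s)) has_real_derivative A1 s / (2 * sqrt (A s))) (at s)"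
    using assms(3) by (auto intro!: derivative_eq_intros assms(1) simp: divide_simps)
  have "((\<lambda>s. A1 s / (2 * sqrt (A s))) has_real_derivative 
      (A2 s * (2 * sqrt (A s)) - A1 s * (2 * (A1 s / (2 * sqrt (A s))))) / ((2 * sqrt (A s)) * (2 * sqrt (A s)))) (at s)"
    by (rule DERIV_divide[OF assms(2) DERIV_cmult[OF *]]) (use assms(3) in simp)
  also have "(A2 s * (2 * sqrt (A s)) - A1 s * (2 * (A1 s / (2 * sqrt (A s))))) / ((2 * sqrt (A s)) * (2 * sqrt (A s))) =
     A2 s / (2 * sqrt (A s)) - (A1 s)\<^sup>2 / (4 * A s * sqrt (A s))"
  proof -
    define r where "r = sqrt (A s)"
    have "A s = r * r" "r > 0" using assms(3) by (auto simp: r_def)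
    then show ?thesis unfolding r_def[symmetric] 
      by (simp add: field_simps power2_eq_square)
  qed
  finally show "((\<lambda>s. A1 s / (2 * sqrt (A s))) has_real_derivative
           A2 s / (2 * sqrt (A s)) - (A1 s)\<^sup>2 / (4 * A s * sqrt (A s))) (at s)" .
qed

text \<open>The Laplacian of \<open>sqrt A\<close> is \<open>\<Delta>A / (2 * sqrt A) - \<bar>\<nabla>A\<bar>\<^sup>2 / (4 * A * sqrt A)\<close>. Here \<open>N1 = \<bar>f\<bar>\<^sup>2\<close> and
  \<open>N2 = \<bar>g\<bar>\<^sup>2\<close> for analytic \<open>f\<close> and \<open>g\<close> with the same derivative, and \<open>E\<close> is the square of the modulus
  of that derivative. The Laplacian of the first root is at least \<open>E / sqrt A1\<close>, that of the second
  at most \<open>4 * E / sqrt A2\<close>; this is where the constant 4 comes from.\<close>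

lemma laplacian_burkholder_fun_nonneg:
  fixes E N1 N2 :: real
  assumes A1: "A1 = N1 + d" "A2 = N1 + N2 + d" and pos: "d > 0" "N1 \<ge> 0" "N2 \<ge> 0" "E \<ge> 0"
    and g1: "a1 = 4 * E" "p1\<^sup>2 + q1\<^sup>2 = 4 * N1 * E" and g2: "a2 = 8 * E"
  shows "0 \<le> 4 * (a1 / (2 * sqrt A1) - (p1\<^sup>2 + q1\<^sup>2) / (4 * A1 * sqrt A1))
           - (a2 / (2 * sqrt A2) - (p2\<^sup>2 + q2\<^sup>2) / (4 * A2 * sqrt A2))"
proof -
  have p: "A1 > 0" "A2 > 0" "A1 \<le> A2" using A1 pos by auto
  have "(p1\<^sup>2 + q1\<^sup>2) / (4 * A1 * sqrt A1) = (N1 / A1) * (E / sqrt A1)"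
    unfolding g1 using p by (simp add: field_simps)
  also have "\<dots> \<le> 1 * (E / sqrt A1)"
    using p pos A1 by (intro mult_right_mono) auto
  finally have T: "(p1\<^sup>2 + q1\<^sup>2) / (4 * A1 * sqrt A1) \<le> E / sqrt A1" by simp
  have "4 * E / (2 * sqrt A1) = 2 * (E / sqrt A1)" by simp
  with T have 1: "4 * (a1 / (2 * sqrt A1) - (p1\<^sup>2 + q1\<^sup>2) / (4 * A1 * sqrt A1)) \<ge> 4 * E / sqrt A1"
    unfolding g1(1) by (simp only: ring_distribs)
  have "a2 / (2 * sqrt A2) = 4 * E / sqrt A2" unfolding g2 by (simp add: field_simps)
  also have "\<dots> \<le> 4 * E / sqrt A1"
    using p pos by (intro divide_left_mono) auto
  finally have 2: "a2 / (2 * sqrt A2) \<le> 4 * E / sqrt A1" .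
  have "(p2\<^sup>2 + q2\<^sup>2) / (4 * A2 * sqrt A2) \<ge> 0" using p by simp
  then show ?thesis using 1 2 by linarith
qed

lemma burkholder_fun_submean:
  fixes c :: "'i \<Rightarrow> complex" and p :: "'i \<Rightarrow> nat" and x y :: complex
  assumes \<delta>: "\<delta> > 0" and p: "\<And>i. i \<in> J \<Longrightarrow> 1 \<le> p i"
  defines "h \<equiv> \<lambda>z. \<Sum>i\<in>J. c i * z ^ p i"
  shows "burkholder_fun \<delta> x y \<le> (LINT z|circle. burkholder_fun \<delta> (x + h z) (y + h z))"
proof -
  have h_eq: "h w = (\<Sum>i\<in>J. c i * w ^ p i)" for w by (simp add: h_def)
  define z where "z s t = exp (complex_of_real s) * cis t" for s t :: real
  define h1 where "h1 z = (\<Sum>i\<in>J. c i * of_nat (p i) * z ^ p i)" for z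
  define h2 where "h2 z = (\<Sum>i\<in>J. c i * of_nat (p i) * of_nat (p i) * z ^ p i)" for z
  define P Q P1 Q1 P2 Q2 where W: "P = (\<lambda>s t. Re (h (z s t)))" "Q = (\<lambda>s t. Im (h (z s t)))"
    "P1 = (\<lambda>s t. Re (h1 (z s t)))" "Q1 = (\<lambda>s t. Im (h1 (z s t)))"
    "P2 = (\<lambda>s t. Re (h2 (z s t)))" "Q2 = (\<lambda>s t. Im (h2 (z s t)))"
  have chain: "((\<lambda>r. \<Sum>i\<in>J. C i * g r ^ p i) has_vector_derivative k * (\<Sum>i\<in>J. C i * of_nat (p i) * g r ^ p i)) (at r)"
    if "(g has_vector_derivative k * g r) (at r)" for g :: "real \<Rightarrow> complex" and k r and C :: "'i \<Rightarrow> complex"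
  proof -
    have "((\<lambda>w. \<Sum>i\<in>J. C i * w ^ p i) has_field_derivative (\<Sum>i\<in>J. C i * (of_nat (p i) * g r ^ (p i - 1)))) (at (g r))"
      by (auto intro!: derivative_eq_intros sum.cong)
    from field_vector_diff_chain_at[OF that this]
    have "((\<lambda>r. \<Sum>i\<in>J. C i * g r ^ p i) has_vector_derivative k * g r * (\<Sum>i\<in>J. C i * (of_nat (p i) * g r ^ (p i - 1)))) (at r)"
      by (simp add: o_def)
    also have "k * g r * (\<Sum>i\<in>J. C i * (of_nat (p i) * g r ^ (p i - 1))) = k * (\<Sum>i\<in>J. C i * of_nat (p i) * g r ^ p i)"
    proof -
      have "k * g r * (C i * (of_nat (p i) * g r ^ (p i - 1))) = k * (C i * of_nat (p i) * g r ^ p i)" if "i \<in> J" for i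
        using p[OF that] by (cases "p i") auto
      then show ?thesis unfolding sum_distrib_left by (rule sum.cong[OF HOL.refl])
    qed
    finally show ?thesis .
  qed
  have zs: "((\<lambda>s. z s t) has_vector_derivative 1 * z s t) (at s)" for s t
    unfolding z_def by (auto intro!: derivative_eq_intros has_vector_derivative_real_field)
  have zt: "((\<lambda>t. z s t) has_vector_derivative \<i> * z s t) (at t)" for s t
  proof -
    have "(cis has_vector_derivative \<i> * cis t) (at t)"
      unfolding cis_conv_exp by (auto intro!: derivative_eq_intros has_vector_derivative_real_field)
    then show ?thesis unfolding z_def by (auto intro!: derivative_eq_intros)
  qed
  note re = bounded_linear.has_vector_derivative[OF bounded_linear_Re]
    and im = bounded_linear.has_vector_derivative[OF bounded_linear_Im]
  note hs = chain[OF zs, of c, folded h_eq h1_def] 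
    chain[OF zs, of "\<lambda>i. c i * of_nat (p i)", folded h1_def h2_def]
  note ht = chain[OF zt, of c, folded h_eq h1_def] 
    chain[OF zt, of "\<lambda>i. c i * of_nat (p i)", folded h1_def h2_def]
  have D: "((\<lambda>s. P s t) has_real_derivative P1 s t) (at s)" "((\<lambda>s. Q s t) has_real_derivative Q1 s t) (at s)"
    "((\<lambda>s. P1 s t) has_real_derivative P2 s t) (at s)" "((\<lambda>s. Q1 s t) has_real_derivative Q2 s t) (at s)"
    "((\<lambda>t. P s t) has_real_derivative - Q1 s t) (at t)" "((\<lambda>t. Q s t) has_real_derivative P1 s t) (at t)"
    "((\<lambda>t. P1 s t) has_real_derivative - Q2 s t) (at t)" "((\<lambda>t. Q1 s t) has_real_derivative P2 s t) (at t)"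
    for s t
    unfolding W has_real_derivative_iff_has_vector_derivative
    using re[OF hs(1)] im[OF hs(1)] re[OF hs(2)] im[OF hs(2)] re[OF ht(1)] im[OF ht(1)] re[OF ht(2)] im[OF ht(2)]
    by simp_all
  define N where "N w s t = (Re w + P s t)\<^sup>2 + (Im w + Q s t)\<^sup>2" for w s t
  define Ns where "Ns w s t = 2 * ((Re w + P s t) * P1 s t + (Im w + Q s t) * Q1 s t)" for w s t
  define Nt where "Nt w s t = 2 * ((Im w + Q s t) * P1 s t - (Re w + P s t) * Q1 s t)" for w s t
  define E where "E s t = (P1 s t)\<^sup>2 + (Q1 s t)\<^sup>2" for s t
  define R where "R w s t = (Re w + P s t) * P2 s t + (Im w + Q s t) * Q2 s t" for w s t
  define A where "A s t = N x s t + \<delta>\<^sup>2" for s t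
  define B where "B s t = N x s t + N y s t + \<delta>\<^sup>2" for s t
  have DN: "((\<lambda>s. N w s t) has_real_derivative Ns w s t) (at s)"
      "((\<lambda>s. Ns w s t) has_real_derivative 2 * (E s t + R w s t)) (at s)"
      "((\<lambda>t. N w s t) has_real_derivative Nt w s t) (at t)"
      "((\<lambda>t. Nt w s t) has_real_derivative 2 * (E s t - R w s t)) (at t)" for w s t
    unfolding N_def Ns_def Nt_def E_def R_def
    by (auto intro!: derivative_eq_intros D simp: algebra_simps power2_eq_square)
  have DA: "((\<lambda>s. A s t) has_real_derivative Ns x s t) (at s)" "((\<lambda>t. A s t) has_real_derivative Nt x s t) (at t)"
    and DB: "((\<lambda>s. B s t) has_real_derivative Ns x s t + Ns y s t) (at s)"
      "((\<lambda>s. Ns x s t + Ns y s t) has_real_derivative 2 * (E s t + R x s t) + 2 * (E s t + R y s t)) (at s)"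
      "((\<lambda>t. B s t) has_real_derivative Nt x s t + Nt y s t) (at t)"
      "((\<lambda>t. Nt x s t + Nt y s t) has_real_derivative 2 * (E s t - R x s t) + 2 * (E s t - R y s t)) (at t)" for s t
    unfolding A_def B_def by (auto intro!: derivative_eq_intros DN)
  have N_nonneg: "0 \<le> N w s t" for w s t by (simp add: N_def)
  have pos: "A s t > 0" "B s t > 0" for s t
    using N_nonneg[of x s t] N_nonneg[of y s t] \<delta> by (auto simp: A_def B_def add_nonneg_pos)
  have cont: "continuous_on UNIV (\<lambda>x. P (fst x) (snd x))" "continuous_on UNIV (\<lambda>x. Q (fst x) (snd x))"
     "continuous_on UNIV (\<lambda>x. P1 (fst x) (snd x))" "continuous_on UNIV (\<lambda>x. Q1 (fst x) (snd x))"
     "continuous_on UNIV (\<lambda>x. P2 (fst x) (snd x))" "continuous_on UNIV (\<lambda>x. Q2 (fst x) (snd x))"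
    unfolding W z_def h_def h1_def h2_def by (intro continuous_intros)+
  have contN: "continuous_on UNIV (\<lambda>x. N w (fst x) (snd x))" "continuous_on UNIV (\<lambda>x. Ns w (fst x) (snd x))"
     "continuous_on UNIV (\<lambda>x. E (fst x) (snd x))" "continuous_on UNIV (\<lambda>x. R w (fst x) (snd x))" for w
    unfolding N_def Ns_def E_def R_def by (intro continuous_intros cont)+
  have contA: "continuous_on UNIV (\<lambda>x. A (fst x) (snd x))" "continuous_on UNIV (\<lambda>x. B (fst x) (snd x))"
    unfolding A_def B_def by (intro continuous_intros contN)+
  have nz: "A s t \<noteq> 0" "B s t \<noteq> 0" for s t using pos[of s t] by auto
  define V where "V s t = burkholder_fun \<delta> (x + h (z s t)) (y + h (z s t))" for s t
  have V: "V s t = 4 * sqrt (A s t) - sqrt (B s t)" for s t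
    by (simp add: V_def burkholder_fun_def A_def B_def N_def W cmod_power2)
  \<comment> \<open>The circular mean over the circle of radius \<open>r\<close>; at \<open>r = 0\<close> it gives the value at the centre.\<close>
  define mv where "mv r = integral {0..2*pi} (\<lambda>t. burkholder_fun \<delta> (x + h (complex_of_real r * cis t)) (y + h (complex_of_real r * cis t)))" for r
  have Vmv: "integral {0..2*pi} (V s) = mv (exp s)" for s
    unfolding V_def mv_def z_def by (simp add: exp_of_real)
  have mvc: "continuous_on UNIV mv"
    unfolding mv_def cbox_interval[symmetric]
  proof (rule integral_continuous_on_param)
    show "continuous_on (UNIV \<times> cbox 0 (2*pi))
      (\<lambda>(r, t). burkholder_fun \<delta> (x + h (complex_of_real r * cis t)) (y + h (complex_of_real r * cis t)))"
      unfolding h_def case_prod_beta' by (intro continuous_burkholder_fun continuous_intros)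
  qed
  have "compact (mv ` {0..1})"
    by (intro compact_continuous_image continuous_on_subset[OF mvc]) auto
  from compact_imp_bounded[OF this] obtain Bd where "\<forall>r\<in>{0..1}. norm (mv r) \<le> Bd"
    by (auto simp: bounded_iff)
  then have Bd: "norm (mv r) \<le> Bd" if "r \<in> {0..1}" for r using that by blast
  define Vs where "Vs s t = 4 * (Ns x s t / (2 * sqrt (A s t))) - (Ns x s t + Ns y s t) / (2 * sqrt (B s t))" for s t
  define Vt where "Vt s t = 4 * (Nt x s t / (2 * sqrt (A s t))) - (Nt x s t + Nt y s t) / (2 * sqrt (B s t))" for s t
  define Vss where "Vss s t = 
    4 * (2 * (E s t + R x s t) / (2 * sqrt (A s t)) - (Ns x s t)\<^sup>2 / (4 * A s t * sqrt (A s t))) -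
    ((2 * (E s t + R x s t) + 2 * (E s t + R y s t)) / (2 * sqrt (B s t)) - 
        (Ns x s t + Ns y s t)\<^sup>2 / (4 * B s t * sqrt (B s t)))" for s t
  define Vtt where "Vtt s t = 
    4 * (2 * (E s t - R x s t) / (2 * sqrt (A s t)) - (Nt x s t)\<^sup>2 / (4 * A s t * sqrt (A s t))) -
    ((2 * (E s t - R x s t) + 2 * (E s t - R y s t)) / (2 * sqrt (B s t)) - 
        (Nt x s t + Nt y s t)\<^sup>2 / (4 * B s t * sqrt (B s t)))" for s t
  have DV: "((\<lambda>s. V s t) has_real_derivative Vs s t) (at s)"
      "((\<lambda>s. Vs s t) has_real_derivative Vss s t) (at s)"
      "((\<lambda>t. Vt s t) has_real_derivative Vtt s t) (at t)" for s t
  proof -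
    note sA = sqrt_deriv_twice[where A="\<lambda>s. A s t" and ?A1.0="\<lambda>s. Ns x s t" 
        and ?A2.0="\<lambda>s. 2 * (E s t + R x s t)", OF DA(1) DN(2) pos(1)]
      and sB = sqrt_deriv_twice[where A="\<lambda>s. B s t" and ?A1.0="\<lambda>s. Ns x s t + Ns y s t"
        and ?A2.0="\<lambda>s. 2 * (E s t + R x s t) + 2 * (E s t + R y s t)", OF DB(1) DB(2) pos(2)]
      and tA = sqrt_deriv_twice[where A="\<lambda>t. A s t" and ?A1.0="\<lambda>t. Nt x s t" 
        and ?A2.0="\<lambda>t. 2 * (E s t - R x s t)", OF DA(2) DN(4) pos(1)]
      and tB = sqrt_deriv_twice[where A="\<lambda>t. B s t" and ?A1.0="\<lambda>t. Nt x s t + Nt y s t"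
        and ?A2.0="\<lambda>t. 2 * (E s t - R x s t) + 2 * (E s t - R y s t)", OF DB(3) DB(4) pos(2)]
    show "((\<lambda>s. V s t) has_real_derivative Vs s t) (at s)"
      unfolding V Vs_def by (rule DERIV_diff[OF DERIV_cmult[OF sA(1)] sB(1)])
    show "((\<lambda>s. Vs s t) has_real_derivative Vss s t) (at s)"
      unfolding Vs_def Vss_def by (rule DERIV_diff[OF DERIV_cmult[OF sA(2)] sB(2)])
    show "((\<lambda>t. Vt s t) has_real_derivative Vtt s t) (at t)"
      unfolding Vt_def Vtt_def by (rule DERIV_diff[OF DERIV_cmult[OF tA(2)] tB(2)])
  qed
  have cV: "continuous_on UNIV (\<lambda>(s, t). V s t)" "continuous_on UNIV (\<lambda>(s, t). Vs s t)"
      "continuous_on UNIV (\<lambda>(s, t). Vss s t)"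
    unfolding V Vs_def Vss_def case_prod_beta' 
    by (intro continuous_intros contA contN; simp add: nz)+
  have lap: "0 \<le> Vss s t + Vtt s t" for s t
  proof -
    have "0 \<le> 4 * (4 * E s t / (2 * sqrt (A s t)) - ((Ns x s t)\<^sup>2 + (Nt x s t)\<^sup>2) / (4 * A s t * sqrt (A s t)))
       - (8 * E s t / (2 * sqrt (B s t)) - ((Ns x s t + Ns y s t)\<^sup>2 + (Nt x s t + Nt y s t)\<^sup>2) / (4 * B s t * sqrt (B s t)))"
    proof (rule laplacian_burkholder_fun_nonneg[where d="\<delta>\<^sup>2" and ?N1.0="N x s t" and ?N2.0="N y s t" and E="E s t"])
      show "(Ns x s t)\<^sup>2 + (Nt x s t)\<^sup>2 = 4 * N x s t * E s t"
        unfolding Ns_def Nt_def N_def E_def power2_eq_square by (simp add: algebra_simps)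
    qed (use \<delta> N_nonneg in \<open>simp_all add: A_def B_def E_def\<close>)
    also have "\<dots> = Vss s t + Vtt s t" 
      unfolding Vss_def Vtt_def add_divide_distrib diff_divide_distrib ring_distribs by simp
    finally show ?thesis .
  qed
  have per: "Vt s (2*pi) = Vt s 0" for s
  proof -
    have zper: "z s (2*pi) = z s 0" by (simp add: z_def)
    show ?thesis unfolding Vt_def A_def B_def Nt_def N_def W zper ..
  qed
  have Vbd: "integral {0..2*pi} (V s) \<le> Bd" if "s \<le> 0" for s
    using Bd[of "exp s"] that unfolding Vmv by (simp add: abs_le_iff)
  have mono: "mv (exp s) \<le> mv 1" if "s \<le> 0" for s
    using subharmonic_integral_mono[where v=V and vs=Vs and vss=Vss and vt=Vt and vtt=Vtt, OF DV cV lap per Vbd that]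
    unfolding Vmv by simp
  have "((\<lambda>s. mv (exp s)) \<longlongrightarrow> mv 0) at_bot"
    using mvc exp_at_bot by (intro isCont_tendsto_compose[of 0 mv]) (auto simp: continuous_on_eq_continuous_at)
  then have "mv 0 \<le> mv 1"
    by (rule tendsto_upperbound) (auto intro!: eventually_mono[OF eventually_le_at_bot[of 0]] mono)
  moreover have h0: "h 0 = 0" unfolding h_def
  proof (intro sum.neutral ballI)
    show "c i * 0 ^ p i = 0" if "i \<in> J" for i using p[OF that] by (cases "p i") auto
  qed
  then have "mv 0 = 2 * pi * burkholder_fun \<delta> x y" by (simp add: mv_def)
  moreover have "(LINT z|circle. burkholder_fun \<delta> (x + h z) (y + h z)) = mv 1 / (2 * pi)"
    unfolding mv_def by (subst integral_circle_eq_integral) 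
      (auto intro!: continuous_burkholder_fun continuous_intros simp: h_def)
  ultimately show ?thesis by (simp add: le_divide_eq mult.commute)
qed


text \<open>The frequencies whose last nonzero coordinate is the \<open>n\<close>-th and is positive there; for \<open>n = 0\<close>
  only the zero frequency is left. The characters with frequency in \<open>lead_freqs n\<close> span the
  \<open>n\<close>-th differences of the Hardy martingales.\<close>

definition lead_freqs :: "nat \<Rightarrow> (nat \<Rightarrow> int) set" where
  "lead_freqs n = {a \<in> freqs n. n = 0 \<or> 0 < a n}"

lemma lead_freqs_0: "lead_freqs 0 = {\<lambda>_. 0}"
  by (auto simp: lead_freqs_def freqs_0)

lemma lead_freqs_unique: 
  assumes "a \<in> lead_freqs n" "a \<in> lead_freqs k" shows "n = k"
proof (rule linorder_cases[of n k])
  show "n = k" if "n < k" using assms that by (auto simp: lead_freqs_def freqs_def)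
  show "n = k" if "k < n" using assms that by (auto simp: lead_freqs_def freqs_def)
qed

lemma burkholder_fun_bounded:
  assumes "cmod x \<le> C" "cmod y \<le> C"
  shows "\<bar>burkholder_fun \<delta> x y\<bar> \<le> 5 * sqrt (C\<^sup>2 + C\<^sup>2 + \<delta>\<^sup>2)"
proof -
  have "(cmod x)\<^sup>2 \<le> C\<^sup>2" "(cmod y)\<^sup>2 \<le> C\<^sup>2" using assms by (auto intro!: power_mono)
  then have "sqrt ((cmod x)\<^sup>2 + \<delta>\<^sup>2) \<le> sqrt (C\<^sup>2 + C\<^sup>2 + \<delta>\<^sup>2)"
    "sqrt ((cmod x)\<^sup>2 + (cmod y)\<^sup>2 + \<delta>\<^sup>2) \<le> sqrt (C\<^sup>2 + C\<^sup>2 + \<delta>\<^sup>2)"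
    using zero_le_power2[of C] by (intro real_sqrt_le_mono; linarith)+
  moreover have "0 \<le> sqrt ((cmod x)\<^sup>2 + \<delta>\<^sup>2)" "0 \<le> sqrt ((cmod x)\<^sup>2 + (cmod y)\<^sup>2 + \<delta>\<^sup>2)" by simp_all
  ultimately show ?thesis unfolding burkholder_fun_def by linarith
qed

lemma burkholder_fun_sign:
  assumes "e = 1 \<or> e = (-1::real)"
  shows "burkholder_fun \<delta> x (y + e *\<^sub>R h) = burkholder_fun \<delta> x (e *\<^sub>R y + h)"
proof -
  have "cmod (y + e *\<^sub>R h) = cmod (e *\<^sub>R y + h)"
    using assms norm_minus_commute[of y h] by auto
  then show ?thesis by (simp add: burkholder_fun_def)
qed

text \<open>The frequencies \<open>a i\<close> of the Hardy polynomial may repeat; the term \<open>i\<close> belongs to the difference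
  number \<open>l i\<close>.\<close>

lemma scalar_hardy_unconditional:
  fixes a :: "'i \<Rightarrow> nat \<Rightarrow> int" and c :: "'i \<Rightarrow> complex" and \<epsilon> :: "nat \<Rightarrow> real"
  assumes I: "finite I" and a: "\<And>i. i \<in> I \<Longrightarrow> a i \<in> lead_freqs (l i)" "\<And>i. i \<in> I \<Longrightarrow> l i \<le> m"
    and \<epsilon>: "\<And>n. \<epsilon> n \<in> {1, -1}"
  shows "L1_norm torus (\<lambda>\<omega>. \<Sum>i\<in>I. \<epsilon> (l i) *\<^sub>R (c i * chi m (a i) \<omega>)) \<le> 
           4 * L1_norm torus (\<lambda>\<omega>. \<Sum>i\<in>I. c i * chi m (a i) \<omega>)"
proof -
  define g where "g n \<omega> = (\<Sum>i\<in>{i\<in>I. l i \<le> n}. c i * chi m (a i) \<omega>)" for n \<omega>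
  define T where "T n \<omega> = (\<Sum>i\<in>{i\<in>I. l i \<le> n}. \<epsilon> (l i) *\<^sub>R (c i * chi m (a i) \<omega>))" for n \<omega>
  define C where "C = (\<Sum>i\<in>I. cmod (c i))"
  have e1: "\<bar>\<epsilon> n\<bar> = 1" for n using \<epsilon>[of n] by auto
  have bd: "cmod (g n \<omega>) \<le> C" "cmod (T n \<omega>) \<le> C" if "\<omega> \<in> space torus" for n \<omega>
  proof -
    have "cmod (g n \<omega>) \<le> (\<Sum>i\<in>{i\<in>I. l i \<le> n}. cmod (c i))"
      unfolding g_def using that by (intro sum_norm_le) (simp add: norm_mult)
    also have "\<dots> \<le> C" unfolding C_def using I by (intro sum_mono2) auto
    finally show "cmod (g n \<omega>) \<le> C" .
    have "cmod (T n \<omega>) \<le> (\<Sum>i\<in>{i\<in>I. l i \<le> n}. cmod (c i))"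
      unfolding T_def using that e1 by (intro sum_norm_le) (simp add: norm_mult)
    also have "\<dots> \<le> C" unfolding C_def using I by (intro sum_mono2) auto
    finally show "cmod (T n \<omega>) \<le> C" .
  qed
  have [measurable]: "g n \<in> borel_measurable torus" "T n \<in> borel_measurable torus" for n
    unfolding g_def T_def by measurable
  have [measurable]: "(\<lambda>\<omega>. burkholder_fun \<delta> (g n \<omega>) (T n \<omega>)) \<in> borel_measurable torus" for n \<delta>
    unfolding burkholder_fun_def by measurable
  have int: "integrable torus (\<lambda>\<omega>. burkholder_fun \<delta> (g n \<omega>) (T n \<omega>))" for n \<delta>
    by (rule integrable_torus_bounded[where B="5 * sqrt (C\<^sup>2 + C\<^sup>2 + \<delta>\<^sup>2)"])
       (use burkholder_fun_bounded[OF bd] in auto)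
  have nonneg: "0 \<le> (LINT \<omega>|torus. burkholder_fun \<delta> (g n \<omega>) (T n \<omega>))" if \<delta>: "\<delta> > 0" "n \<le> m" for \<delta> n
    using that(2)
  proof (induction n)
    case 0
    have "0 \<le> burkholder_fun \<delta> (g 0 \<omega>) (T 0 \<omega>)" for \<omega>
    proof -
      have "T 0 \<omega> = \<epsilon> 0 *\<^sub>R g 0 \<omega>" 
        unfolding T_def g_def scaleR_sum_right by (intro sum.cong) auto
      then have n: "cmod (T 0 \<omega>) = cmod (g 0 \<omega>)" by (simp add: e1)
      have "sqrt ((cmod (g 0 \<omega>))\<^sup>2 + (cmod (g 0 \<omega>))\<^sup>2 + \<delta>\<^sup>2) \<le> sqrt (16 * ((cmod (g 0 \<omega>))\<^sup>2 + \<delta>\<^sup>2))"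
        by (rule real_sqrt_le_mono) (use zero_le_power2[of "cmod (g 0 \<omega>)"] zero_le_power2[of \<delta>] in \<open>simp add: ring_distribs\<close>)
      also have "\<dots> = 4 * sqrt ((cmod (g 0 \<omega>))\<^sup>2 + \<delta>\<^sup>2)" unfolding real_sqrt_mult by simp
      finally show ?thesis unfolding burkholder_fun_def n by simp
    qed
    then show ?case by (intro Bochner_Integration.integral_nonneg)
  next
    case (Suc n)
    define N where "N = Suc n"
    have N: "1 \<le> N" "N \<le> m" using Suc.prems by (auto simp: N_def)
    have split: "(\<Sum>i\<in>{i\<in>I. l i \<le> N}. F i) = (\<Sum>i\<in>{i\<in>I. l i \<le> n}. F i) + (\<Sum>i\<in>{i\<in>I. l i = N}. F i)"
      for F :: "'i \<Rightarrow> complex"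
    proof -
      have "{i\<in>I. l i \<le> N} = {i\<in>I. l i \<le> n} \<union> {i\<in>I. l i = N}" by (auto simp: N_def)
      then show ?thesis using I by (simp add: sum.union_disjoint disjoint_iff N_def)
    qed
    have step: "burkholder_fun \<delta> (g n \<omega>) (T n \<omega>) \<le> (LINT u|circle. burkholder_fun \<delta> (g N (fun_upd \<omega> N u)) (T N (fun_upd \<omega> N u)))"
      if \<omega>: "\<omega> \<in> space torus" for \<omega>
    proof -
      define h where "h u = (\<Sum>i\<in>{i\<in>I. l i = N}. c i * chi m (fun_upd (a i) N 0) \<omega> * u ^ nat (a i N))" for u
      have other: "chi m (a i) (fun_upd \<omega> N u) = chi m (a i) \<omega>" if "i \<in> I" "l i \<le> n" for i u
        by (rule chi_fun_upd_other) (use a(1)[OF that(1)] that(2) in \<open>auto simp: lead_freqs_def freqs_def N_def\<close>)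
      have lead: "chi m (a i) (fun_upd \<omega> N u) = chi m (fun_upd (a i) N 0) \<omega> * u ^ nat (a i N)" if "i \<in> I" "l i = N" for i u
        using chi_fun_upd[OF N, of "a i" \<omega> u] a(1)[OF that(1)] that(2) N(1) by (auto simp: lead_freqs_def power_int_def)
      have gN: "g N (fun_upd \<omega> N u) = g n \<omega> + h u" for u
        unfolding g_def split h_def
        by (intro arg_cong2[where f="(+)"] sum.cong HOL.refl; simp add: other lead mult.assoc)
      have TN: "T N (fun_upd \<omega> N u) = T n \<omega> + \<epsilon> N *\<^sub>R h u" for u
        unfolding T_def split h_def scaleR_sum_right
        by (intro arg_cong2[where f="(+)"] sum.cong HOL.refl; simp add: other lead mult.assoc)
      have e: "\<epsilon> N = 1 \<or> \<epsilon> N = -1" using \<epsilon>[of N] by simp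
      have "burkholder_fun \<delta> (g n \<omega>) (T n \<omega>) = burkholder_fun \<delta> (g n \<omega>) (\<epsilon> N *\<^sub>R T n \<omega>)"
        by (simp add: burkholder_fun_def e1)
      also have "\<dots> \<le> (LINT u|circle. burkholder_fun \<delta> (g n \<omega> + h u) (\<epsilon> N *\<^sub>R T n \<omega> + h u))"
        unfolding h_def
      proof (rule burkholder_fun_submean[OF \<delta>(1)])
        show "1 \<le> nat (a i N)" if "i \<in> {i \<in> I. l i = N}" for i
          using that a(1)[of i] N(1) by (auto simp: lead_freqs_def)
      qed
      finally show ?thesis unfolding gN TN burkholder_fun_sign[OF e] .
    qed
    have "0 \<le> (LINT \<omega>|torus. burkholder_fun \<delta> (g n \<omega>) (T n \<omega>))" using Suc by simp
    also have "\<dots> \<le> (LINT \<omega>|torus. LINT u|circle. burkholder_fun \<delta> (g N (fun_upd \<omega> N u)) (T N (fun_upd \<omega> N u)))"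
      by (intro integral_mono int integral_torus_update(1)[OF N(1) int] step)
    also have "\<dots> = (LINT \<omega>|torus. burkholder_fun \<delta> (g N \<omega>) (T N \<omega>))"
      by (rule integral_torus_update(2)[OF N(1) int])
    finally show ?case by (simp add: N_def)
  qed
  have "{i\<in>I. l i \<le> m} = I" using a(2) by auto
  then have gT: "(\<lambda>\<omega>. \<Sum>i\<in>I. c i * chi m (a i) \<omega>) = g m" "(\<lambda>\<omega>. \<Sum>i\<in>I. \<epsilon> (l i) *\<^sub>R (c i * chi m (a i) \<omega>)) = T m"
    by (auto simp: g_def T_def fun_eq_iff)
  have ig: "integrable torus (\<lambda>\<omega>. cmod (g m \<omega>))" "integrable torus (\<lambda>\<omega>. cmod (T m \<omega>))"
    by (rule integrable_torus_bounded[where B=C]; use bd in auto)+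
  show ?thesis unfolding gT
  proof (rule field_le_epsilon)
    fix e :: real assume "e > 0"
    define \<delta> where "\<delta> = e / 4"
    have \<delta>: "\<delta> > 0" using \<open>e > 0\<close> by (simp add: \<delta>_def)
    have pt: "burkholder_fun \<delta> x y \<le> 4 * cmod x + 4 * \<delta> - cmod y" for x y
    proof -
      have "sqrt ((cmod x)\<^sup>2 + \<delta>\<^sup>2) \<le> cmod x + \<delta>"
        using \<delta> by (intro real_le_lsqrt) (auto simp: power2_sum)
      moreover have "cmod y \<le> sqrt ((cmod x)\<^sup>2 + (cmod y)\<^sup>2 + \<delta>\<^sup>2)"
        by (rule real_le_rsqrt) simp
      ultimately show ?thesis unfolding burkholder_fun_def by linarith
    qed
    have "0 \<le> (LINT \<omega>|torus. burkholder_fun \<delta> (g m \<omega>) (T m \<omega>))" by (rule nonneg[OF \<delta>]) simp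
    also have "\<dots> \<le> (LINT \<omega>|torus. 4 * cmod (g m \<omega>) + 4 * \<delta> - cmod (T m \<omega>))"
      by (intro integral_mono int pt) (use ig in auto)
    also have "\<dots> = 4 * L1_norm torus (g m) + 4 * \<delta> - L1_norm torus (T m)"
      using ig by (simp add: L1_norm_def torus.prob_space)
    finally show "L1_norm torus (T m) \<le> 4 * L1_norm torus (g m) + e" by (simp add: \<delta>_def)
  qed
qed

section \<open>Density of the trigonometric polynomials in the Bochner space\<close>

lemma bochner_L1_cong:
  assumes "\<And>\<omega>. \<omega> \<in> space M \<Longrightarrow> f \<omega> = g \<omega>"
  shows "f \<in> bochner_L1 M \<longleftrightarrow> g \<in> bochner_L1 M"
proof -
  have "strongly_measurable M f \<longleftrightarrow> strongly_measurable M g"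
    unfolding strongly_measurable_def using assms by simp
  moreover have "integrable M (\<lambda>\<omega>. norm (f \<omega>)) \<longleftrightarrow> integrable M (\<lambda>\<omega>. norm (g \<omega>))"
    by (rule Bochner_Integration.integrable_cong[OF HOL.refl]) (simp add: assms)
  ultimately show ?thesis by (simp add: bochner_L1_def)
qed

lemma L1_norm_cong: "(\<And>\<omega>. \<omega> \<in> space M \<Longrightarrow> f \<omega> = g \<omega>) \<Longrightarrow> L1_norm M f = L1_norm M g"
  unfolding L1_norm_def by (rule Bochner_Integration.integral_cong[OF HOL.refl]) simp

text \<open>Trigonometric polynomials in the first \<open>m\<close> coordinates, with coefficients in \<open>'x\<close>.\<close>

definition trig :: "nat \<Rightarrow> ((nat \<Rightarrow> complex) \<Rightarrow> 'x::complex_banach) \<Rightarrow> bool" where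
  "trig m f \<longleftrightarrow> (\<exists>S x. finite S \<and> S \<subseteq> freqs m \<and> (\<forall>\<omega>\<in>space torus. f \<omega> = (\<Sum>a\<in>S. chi m a \<omega> *\<^sub>C x a)))"

text \<open>The closure of the trigonometric polynomials in the Bochner space.\<close>

definition trig_approx :: "nat \<Rightarrow> ((nat \<Rightarrow> complex) \<Rightarrow> 'x::complex_banach) \<Rightarrow> bool" where
  "trig_approx m f \<longleftrightarrow> f \<in> bochner_L1 torus \<and> (\<forall>e>0. \<exists>g. trig m g \<and> L1_norm torus (\<lambda>\<omega>. f \<omega> - g \<omega>) < e)"

lemma bochner_L1_chi_sum: "(\<lambda>\<omega>. \<Sum>a\<in>S. chi m a \<omega> *\<^sub>C x a) \<in> bochner_L1 torus"
  by (rule bochner_L1_sum, rule bochner_L1_scaleC_const, rule integrable_chi)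

lemma trig_bochner_L1: assumes "trig m f" shows "f \<in> bochner_L1 torus"
proof -
  obtain S x where "\<And>\<omega>. \<omega> \<in> space torus \<Longrightarrow> f \<omega> = (\<Sum>a\<in>S. chi m a \<omega> *\<^sub>C x a)"
    using assms unfolding trig_def by blast
  from bochner_L1_cong[of torus f, OF this] show ?thesis using bochner_L1_chi_sum by blast
qed

lemma trig_cong: "(\<And>\<omega>. \<omega> \<in> space torus \<Longrightarrow> f \<omega> = g \<omega>) \<Longrightarrow> trig m f \<Longrightarrow> trig m g"
  unfolding trig_def by metis

lemma trig_char: "a \<in> freqs m \<Longrightarrow> trig m (\<lambda>\<omega>. chi m a \<omega> *\<^sub>C x)"
  unfolding trig_def by (intro exI[of _ "{a}"] exI[of _ "\<lambda>_. x"]) auto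

lemma zero_freq: "(\<lambda>_. 0) \<in> freqs m"
  by (simp add: freqs_def)

lemma trig_const: "trig m (\<lambda>\<omega>. x)"
  using trig_char[OF zero_freq, of m x] by simp

lemma trig_add:
  assumes "trig m f" "trig m g" shows "trig m (\<lambda>\<omega>. f \<omega> + g \<omega>)"
proof -
  obtain S x where S: "finite S" "S \<subseteq> freqs m" "\<And>\<omega>. \<omega> \<in> space torus \<Longrightarrow> f \<omega> = (\<Sum>a\<in>S. chi m a \<omega> *\<^sub>C x a)"
    using assms(1) unfolding trig_def by blast
  obtain T y where T: "finite T" "T \<subseteq> freqs m" "\<And>\<omega>. \<omega> \<in> space torus \<Longrightarrow> g \<omega> = (\<Sum>a\<in>T. chi m a \<omega> *\<^sub>C y a)"
    using assms(2) unfolding trig_def by blast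
  define x' where "x' a = (if a \<in> S then x a else 0)" for a
  define y' where "y' a = (if a \<in> T then y a else 0)" for a
  have "f \<omega> + g \<omega> = (\<Sum>a\<in>S \<union> T. chi m a \<omega> *\<^sub>C (x' a + y' a))" if "\<omega> \<in> space torus" for \<omega>
  proof -
    have "f \<omega> = (\<Sum>a\<in>S. chi m a \<omega> *\<^sub>C x' a)"
      unfolding S(3)[OF that] by (rule sum.cong) (auto simp: x'_def)
    also have "\<dots> = (\<Sum>a\<in>S \<union> T. chi m a \<omega> *\<^sub>C x' a)"
      by (rule sum.mono_neutral_left) (use S T in \<open>auto simp: x'_def\<close>)
    finally have f: "f \<omega> = (\<Sum>a\<in>S \<union> T. chi m a \<omega> *\<^sub>C x' a)" .
    have "g \<omega> = (\<Sum>a\<in>T. chi m a \<omega> *\<^sub>C y' a)"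
      unfolding T(3)[OF that] by (rule sum.cong) (auto simp: y'_def)
    also have "\<dots> = (\<Sum>a\<in>S \<union> T. chi m a \<omega> *\<^sub>C y' a)"
      by (rule sum.mono_neutral_left) (use S T in \<open>auto simp: y'_def\<close>)
    finally show ?thesis using f by (simp add: scaleC_add_right sum.distrib)
  qed
  then show ?thesis unfolding trig_def using S T by (intro exI[of _ "S \<union> T"] exI[of _ "\<lambda>a. x' a + y' a"]) auto
qed

lemma trig_sum: "(\<And>i. i \<in> I \<Longrightarrow> trig m (f i)) \<Longrightarrow> trig m (\<lambda>\<omega>. \<Sum>i\<in>I. f i \<omega>)"
  by (induction I rule: infinite_finite_induct) (auto intro: trig_const trig_add)

lemma trig_mult:
  assumes "trig m f" "trig m g" shows "trig m (\<lambda>\<omega>. f \<omega> *\<^sub>C g \<omega>)"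
proof -
  obtain S x where S: "finite S" "S \<subseteq> freqs m" "\<And>\<omega>. \<omega> \<in> space torus \<Longrightarrow> f \<omega> = (\<Sum>a\<in>S. chi m a \<omega> *\<^sub>C x a)"
    using assms(1) unfolding trig_def by blast
  obtain T y where T: "finite T" "T \<subseteq> freqs m" "\<And>\<omega>. \<omega> \<in> space torus \<Longrightarrow> g \<omega> = (\<Sum>a\<in>T. chi m a \<omega> *\<^sub>C y a)"
    using assms(2) unfolding trig_def by blast
  have "trig m (\<lambda>\<omega>. \<Sum>a\<in>S. \<Sum>b\<in>T. chi m (\<lambda>j. a j + b j) \<omega> *\<^sub>C (x a *\<^sub>C y b))"
    by (intro trig_sum trig_char) (use S(2) T(2) in \<open>auto simp: freqs_def subset_iff\<close>)
  then show ?thesis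
  proof (rule trig_cong[rotated])
    fix \<omega> assume \<omega>: "\<omega> \<in> space torus"
    have nz: "\<omega> j \<noteq> 0" if "1 \<le> j" for j using norm_torus_coordinate[OF \<omega> that] by auto
    have "f \<omega> *\<^sub>C g \<omega> = (\<Sum>a\<in>S. \<Sum>b\<in>T. (chi m a \<omega> *\<^sub>C x a) *\<^sub>C chi m b \<omega> *\<^sub>C y b)"
      unfolding S(3)[OF \<omega>] T(3)[OF \<omega>] scaleC_sum_left scaleC_sum_right by (rule sum.swap)
    also have "\<dots> = (\<Sum>a\<in>S. \<Sum>b\<in>T. chi m (\<lambda>j. a j + b j) \<omega> *\<^sub>C (x a *\<^sub>C y b))"
      by (intro sum.cong HOL.refl) (simp add: chi_add nz scaleC_scaleC scaleC_complex_def mult_ac)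
    finally show "(\<Sum>a\<in>S. \<Sum>b\<in>T. chi m (\<lambda>j. a j + b j) \<omega> *\<^sub>C (x a *\<^sub>C y b)) = f \<omega> *\<^sub>C g \<omega>" by simp
  qed
qed

lemma trig_prod:
  fixes f :: "'i \<Rightarrow> (nat \<Rightarrow> complex) \<Rightarrow> complex"
  shows "(\<And>i. i \<in> I \<Longrightarrow> trig m (f i)) \<Longrightarrow> trig m (\<lambda>\<omega>. \<Prod>i\<in>I. f i \<omega>)"
proof (induction I rule: infinite_finite_induct)
  case (insert i I)
  then have "trig m (\<lambda>\<omega>. f i \<omega> *\<^sub>C (\<Prod>i\<in>I. f i \<omega>))" by (intro trig_mult) auto
  then show ?case using insert.hyps by (simp add: scaleC_complex_def)
qed (auto intro: trig_const)

lemma trig_coordinate: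
  assumes "1 \<le> j" "j \<le> m"
  shows "trig m (\<lambda>\<omega>. \<omega> j)" "trig m (\<lambda>\<omega>. cnj (\<omega> j))"
proof -
  define a where "a k = (\<lambda>i. if i = j then k else 0 :: int)" for k
  have a: "a k \<in> freqs m" for k using assms by (auto simp: a_def freqs_def)
  have chi: "chi m (a k) \<omega> = \<omega> j powi k" for k \<omega>
  proof -
    have "chi m (a k) \<omega> = (\<Prod>i\<in>{1..m}. if i = j then \<omega> j powi k else 1)"
      unfolding chi_def by (rule prod.cong) (auto simp: a_def)
    then show ?thesis using assms by simp
  qed
  show "trig m (\<lambda>\<omega>. \<omega> j)" 
    using trig_char[OF a[of 1], of "1::complex"] by (simp add: chi scaleC_complex_def)
  have "trig m (\<lambda>\<omega>. inverse (\<omega> j))" 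
    using trig_char[OF a[of "-1"], of "1::complex"] by (simp add: chi scaleC_complex_def power_int_minus)
  then show "trig m (\<lambda>\<omega>. cnj (\<omega> j))"
  proof (rule trig_cong[rotated])
    fix \<omega> assume "\<omega> \<in> space torus"
    then show "inverse (\<omega> j) = cnj (\<omega> j)" 
      using norm_torus_coordinate[of \<omega> j] assms complex_div_cnj[of 1 "\<omega> j"] unfolding inverse_eq_divide by simp
  qed
qed

lemma trig_real_polynomial:
  assumes "real_polynomial_function g" "1 \<le> j" "j \<le> m"
  shows "trig m (\<lambda>\<omega>. complex_of_real (g (\<omega> j)))"
  using assms(1)
proof (induction g rule: real_polynomial_function.induct)
  case (linear f)
  have lin: "f z = Re z * f 1 + Im z * f \<i>" for z
  proof -
    have "f z = f (Re z *\<^sub>R 1 + Im z *\<^sub>R \<i>)" by (rule arg_cong[where f=f]) (simp add: complex_eq_iff)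
    then show ?thesis using bounded_linear.linear[OF linear] by (simp add: linear_add linear_scale)
  qed
  \<comment> \<open>A real-linear function of \<open>z\<close> is a combination of \<open>z\<close> and its conjugate.\<close>
  define \<alpha> where "\<alpha> = (complex_of_real (f 1) - \<i> * f \<i>) / 2"
  define \<beta> where "\<beta> = (complex_of_real (f 1) + \<i> * f \<i>) / 2"
  have "trig m (\<lambda>\<omega>. \<alpha> *\<^sub>C \<omega> j + \<beta> *\<^sub>C cnj (\<omega> j))"
    by (intro trig_add trig_mult trig_const trig_coordinate assms)
  moreover have "\<alpha> *\<^sub>C z + \<beta> *\<^sub>C cnj z = complex_of_real (f z)" for z
    unfolding lin[of z] \<alpha>_def \<beta>_def by (simp add: scaleC_complex_def complex_eq_iff field_simps)
  ultimately show ?case by simp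
next
  case (const c)
  show ?case by (rule trig_const)
next
  case (add f g)
  then show ?case using trig_add[OF add.IH] by simp
next
  case (mult f g)
  then show ?case using trig_mult[OF mult.IH] by (simp add: scaleC_complex_def)
qed

text \<open>Indicators are approximated by continuous functions, by regularity and Urysohn's lemma, and these
  by polynomials. The bound \<open>\<bar>g z\<bar> \<le> 1\<close> is there to control products of approximants.\<close>

lemma circle_indicator_approx:
  assumes A: "A \<in> sets circle" and e: "e > 0"
  obtains g where "real_polynomial_function g" "\<And>z. norm z = 1 \<Longrightarrow> \<bar>g z\<bar> \<le> 1"
    "(LINT z|circle. \<bar>indicator A z - g z\<bar>) < e"
proof -
  define N where "N = distr circle borel (\<lambda>z. z)"
  have [simp]: "sets N = sets borel" "space N = UNIV" by (simp_all add: N_def)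
  interpret N: prob_space N unfolding N_def by (rule circle.prob_space_distr) simp
  have emN: "emeasure N B = emeasure circle (B \<inter> sphere 0 1)" if "B \<in> sets borel" for B
    unfolding N_def using that by (subst emeasure_distr) (auto simp: space_circle)
  have subA: "A \<subseteq> sphere 0 1" using sets.sets_into_space[OF A] by (simp add: space_circle)
  have Ab: "A \<in> sets borel"
    using A unfolding sets_circle by (subst (asm) sets_restrict_space_iff) (auto)
  have fin: "emeasure N (space N) \<noteq> \<infinity>" by simp
  define d where "d = e / 8"
  have d: "d > 0" using e by (simp add: d_def)
  have "\<exists>K. K \<subseteq> A \<and> compact K \<and> measure N A < measure N K + d"
  proof (rule ccontr)
    assume "\<not> ?thesis"
    then have *: "measure N K \<le> measure N A - d" if "K \<subseteq> A" "compact K" for K using that by force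
    have "emeasure N A \<le> ennreal (measure N A - d)"
      unfolding inner_regular[OF \<open>sets N = sets borel\<close> fin Ab]
      using * by (intro SUP_least) (auto simp: N.emeasure_eq_measure intro!: ennreal_leI)
    moreover have "0 \<le> measure N A - d" using *[of "{}"] by simp
    ultimately show False using d by (simp add: N.emeasure_eq_measure)
  qed
  then obtain K where K: "K \<subseteq> A" "compact K" "measure N A < measure N K + d" by blast
  have "\<exists>U. A \<subseteq> U \<and> open U \<and> measure N U < measure N A + d"
  proof (rule ccontr)
    assume "\<not> ?thesis"
    then have *: "measure N A + d \<le> measure N U" if "A \<subseteq> U" "open U" for U using that by force
    have "ennreal (measure N A + d) \<le> emeasure N A"
      unfolding outer_regular[OF \<open>sets N = sets borel\<close> fin Ab]
      using * by (intro INF_greatest) (auto simp: N.emeasure_eq_measure intro!: ennreal_leI)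
    then show False using d by (simp add: N.emeasure_eq_measure)
  qed
  then obtain U where U: "A \<subseteq> U" "open U" "measure N U < measure N A + d" by blast
  obtain f :: "complex \<Rightarrow> real" where f: "continuous_on UNIV f" "\<And>x. f x \<in> closed_segment 1 0"
      "\<And>x. x \<in> K \<Longrightarrow> f x = 1" "\<And>x. x \<in> - U \<Longrightarrow> f x = 0"
    using Urysohn[of K "- U" 1 0] K U by (auto simp: compact_imp_closed)
  have f01: "0 \<le> f x" "f x \<le> 1" for x using f(2)[of x] by (auto simp: closed_segment_eq_real_ivl)
  obtain g' where g': "real_polynomial_function g'" "\<And>x. x \<in> sphere 0 1 \<Longrightarrow> \<bar>f x - g' x\<bar> < d"
    using Stone_Weierstrass_real_polynomial_function[of "sphere 0 (1::real)" f d] d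
      continuous_on_subset[OF f(1)] by (auto simp: )
  define g where "g z = g' z * (1 / (1 + d))" for z
  have g: "real_polynomial_function g"
    unfolding g_def by (rule real_polynomial_function.intros(4)[OF g'(1) real_polynomial_function.intros(2)])
  have g1: "\<bar>g z\<bar> \<le> 1" "\<bar>f z - g z\<bar> \<le> 2 * d" if z: "norm z = 1" for z
  proof -
    have *: "\<bar>f z - g' z\<bar> < d" using g'(2)[of z] z by simp
    have "\<bar>g' z\<bar> \<le> 1 + d" using * f01[of z] by linarith
    then show "\<bar>g z\<bar> \<le> 1" unfolding g_def using d by (simp add: abs_mult)
    have "f z - g z = ((f z - g' z) + d * f z) / (1 + d)" unfolding g_def using d by (simp add: field_simps)
    then have "\<bar>f z - g z\<bar> = \<bar>(f z - g' z) + d * f z\<bar> / (1 + d)" using d by (simp add: abs_divide)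
    also have "\<dots> \<le> \<bar>(f z - g' z) + d * f z\<bar> / 1" using d by (intro divide_left_mono) auto
    also have "\<dots> \<le> \<bar>f z - g' z\<bar> + \<bar>d * f z\<bar>" by simp
    also have "\<dots> \<le> d + d" using * f01[of z] d by (intro add_mono) (auto simp: abs_mult mult_left_le)
    finally show "\<bar>f z - g z\<bar> \<le> 2 * d" by simp
  qed
  have gm: "g \<in> borel_measurable circle"
    by (intro measurable_circle_borelI borel_measurable_continuous_onI)
       (use g continuous_real_polymonial_function in \<open>auto intro: continuous_at_imp_continuous_on\<close>)
  have UK: "U - K \<in> sets borel" using U(2) K(2) by (auto dest: compact_imp_closed)
  then have UKc: "(U - K) \<inter> sphere 0 1 \<in> sets circle" 
    unfolding sets_circle by (subst sets_restrict_space_iff) auto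
  have iU: "integrable circle (indicat_real ((U - K) \<inter> sphere 0 1))"
    by (rule integrable_real_indicator[OF UKc]) (simp add: less_top[symmetric])
  have pt: "\<bar>indicator A z - g z\<bar> \<le> indicator ((U - K) \<inter> sphere 0 1) z + 2 * d" if z: "z \<in> space circle" for z
  proof -
    have zn: "norm z = 1" using z by (simp add: space_circle)
    have "\<bar>indicator A z - f z\<bar> \<le> indicator ((U - K) \<inter> sphere 0 1) z"
      using f(3)[of z] f(4)[of z] f01[of z] K(1) U(1) zn by (auto simp: indicator_def)
    then show ?thesis using g1(2)[OF zn] by linarith
  qed
  have "(LINT z|circle. \<bar>indicator A z - g z\<bar>) \<le> (LINT z|circle. indicator ((U - K) \<inter> sphere 0 1) z + 2 * d)"
  proof (rule integral_mono[OF _ _ pt])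
    have ind: "indicat_real A \<in> borel_measurable circle" using A by simp
    show "integrable circle (\<lambda>z. \<bar>indicat_real A z - g z\<bar>)"
    proof (intro integrable_circle_bounded[where B=2])
      fix z :: complex assume "norm z = 1"
      then show "norm \<bar>indicat_real A z - g z\<bar> \<le> 2" using g1(1)[of z] by (auto simp: indicator_def)
    qed (intro borel_measurable_abs borel_measurable_diff ind gm)
    show "integrable circle (\<lambda>z. indicator ((U - K) \<inter> sphere 0 1) z + 2 * d)"
      by (intro Bochner_Integration.integrable_add iU circle.integrable_const)
  qed
  also have "\<dots> = measure circle ((U - K) \<inter> sphere 0 1) + 2 * d"
    unfolding Bochner_Integration.integral_add[OF iU circle.integrable_const]
    using UKc by (simp add: circle.prob_space Int_absorb2 sets.sets_into_space)
  also have "measure circle ((U - K) \<inter> sphere 0 1) = measure N (U - K)"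
    unfolding measure_def emN[OF UK] ..
  also have "\<dots> = measure N U - measure N K"
    using U(1,2) K(1,2) by (intro N.finite_measure_Diff) (auto dest: compact_imp_closed)
  also have "\<dots> + 2 * d < e" using U(3) K(3) e unfolding d_def by linarith
  finally show ?thesis using that[OF g g1(1)] by blast
qed

lemma trig_approx_trig: assumes "trig m f" shows "trig_approx m f"
  unfolding trig_approx_def
proof (intro conjI allI impI)
  show "f \<in> bochner_L1 torus" by (rule trig_bochner_L1) fact
  fix e :: real assume "e > 0"
  then show "\<exists>g. trig m g \<and> L1_norm torus (\<lambda>\<omega>. f \<omega> - g \<omega>) < e"
    using assms by (intro exI[of _ f]) (simp add: L1_norm_def)
qed

lemma trig_approx_limit:
  assumes f: "f \<in> bochner_L1 torus"
    and lim: "\<And>e. e > 0 \<Longrightarrow> \<exists>g. trig_approx m g \<and> L1_norm torus (\<lambda>\<omega>. f \<omega> - g \<omega>) < e"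
  shows "trig_approx m f"
  unfolding trig_approx_def
proof (intro conjI allI impI f)
  fix e :: real assume "e > 0"
  then obtain g where g: "trig_approx m g" "L1_norm torus (\<lambda>\<omega>. f \<omega> - g \<omega>) < e / 2"
    using lim[of "e / 2"] by auto
  have "e / 2 > 0" using \<open>e > 0\<close> by simp
  then obtain h where h: "trig m h" "L1_norm torus (\<lambda>\<omega>. g \<omega> - h \<omega>) < e / 2"
    using g(1) unfolding trig_approx_def by blast
  have "L1_norm torus (\<lambda>\<omega>. f \<omega> - h \<omega>) < e"
    using L1_norm_triangle[of f torus g h] f g h trig_bochner_L1[OF h(1)] unfolding trig_approx_def by auto
  then show "\<exists>g. trig m g \<and> L1_norm torus (\<lambda>\<omega>. f \<omega> - g \<omega>) < e" using h(1) by blast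
qed

lemma trig_approx_cong:
  assumes "\<And>\<omega>. \<omega> \<in> space torus \<Longrightarrow> f \<omega> = g \<omega>" and f: "trig_approx m f"
  shows "trig_approx m g"
proof (rule trig_approx_limit)
  show "g \<in> bochner_L1 torus" using bochner_L1_cong[of torus f g] assms by (simp add: trig_approx_def)
  fix e :: real assume e: "e > 0"
  have "L1_norm torus (\<lambda>\<omega>. g \<omega> - f \<omega>) = L1_norm torus (\<lambda>_. 0 :: 'a)"
    by (rule L1_norm_cong) (simp add: assms(1))
  then show "\<exists>h. trig_approx m h \<and> L1_norm torus (\<lambda>\<omega>. g \<omega> - h \<omega>) < e"
    using f e by (intro exI[of _ f]) (simp add: L1_norm_def)
qed

lemma trig_approx_add:
  assumes "trig_approx m f" "trig_approx m g" shows "trig_approx m (\<lambda>\<omega>. f \<omega> + g \<omega>)"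
  unfolding trig_approx_def
proof (intro conjI allI impI)
  have f: "f \<in> bochner_L1 torus" and g: "g \<in> bochner_L1 torus" using assms by (auto simp: trig_approx_def)
  show "(\<lambda>\<omega>. f \<omega> + g \<omega>) \<in> bochner_L1 torus" by (rule bochner_L1_add[OF f g])
  fix e :: real assume "e > 0"
  then have e2: "e / 2 > 0" by simp
  obtain f' where f': "trig m f'" "L1_norm torus (\<lambda>\<omega>. f \<omega> - f' \<omega>) < e / 2"
    using assms(1) e2 unfolding trig_approx_def by blast
  obtain g' where g': "trig m g'" "L1_norm torus (\<lambda>\<omega>. g \<omega> - g' \<omega>) < e / 2"
    using assms(2) e2 unfolding trig_approx_def by blast
  have "L1_norm torus (\<lambda>\<omega>. (f \<omega> - f' \<omega>) + (g \<omega> - g' \<omega>)) < e"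
    using L1_norm_add_le[OF bochner_L1_diff[OF f trig_bochner_L1[OF f'(1)]] bochner_L1_diff[OF g trig_bochner_L1[OF g'(1)]]] 
      f'(2) g'(2) by simp
  then show "\<exists>h. trig m h \<and> L1_norm torus (\<lambda>\<omega>. f \<omega> + g \<omega> - h \<omega>) < e"
    using trig_add[OF f'(1) g'(1)] by (intro exI[of _ "\<lambda>\<omega>. f' \<omega> + g' \<omega>"]) (simp add: algebra_simps)
qed

lemma trig_approx_sum:
  "(\<And>i. i \<in> I \<Longrightarrow> trig_approx m (f i)) \<Longrightarrow> trig_approx m (\<lambda>\<omega>. \<Sum>i\<in>I. f i \<omega>)"
  by (induction I rule: infinite_finite_induct) (auto intro: trig_approx_add trig_approx_trig trig_const)

lemma trig_approx_scaleC_const: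
  assumes "trig_approx m f" shows "trig_approx m (\<lambda>\<omega>. f \<omega> *\<^sub>C x)"
  unfolding trig_approx_def
proof (intro conjI allI impI)
  have f: "f \<in> bochner_L1 torus" using assms by (auto simp: trig_approx_def)
  show "(\<lambda>\<omega>. f \<omega> *\<^sub>C x) \<in> bochner_L1 torus" 
    using f by (intro bochner_L1_scaleC_const) (simp add: bochner_L1_complex_iff)
  fix e :: real assume e: "e > 0"
  define d where "d = e / (norm x + 1)"
  have d: "d > 0" using e by (simp add: d_def add_nonneg_pos)
  obtain f' where f': "trig m f'" "L1_norm torus (\<lambda>\<omega>. f \<omega> - f' \<omega>) < d"
    using assms d unfolding trig_approx_def by blast
  have "L1_norm torus (\<lambda>\<omega>. f \<omega> *\<^sub>C x - f' \<omega> *\<^sub>C x) = L1_norm torus (\<lambda>\<omega>. f \<omega> - f' \<omega>) * norm x"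
    by (simp add: L1_norm_scaleC_const flip: scaleC_diff_left)
  also have "\<dots> \<le> d * norm x" using f'(2) by (intro mult_right_mono) auto
  also have "\<dots> < d * (norm x + 1)" using d by simp
  also have "\<dots> = e" by (simp add: d_def add_nonneg_pos[THEN less_imp_neq, symmetric])
  finally show "\<exists>g. trig m g \<and> L1_norm torus (\<lambda>\<omega>. f \<omega> *\<^sub>C x - g \<omega>) < e"
    using trig_mult[OF f'(1) trig_const] by blast
qed

lemma distr_torus_coordinate: "1 \<le> j \<Longrightarrow> distr torus circle (\<lambda>\<omega>. \<omega> j) = circle"
  unfolding torus_def by (rule circle_product.PiM_component) simp

lemma trig_approx_rectangle:
  assumes E: "\<And>j. j \<in> {1..m} \<Longrightarrow> E j \<in> sets circle"
  shows "trig_approx m (\<lambda>\<omega>. \<Prod>j\<in>{1..m}. complex_of_real (indicator (E j) (\<omega> j)))"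
proof (rule trig_approx_limit)
  have m: "(\<lambda>\<omega>. indicat_real (E j) (\<omega> j)) \<in> borel_measurable torus" if "j \<in> {1..m}" for j
    using measurable_compose[OF measurable_torus_coordinate_circle borel_measurable_indicator[OF E[OF that]]] that by auto
  have mm: "(\<lambda>\<omega>. \<Prod>j\<in>{1..m}. complex_of_real (indicator (E j) (\<omega> j))) \<in> borel_measurable torus"
    by (intro borel_measurable_prod measurable_compose[OF m borel_measurable_continuous_onI] continuous_intros)
  have "integrable torus (\<lambda>\<omega>. \<Prod>j\<in>{1..m}. complex_of_real (indicator (E j) (\<omega> j)))"
  proof (rule integrable_torus_bounded[where B=1, OF mm])
    fix \<omega>
    have "norm (\<Prod>j\<in>{1..m}. complex_of_real (indicator (E j) (\<omega> j))) \<le> (\<Prod>j\<in>{1..m}. 1)"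
      unfolding prod_norm[symmetric] by (rule prod_mono) (auto simp: indicator_def)
    then show "norm (\<Prod>j\<in>{1..m}. complex_of_real (indicator (E j) (\<omega> j))) \<le> 1" by simp
  qed
  then show L1: "(\<lambda>\<omega>. \<Prod>j\<in>{1..m}. complex_of_real (indicator (E j) (\<omega> j))) \<in> bochner_L1 torus"
    by (simp add: bochner_L1_complex_iff)
  fix e :: real assume e: "e > 0"
  define d where "d = e / (real m + 1)"
  have d: "d > 0" using e by (simp add: d_def)
  have "\<exists>g. \<forall>j\<in>{1..m}. real_polynomial_function (g j) \<and> (\<forall>z. norm z = 1 \<longrightarrow> \<bar>g j z\<bar> \<le> 1) \<and>
     (LINT z|circle. \<bar>indicator (E j) z - g j z\<bar>) < d"
    by (rule bchoice) (use circle_indicator_approx[OF E d] in metis)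
  then obtain g where g: "\<And>j. j \<in> {1..m} \<Longrightarrow> real_polynomial_function (g j)"
      "\<And>j z. j \<in> {1..m} \<Longrightarrow> norm z = 1 \<Longrightarrow> \<bar>g j z\<bar> \<le> 1"
      "\<And>j. j \<in> {1..m} \<Longrightarrow> (LINT z|circle. \<bar>indicator (E j) z - g j z\<bar>) < d" by blast
  have gm: "g j \<in> borel_measurable circle" if "j \<in> {1..m}" for j
    by (intro measurable_circle_borelI borel_measurable_continuous_onI)
       (use g(1)[OF that] continuous_real_polymonial_function in \<open>auto intro: continuous_at_imp_continuous_on\<close>)
  define p where "p \<omega> = (\<Prod>j\<in>{1..m}. complex_of_real (g j (\<omega> j)))" for \<omega>
  have p: "trig m p" unfolding p_def by (intro trig_prod trig_real_polynomial g) auto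
  have ij: "integrable torus (\<lambda>\<omega>. \<bar>indicat_real (E j) (\<omega> j) - g j (\<omega> j)\<bar>)"
    and Lj: "(LINT \<omega>|torus. \<bar>indicat_real (E j) (\<omega> j) - g j (\<omega> j)\<bar>) = (LINT z|circle. \<bar>indicator (E j) z - g j z\<bar>)"
    if j: "j \<in> {1..m}" for j
  proof -
    have j1: "1 \<le> j" using j by simp
    have mc: "(\<lambda>z. \<bar>indicat_real (E j) z - g j z\<bar>) \<in> borel_measurable circle"
      by (intro borel_measurable_abs borel_measurable_diff gm[OF j] borel_measurable_indicator E[OF j])
    have ic: "integrable circle (\<lambda>z. \<bar>indicat_real (E j) z - g j z\<bar>)"
    proof (rule integrable_circle_bounded[where B=2, OF mc])
      fix z :: complex assume "norm z = 1"
      then show "norm \<bar>indicat_real (E j) z - g j z\<bar> \<le> 2" using g(2)[OF j, of z] by (auto simp: indicator_def)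
    qed
    show "integrable torus (\<lambda>\<omega>. \<bar>indicat_real (E j) (\<omega> j) - g j (\<omega> j)\<bar>)"
      using integrable_distr_eq[OF measurable_torus_coordinate_circle[OF j1] mc] ic 
      unfolding distr_torus_coordinate[OF j1] by simp
    show "(LINT \<omega>|torus. \<bar>indicat_real (E j) (\<omega> j) - g j (\<omega> j)\<bar>) = (LINT z|circle. \<bar>indicator (E j) z - g j z\<bar>)"
      using integral_distr[OF measurable_torus_coordinate_circle[OF j1] mc] 
      unfolding distr_torus_coordinate[OF j1] by simp
  qed
  have "L1_norm torus (\<lambda>\<omega>. (\<Prod>j\<in>{1..m}. complex_of_real (indicator (E j) (\<omega> j))) - p \<omega>) \<le>
      (LINT \<omega>|torus. (\<Sum>j\<in>{1..m}. \<bar>indicat_real (E j) (\<omega> j) - g j (\<omega> j)\<bar>))"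
    unfolding L1_norm_def
  proof (rule integral_mono)
    show "integrable torus (\<lambda>\<omega>. norm ((\<Prod>j\<in>{1..m}. complex_of_real (indicator (E j) (\<omega> j))) - p \<omega>))"
      using bochner_L1_diff[OF L1 trig_bochner_L1[OF p]] by (simp add: bochner_L1_def)
    show "integrable torus (\<lambda>\<omega>. \<Sum>j\<in>{1..m}. \<bar>indicat_real (E j) (\<omega> j) - g j (\<omega> j)\<bar>)"
      by (intro Bochner_Integration.integrable_sum ij)
    fix \<omega> assume \<omega>: "\<omega> \<in> space torus"
    have "norm ((\<Prod>j\<in>{1..m}. complex_of_real (indicator (E j) (\<omega> j))) - p \<omega>) \<le>
       (\<Sum>j\<in>{1..m}. norm (complex_of_real (indicator (E j) (\<omega> j)) - complex_of_real (g j (\<omega> j))))"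
      unfolding p_def
    proof (rule norm_prod_diff)
      show "norm (complex_of_real (g j (\<omega> j))) \<le> 1" if "j \<in> {1..m}" for j
        using g(2)[OF that, of "\<omega> j"] norm_torus_coordinate[OF \<omega>, of j] that by simp
    qed (auto simp: indicator_def)
    also have "\<dots> = (\<Sum>j\<in>{1..m}. \<bar>indicat_real (E j) (\<omega> j) - g j (\<omega> j)\<bar>)"
      by (simp flip: of_real_diff)
    finally show "norm ((\<Prod>j\<in>{1..m}. complex_of_real (indicator (E j) (\<omega> j))) - p \<omega>) \<le>
      (\<Sum>j\<in>{1..m}. \<bar>indicat_real (E j) (\<omega> j) - g j (\<omega> j)\<bar>)" .
  qed
  also have "\<dots> = (\<Sum>j\<in>{1..m}. LINT z|circle. \<bar>indicator (E j) z - g j z\<bar>)"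
    by (subst Bochner_Integration.integral_sum[OF ij]) (simp_all add: Lj)
  also have "\<dots> \<le> (\<Sum>j\<in>{1..m}. d)"
    by (intro sum_mono less_imp_le g(3))
  also have "\<dots> = real m * d" by simp
  also have "\<dots> < (real m + 1) * d" using d by simp
  also have "\<dots> = e" by (simp add: d_def)
  finally show "\<exists>g. trig_approx m g \<and> 
      L1_norm torus (\<lambda>\<omega>. (\<Prod>j\<in>{1..m}. complex_of_real (indicator (E j) (\<omega> j))) - g \<omega>) < e"
    using trig_approx_trig[OF p] by blast
qed

lemma space_coord_algebra [simp]: "space (coord_algebra n) = space torus"
  by (simp add: coord_algebra_def)

lemma measurable_restrict_torus: "(\<lambda>\<omega>. restrict \<omega> {1..n}) \<in> measurable torus (Pi\<^sub>M {1..n} (\<lambda>_. circle))"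
  unfolding torus_def by (rule measurable_restrict_subset) auto

lemma sets_coord_algebra: 
  "sets (coord_algebra n) = {(\<lambda>\<omega>. restrict \<omega> {1..n}) -` B \<inter> space torus | B. B \<in> sets (Pi\<^sub>M {1..n} (\<lambda>_. circle))}"
  unfolding coord_algebra_def
  by (rule sets_vimage_algebra2) (use measurable_space[OF measurable_restrict_torus] in auto)

lemma sets_coord_algebra_subset: "sets (coord_algebra n) \<subseteq> sets torus"
  unfolding sets_coord_algebra using measurable_sets[OF measurable_restrict_torus] by auto

text \<open>The sets whose indicators are in the closure form a Dynkin system that contains the rectangles.\<close>

lemma trig_approx_indicator:
  assumes "A \<in> sets (coord_algebra m)"
  shows "trig_approx m (\<lambda>\<omega>. complex_of_real (indicator A \<omega>))"
proof -
  let ?r = "\<lambda>B. (\<lambda>\<omega>. restrict \<omega> {1..m}) -` B \<inter> space torus"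
  let ?P = "\<lambda>B. trig_approx m (\<lambda>\<omega>. complex_of_real (indicator (?r B) \<omega>))"
  obtain B where A: "A = ?r B" and B: "B \<in> sets (Pi\<^sub>M {1..m} (\<lambda>_. circle))"
    using assms unfolding sets_coord_algebra by blast
  have r: "?r B \<in> sets torus" if "B \<in> sets (Pi\<^sub>M {1..m} (\<lambda>_. circle))" for B
    by (rule measurable_sets[OF measurable_restrict_torus that])
  have L1: "(\<lambda>\<omega>. complex_of_real (indicator D \<omega>)) \<in> bochner_L1 torus" if "D \<in> sets torus" for D
    unfolding bochner_L1_complex_iff by (rule integrable_torus_bounded[where B=1]) (use that in \<open>auto simp: indicator_def\<close>)
  have "B \<in> sigma_sets (\<Pi>\<^sub>E i\<in>{1..m}. space circle) (prod_algebra {1..m} (\<lambda>_. circle))"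
    using B by (simp add: sets_PiM)
  then have "?P B"
  proof (rule sigma_sets_induct_disjoint[OF Int_stable_prod_algebra prod_algebra_sets_into_space, where P="?P"])
    fix B assume "B \<in> prod_algebra {1..m} (\<lambda>_. circle)"
    then obtain E where E: "B = Pi\<^sub>E {1..m} E" "E \<in> {1..m} \<rightarrow> sets circle" by (rule prod_algebraE_all)
    have "trig_approx m (\<lambda>\<omega>. \<Prod>j\<in>{1..m}. complex_of_real (indicator (E j) (\<omega> j)))"
      using E(2) by (intro trig_approx_rectangle) auto
    then show "?P B"
    proof (rule trig_approx_cong[rotated])
      fix \<omega> assume \<omega>: "\<omega> \<in> space torus"
      have "\<omega> \<in> ?r B \<longleftrightarrow> (\<forall>j\<in>{1..m}. \<omega> j \<in> E j)"
        using \<omega> unfolding E(1) by (auto simp: PiE_iff)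
      moreover have "(\<Prod>j\<in>{1..m}. complex_of_real (indicator (E j) (\<omega> j))) = of_bool (\<forall>j\<in>{1..m}. \<omega> j \<in> E j)"
      proof (cases "\<forall>j\<in>{1..m}. \<omega> j \<in> E j")
        case False
        then obtain j where j: "j \<in> {1..m}" "\<omega> j \<notin> E j" by blast
        then have "(\<Prod>j\<in>{1..m}. complex_of_real (indicator (E j) (\<omega> j))) = 0"
          by (intro prod_zero bexI[of _ j]) auto
        then show ?thesis using False by simp
      qed auto
      ultimately show "(\<Prod>j\<in>{1..m}. complex_of_real (indicator (E j) (\<omega> j))) = complex_of_real (indicator (?r B) \<omega>)"
        by (simp add: indicator_def)
    qed
  next
    show "?P {}" using trig_approx_trig[OF trig_const, of m "0::complex"] by simp
  next
    fix B assume compl: "B \<in> sigma_sets (\<Pi>\<^sub>E i\<in>{1..m}. space circle) (prod_algebra {1..m} (\<lambda>_. circle))" "?P B"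
    have sub: "B \<subseteq> (\<Pi>\<^sub>E i\<in>{1..m}. space circle)"
      by (rule sigma_sets_into_sp[OF prod_algebra_sets_into_space compl(1)])
    have "trig_approx m (\<lambda>\<omega>. 1 + complex_of_real (indicator (?r B) \<omega>) *\<^sub>C (-1))"
      by (intro trig_approx_add trig_approx_trig[OF trig_const] trig_approx_scaleC_const compl)
    then show "?P ((\<Pi>\<^sub>E i\<in>{1..m}. space circle) - B)"
    proof (rule trig_approx_cong[rotated])
      fix \<omega> assume \<omega>: "\<omega> \<in> space torus"
      then have "restrict \<omega> {1..m} \<in> (\<Pi>\<^sub>E i\<in>{1..m}. space circle)"
        using measurable_space[OF measurable_restrict_torus] by (auto simp: space_PiM)
      then show "1 + complex_of_real (indicator (?r B) \<omega>) *\<^sub>C (-1) = 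
          complex_of_real (indicator (?r ((\<Pi>\<^sub>E i\<in>{1..m}. space circle) - B)) \<omega>)"
        using \<omega> by (auto simp: indicator_def scaleC_complex_def)
    qed
  next
    fix B :: "nat \<Rightarrow> (nat \<Rightarrow> complex) set"
    assume union: "disjoint_family B" "range B \<subseteq> sigma_sets (\<Pi>\<^sub>E i\<in>{1..m}. space circle) (prod_algebra {1..m} (\<lambda>_. circle))"
      "\<And>i. ?P (B i)"
    have rB: "?r (B i) \<in> sets torus" for i using union(2) by (intro r) (auto simp: sets_PiM)
    have "?r (\<Union>i. B i) \<in> sets torus" using union(2) by (intro r) (auto simp: sets_PiM intro!: sigma_sets.Union)
    have disj: "disjoint_family (\<lambda>i. ?r (B i))" 
      using union(1) unfolding disjoint_family_on_def by blast
    have U: "?r (\<Union>i. B i) = (\<Union>i. ?r (B i))" by auto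
    have lim: "(\<lambda>N. \<Sum>i<N. measure torus (?r (B i))) \<longlonglongrightarrow> measure torus (?r (\<Union>i. B i))"
      using torus.finite_measure_UNION[OF _ disj] rB unfolding U sums_def by auto
    show "?P (\<Union>i. B i)"
    proof (rule trig_approx_limit)
      show "(\<lambda>\<omega>. complex_of_real (indicator (?r (\<Union>i. B i)) \<omega>)) \<in> bochner_L1 torus" by (rule L1) fact
      fix e :: real assume "e > 0"
      then obtain N where N: "\<bar>(\<Sum>i<N. measure torus (?r (B i))) - measure torus (?r (\<Union>i. B i))\<bar> < e"
        using LIMSEQ_D[OF lim] by fastforce
      have ptw: "norm (complex_of_real (indicator (?r (\<Union>i. B i)) \<omega>) - (\<Sum>i<N. complex_of_real (indicator (?r (B i)) \<omega>))) =
           indicator (?r (\<Union>i. B i)) \<omega> - (\<Sum>i<N. indicat_real (?r (B i)) \<omega>)" for \<omega>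
      proof -
        have "(\<Sum>i<N. indicat_real (?r (B i)) \<omega>) = indicator (\<Union>i<N. ?r (B i)) \<omega>"
          using disj by (intro indicator_UN_disjoint[symmetric]) (auto simp: disjoint_family_on_def)
        also have "\<dots> \<le> indicator (?r (\<Union>i. B i)) \<omega>" by (auto simp: indicator_def)
        finally have "0 \<le> indicator (?r (\<Union>i. B i)) \<omega> - (\<Sum>i<N. indicat_real (?r (B i)) \<omega>)" by simp
        then show ?thesis by (simp flip: of_real_sum of_real_diff)
      qed
      have "L1_norm torus (\<lambda>\<omega>. complex_of_real (indicator (?r (\<Union>i. B i)) \<omega>) - (\<Sum>i<N. complex_of_real (indicator (?r (B i)) \<omega>))) =
         (LINT \<omega>|torus. indicator (?r (\<Union>i. B i)) \<omega> - (\<Sum>i<N. indicat_real (?r (B i)) \<omega>))"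
        unfolding L1_norm_def ptw ..
      also have "\<dots> = measure torus (?r (\<Union>i. B i)) - (\<Sum>i<N. measure torus (?r (B i)))"
      proof -
        have i: "integrable torus (indicat_real D)" "(LINT \<omega>|torus. indicat_real D \<omega>) = measure torus D" if "D \<in> sets torus" for D
          using that sets.sets_into_space[OF that]
          by (auto intro!: integrable_real_indicator simp: less_top[symmetric] Int_absorb2)
        show ?thesis
          using i[OF rB] i[OF \<open>?r (\<Union>i. B i) \<in> sets torus\<close>] 
          by (simp add: Bochner_Integration.integral_diff Bochner_Integration.integral_sum Bochner_Integration.integrable_sum)
      qed
      also have "\<dots> < e" using N by linarith
      finally show "\<exists>g. trig_approx m g \<and> L1_norm torus (\<lambda>\<omega>. complex_of_real (indicator (?r (\<Union>i. B i)) \<omega>) - g \<omega>) < e"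
        using trig_approx_sum[of "{..<N}" m "\<lambda>i \<omega>. complex_of_real (indicator (?r (B i)) \<omega>)"] union(3) by blast
    qed
  qed
  then show ?thesis unfolding A .
qed


text \<open>The simple functions that converge to \<open>f\<close> are truncated where they exceed \<open>2 * norm f\<close>, so that
  dominated convergence applies.\<close>

lemma bochner_L1_simple_approx:
  fixes f :: "'a \<Rightarrow> 'x::complex_banach"
  assumes f: "f \<in> bochner_L1 M" and fF: "strongly_measurable F f" 
    and F: "space F = space M" "sets F \<subseteq> sets M" and e: "e > 0"
  obtains s where "simple_function F s" "s \<in> bochner_L1 M" "L1_norm M (\<lambda>\<omega>. f \<omega> - s \<omega>) < e"
proof -
  obtain s where s: "\<And>i. simple_function F (s i)" "\<And>\<omega>. \<omega> \<in> space F \<Longrightarrow> (\<lambda>i. s i \<omega>) \<longlonglongrightarrow> f \<omega>"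
    using fF unfolding strongly_measurable_def by blast
  define t where "t i \<omega> = (if norm (s i \<omega>) \<le> 2 * norm (f \<omega>) then s i \<omega> else 0)" for i \<omega>
  have t: "simple_function F (t i)" for i
    unfolding t_def
  proof (rule simple_function_If[OF s(1) simple_function_const])
    have [measurable]: "(\<lambda>\<omega>. norm (f \<omega>)) \<in> borel_measurable F" "(\<lambda>\<omega>. norm (s i \<omega>)) \<in> borel_measurable F"
      by (intro strongly_measurable_norm strongly_measurable_simple fF s(1))+
    show "{\<omega> \<in> space F. norm (s i \<omega>) \<le> 2 * norm (f \<omega>)} \<in> sets F" by measurable
  qed
  have tM: "strongly_measurable M (t i)" for i
    by (intro strongly_measurable_simple simple_function_subalgebra_mono[OF t F])
  have fi: "integrable M (\<lambda>\<omega>. norm (f \<omega>))" and fm: "strongly_measurable M f" using f by (auto simp: bochner_L1_def)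
  have tL: "t i \<in> bochner_L1 M" for i
    by (rule bochner_L1_bounded[OF tM, of "\<lambda>\<omega>. 2 * norm (f \<omega>)"]) (use fi in \<open>auto simp: t_def\<close>)
  have "(\<lambda>i. LINT \<omega>|M. norm (f \<omega> - t i \<omega>)) \<longlonglongrightarrow> (LINT \<omega>|M. 0)"
  proof (rule integral_dominated_convergence[where w="\<lambda>\<omega>. 3 * norm (f \<omega>)"])
    show "(\<lambda>\<omega>. norm (f \<omega> - t i \<omega>)) \<in> borel_measurable M" for i
      by (intro strongly_measurable_norm strongly_measurable_diff fm tM)
    show "AE \<omega> in M. (\<lambda>i. norm (f \<omega> - t i \<omega>)) \<longlonglongrightarrow> 0"
    proof (rule AE_I2)
      fix \<omega> assume \<omega>: "\<omega> \<in> space M"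
      have "(\<lambda>i. t i \<omega>) \<longlonglongrightarrow> f \<omega>"
      proof (cases "f \<omega> = 0")
        case True
        then have "t i \<omega> = 0" for i by (simp add: t_def)
        then show ?thesis using True by simp
      next
        case False
        have lim: "(\<lambda>i. s i \<omega>) \<longlonglongrightarrow> f \<omega>" by (rule s(2)) (simp add: F \<omega>)
        have "norm (f \<omega>) < 2 * norm (f \<omega>)" using False by simp
        from order_tendstoD(2)[OF tendsto_norm[OF lim] this]
        have "\<forall>\<^sub>F i in sequentially. s i \<omega> = t i \<omega>" by eventually_elim (simp add: t_def)
        then show ?thesis by (rule Lim_transform_eventually[OF lim])
      qed
      from tendsto_norm[OF tendsto_diff[OF tendsto_const[of "f \<omega>"] this]]
      show "(\<lambda>i. norm (f \<omega> - t i \<omega>)) \<longlonglongrightarrow> 0" by simp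
    qed
    show "AE \<omega> in M. norm (norm (f \<omega> - t i \<omega>)) \<le> 3 * norm (f \<omega>)" for i
    proof (rule AE_I2)
      fix \<omega>
      have "norm (t i \<omega>) \<le> 2 * norm (f \<omega>)" by (auto simp: t_def)
      then show "norm (norm (f \<omega> - t i \<omega>)) \<le> 3 * norm (f \<omega>)"
        using norm_triangle_ineq4[of "f \<omega>" "t i \<omega>"] by simp
    qed
  qed (use fi in auto)
  then have "(\<lambda>i. L1_norm M (\<lambda>\<omega>. f \<omega> - t i \<omega>)) \<longlonglongrightarrow> 0" by (simp add: L1_norm_def)
  from order_tendstoD(2)[OF this e] obtain i where "L1_norm M (\<lambda>\<omega>. f \<omega> - t i \<omega>) < e"
    using eventually_happens'[OF sequentially_bot] by blast
  then show ?thesis using that[OF t tL] by blast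
qed

lemma simple_function_eq_sum_indicator:
  fixes s :: "'a \<Rightarrow> 'x::complex_banach"
  assumes "simple_function F s" "\<omega> \<in> space F"
  shows "s \<omega> = (\<Sum>y\<in>s ` space F. complex_of_real (indicator (s -` {y} \<inter> space F) \<omega>) *\<^sub>C y)"
proof -
  have "(\<Sum>y\<in>s ` space F. complex_of_real (indicator (s -` {y} \<inter> space F) \<omega>) *\<^sub>C y) = 
      (\<Sum>y\<in>s ` space F. if y = s \<omega> then y else 0)"
    using assms(2) by (intro sum.cong) (auto simp: indicator_def)
  also have "\<dots> = s \<omega>" using assms by (simp add: simple_function_def)
  finally show ?thesis ..
qed

lemma trig_approx_bochner_L1:
  assumes f: "f \<in> bochner_L1 torus" "strongly_measurable (coord_algebra m) f"
  shows "trig_approx m f"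
proof (rule trig_approx_limit[OF f(1)])
  fix e :: real assume e: "e > 0"
  obtain s where s: "simple_function (coord_algebra m) s" "s \<in> bochner_L1 torus" "L1_norm torus (\<lambda>\<omega>. f \<omega> - s \<omega>) < e"
    by (rule bochner_L1_simple_approx[OF f space_coord_algebra sets_coord_algebra_subset e])
  have "trig_approx m (\<lambda>\<omega>. \<Sum>y\<in>s ` space torus. complex_of_real (indicator (s -` {y} \<inter> space torus) \<omega>) *\<^sub>C y)"
    by (intro trig_approx_sum trig_approx_scaleC_const trig_approx_indicator)
       (use simple_functionD(2)[OF s(1)] in simp)
  then have "trig_approx m s"
  proof (rule trig_approx_cong[rotated])
    fix \<omega> assume "\<omega> \<in> space torus"
    then show "(\<Sum>y\<in>s ` space torus. complex_of_real (indicator (s -` {y} \<inter> space torus) \<omega>) *\<^sub>C y) = s \<omega>"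
      by (rule simple_function_eq_sum_indicator[OF s(1), of \<omega>, unfolded space_coord_algebra, symmetric])
  qed
  then show "\<exists>g. trig_approx m g \<and> L1_norm torus (\<lambda>\<omega>. f \<omega> - g \<omega>) < e" using s(3) by blast
qed

section \<open>Conditional expectations and Fourier coefficients of Hardy martingales\<close>

lemma measurable_coordinate_coord_algebra:
  assumes "j \<in> {1..n}" shows "(\<lambda>\<omega>. \<omega> j) \<in> borel_measurable (coord_algebra n)"
proof -
  have r: "(\<lambda>\<omega>. restrict \<omega> {1..n}) \<in> measurable (coord_algebra n) (Pi\<^sub>M {1..n} (\<lambda>_. circle))"
    unfolding coord_algebra_def 
    by (rule measurable_vimage_algebra1) (use measurable_space[OF measurable_restrict_torus] in auto)
  have "(\<lambda>\<omega>. restrict \<omega> {1..n} j) \<in> measurable (coord_algebra n) circle"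
    using measurable_compose[OF r measurable_component_singleton[OF assms]] .
  from measurable_compose[OF this measurable_circle_ident] show ?thesis using assms by simp
qed

lemma measurable_chi_coord_algebra:
  assumes "a \<in> freqs n" "n \<le> m" shows "chi m a \<in> borel_measurable (coord_algebra n)"
proof -
  have "(\<lambda>\<omega>. \<omega> j powi a j) \<in> borel_measurable (coord_algebra n)" if "j \<in> {1..n}" for j
    using measurable_coordinate_coord_algebra[OF that] by (rule borel_measurable_power_int)
  then have "chi n a \<in> borel_measurable (coord_algebra n)"
    unfolding chi_def by (rule borel_measurable_prod)
  moreover have "chi n a = chi m a" using chi_freqs_mono[OF assms] by (simp add: fun_eq_iff)
  ultimately show ?thesis by simp
qed

lemma indicator_coord_algebra_fun_upd:
  assumes A: "A \<in> sets (coord_algebra n)" and j: "j \<ge> 1" "j \<notin> {1..n}" and \<omega>: "\<omega> \<in> space torus" and u: "norm u = 1"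
  shows "indicator A (fun_upd \<omega> j u) = indicator A \<omega>"
proof -
  obtain B where B: "A = (\<lambda>\<omega>. restrict \<omega> {1..n}) -` B \<inter> space torus"
    using A unfolding sets_coord_algebra by blast
  have "fun_upd \<omega> j u \<in> space torus" using \<omega> u j by (auto simp: space_torus PiE_iff extensional_def)
  moreover have "restrict (fun_upd \<omega> j u) {1..n} = restrict \<omega> {1..n}"
    using j(2) by (auto simp: restrict_def fun_eq_iff)
  ultimately show ?thesis using \<omega> unfolding B by (simp add: indicator_def)
qed

text \<open>Conditional expectations given \<open>coord_algebra n\<close> are contractions, and they send a
  trigonometric polynomial to the part of it with frequencies in \<open>freqs n\<close>.\<close>

lemma cond_exp_trig_contraction:
  fixes x :: "(nat \<Rightarrow> int) \<Rightarrow> 'x::complex_banach"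
  assumes ce: "is_cond_exp torus (coord_algebra n) f g" and f: "f \<in> bochner_L1 torus" 
    and n: "n \<le> m" and S: "finite S" "S \<subseteq> freqs m"
  shows "L1_norm torus (\<lambda>\<omega>. g \<omega> - (\<Sum>a\<in>S \<inter> freqs n. chi m a \<omega> *\<^sub>C x a)) \<le> 
         L1_norm torus (\<lambda>\<omega>. f \<omega> - (\<Sum>a\<in>S. chi m a \<omega> *\<^sub>C x a))"
proof -
  define G where "G \<omega> = (\<Sum>a\<in>S. chi m a \<omega> *\<^sub>C x a)" for \<omega>
  define H where "H \<omega> = (\<Sum>a\<in>S \<inter> freqs n. chi m a \<omega> *\<^sub>C x a)" for \<omega>
  have G: "G \<in> bochner_L1 torus" unfolding G_def by (rule bochner_L1_chi_sum)
  have H: "H \<in> bochner_L1 torus" unfolding H_def by (rule bochner_L1_chi_sum)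
  have g: "g \<in> bochner_L1 torus" "strongly_measurable (coord_algebra n) g"
    using ce by (auto simp: is_cond_exp_def)
  define D where "D \<omega> = f \<omega> - G \<omega>" for \<omega>
  define E where "E \<omega> = g \<omega> - H \<omega>" for \<omega>
  have D: "D \<in> bochner_L1 torus" unfolding D_def by (rule bochner_L1_diff[OF f G])
  have E: "E \<in> bochner_L1 torus" unfolding E_def by (rule bochner_L1_diff[OF g(1) H])
  have EF: "strongly_measurable (coord_algebra n) E"
    unfolding E_def H_def
    by (intro strongly_measurable_diff g strongly_measurable_sum strongly_measurable_scaleC_const measurable_chi_coord_algebra n) auto
  have ind_m: "(\<lambda>\<omega>. complex_of_real (indicator A \<omega>)) \<in> borel_measurable torus" if "A \<in> sets (coord_algebra n)" for A
  proof -
    have "A \<in> sets torus" using that sets_coord_algebra_subset by blast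
    then have "indicat_real A \<in> borel_measurable torus" by simp
    from measurable_compose[OF this borel_measurable_continuous_onI[OF continuous_on_of_real[OF continuous_on_id]]]
    show ?thesis .
  qed
  \<comment> \<open>\<open>D\<close> and \<open>E\<close> have the same integral over each set of the \<open>\<sigma>\<close>-algebra.\<close>
  have same: "\<exists>I. has_strong_integral torus (\<lambda>\<omega>. indicator A \<omega> *\<^sub>R D \<omega>) I \<and>
                  has_strong_integral torus (\<lambda>\<omega>. indicator A \<omega> *\<^sub>R E \<omega>) I" if A: "A \<in> sets (coord_algebra n)" for A
  proof -
    obtain I where I: "has_strong_integral torus (\<lambda>\<omega>. indicator A \<omega> *\<^sub>R f \<omega>) I" "has_strong_integral torus (\<lambda>\<omega>. indicator A \<omega> *\<^sub>R g \<omega>) I"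
      using ce A unfolding is_cond_exp_def by blast
    define F where "F a \<omega> = complex_of_real (indicator A \<omega>) * chi m a \<omega>" for a \<omega>
    have F: "integrable torus (F a)" for a
      unfolding F_def
      by (rule integrable_torus_bounded[where B=1]) (use ind_m[OF A] in \<open>auto simp: norm_mult indicator_def intro!: borel_measurable_times\<close>)
    have sum: "has_strong_integral torus (\<lambda>\<omega>. indicator A \<omega> *\<^sub>R (\<Sum>a\<in>T. chi m a \<omega> *\<^sub>C x a)) (\<Sum>a\<in>T. integral\<^sup>L torus (F a) *\<^sub>C x a)" for T
    proof -
      have "has_strong_integral torus (\<lambda>\<omega>. \<Sum>a\<in>T. F a \<omega> *\<^sub>C x a) (\<Sum>a\<in>T. integral\<^sup>L torus (F a) *\<^sub>C x a)"
        by (intro has_strong_integral_sum has_strong_integral_scaleC_const F)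
      moreover have "(\<Sum>a\<in>T. F a \<omega> *\<^sub>C x a) = indicator A \<omega> *\<^sub>R (\<Sum>a\<in>T. chi m a \<omega> *\<^sub>C x a)" for \<omega>
        unfolding F_def scaleR_eq_scaleC scaleC_sum_right scaleC_scaleC ..
      ultimately show ?thesis by simp
    qed
    have "(\<Sum>a\<in>S. integral\<^sup>L torus (F a) *\<^sub>C x a) = (\<Sum>a\<in>S \<inter> freqs n. integral\<^sup>L torus (F a) *\<^sub>C x a)"
    proof (rule sum.mono_neutral_right)
      show "\<forall>a\<in>S - S \<inter> freqs n. integral\<^sup>L torus (F a) *\<^sub>C x a = 0"
      proof
        fix a assume a: "a \<in> S - S \<inter> freqs n"
        then obtain j where j: "a j \<noteq> 0" "j \<notin> {1..n}" unfolding freqs_def by blast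
        have jm: "j \<in> {1..m}" using a j(1) S(2) unfolding freqs_def by blast
        have "integral\<^sup>L torus (F a) = 0"
          unfolding F_def
        proof (rule integral_torus_chi_mult_eq_0[where n=j])
          show "complex_of_real (indicator A (fun_upd \<omega> j u)) = complex_of_real (indicator A \<omega>)"
            if "\<omega> \<in> space torus" "norm u = 1" for \<omega> u
            using indicator_coord_algebra_fun_upd[OF A _ j(2) that, where 'a=real] jm by simp
        qed (use jm j ind_m[OF A] in auto)
        then show "integral\<^sup>L torus (F a) *\<^sub>C x a = 0" by simp
      qed
    qed (use S in auto)
    then have GH: "has_strong_integral torus (\<lambda>\<omega>. indicator A \<omega> *\<^sub>R G \<omega>) (\<Sum>a\<in>S. integral\<^sup>L torus (F a) *\<^sub>C x a)"
       "has_strong_integral torus (\<lambda>\<omega>. indicator A \<omega> *\<^sub>R H \<omega>) (\<Sum>a\<in>S. integral\<^sup>L torus (F a) *\<^sub>C x a)"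
      using sum[of S] sum[of "S \<inter> freqs n"] unfolding G_def H_def by simp_all
    show ?thesis
      using has_strong_integral_diff[OF I(1) GH(1)] has_strong_integral_diff[OF I(2) GH(2)]
      unfolding D_def E_def by (auto simp: scaleR_diff_right)
  qed
  have "L1_norm torus E \<le> L1_norm torus D"
  proof (rule field_le_epsilon)
    fix e :: real assume "e > 0"
    then have e2: "e / 2 > 0" by simp
    obtain s where s: "simple_function (coord_algebra n) s" "s \<in> bochner_L1 torus" "L1_norm torus (\<lambda>\<omega>. E \<omega> - s \<omega>) < e / 2"
      by (rule bochner_L1_simple_approx[OF E EF space_coord_algebra sets_coord_algebra_subset e2])
    define Y where "Y = s ` space torus"
    have Y: "finite Y" using s(1) by (simp add: simple_function_def Y_def)
    define A where "A y = s -` {y} \<inter> space torus" for y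
    have A: "A y \<in> sets (coord_algebra n)" for y
      using simple_functionD(2)[OF s(1), of "{y}"] by (simp add: A_def)
    have At: "A y \<in> sets torus" for y using A sets_coord_algebra_subset by blast
    have part: "(\<Sum>y\<in>Y. indicat_real (A y) \<omega>) = 1" if "\<omega> \<in> space torus" for \<omega>
    proof -
      have "(\<Sum>y\<in>Y. indicat_real (A y) \<omega>) = (\<Sum>y\<in>Y. if y = s \<omega> then 1 else 0)"
        using that by (intro sum.cong) (auto simp: A_def indicator_def)
      then show ?thesis using Y that by (simp add: Y_def)
    qed
    have ib: "integrable torus (\<lambda>\<omega>. indicat_real (A y) \<omega> * norm (h \<omega>))" if "h \<in> bochner_L1 torus" for h :: "_ \<Rightarrow> 'x" and y
      using integrable_mult_indicator[OF At[of y], of "\<lambda>\<omega>. norm (h \<omega>)"] that by (simp add: bochner_L1_def)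
    have split: "(\<Sum>y\<in>Y. LINT \<omega>|torus. indicat_real (A y) \<omega> * norm (h \<omega>)) = L1_norm torus h" 
      if "h \<in> bochner_L1 torus" for h :: "_ \<Rightarrow> 'x"
    proof -
      have "(\<Sum>y\<in>Y. LINT \<omega>|torus. indicat_real (A y) \<omega> * norm (h \<omega>)) = (LINT \<omega>|torus. (\<Sum>y\<in>Y. indicat_real (A y) \<omega> * norm (h \<omega>)))"
        by (rule Bochner_Integration.integral_sum[symmetric]) (rule ib[OF that])
      also have "\<dots> = L1_norm torus h"
        unfolding L1_norm_def 
        by (rule Bochner_Integration.integral_cong) (simp_all add: part flip: sum_distrib_right)
      finally show ?thesis .
    qed
    have piece: "(LINT \<omega>|torus. indicat_real (A y) \<omega> * norm (s \<omega>)) \<le> 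
        (LINT \<omega>|torus. indicat_real (A y) \<omega> * norm (D \<omega>)) + (LINT \<omega>|torus. indicat_real (A y) \<omega> * norm (E \<omega> - s \<omega>))" for y
    proof -
      obtain I where I: "has_strong_integral torus (\<lambda>\<omega>. indicator (A y) \<omega> *\<^sub>R D \<omega>) I"
          "has_strong_integral torus (\<lambda>\<omega>. indicator (A y) \<omega> *\<^sub>R E \<omega>) I"
        using same[OF A] by blast
      have ind: "integrable torus (\<lambda>\<omega>. complex_of_real (indicator (A y) \<omega>))"
        by (rule integrable_torus_bounded[where B=1, OF ind_m[OF A]]) (simp add: indicator_def)
      have As: "indicator (A y) \<omega> *\<^sub>R s \<omega> = complex_of_real (indicator (A y) \<omega>) *\<^sub>C y" for \<omega>
        by (auto simp: indicator_def A_def)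
      have J: "has_strong_integral torus (\<lambda>\<omega>. indicator (A y) \<omega> *\<^sub>R s \<omega>) (complex_of_real (measure torus (A y)) *\<^sub>C y)"
        using has_strong_integral_scaleC_const[OF ind, of y] At[of y] sets.sets_into_space[OF At[of y]] 
        unfolding As by (simp add: Int_absorb2)
      have n1: "norm I \<le> (LINT \<omega>|torus. indicat_real (A y) \<omega> * norm (D \<omega>))"
        using has_strong_integral_norm_le[OF I(1)] ib[OF D] by (simp add: L1_norm_def)
      have n2: "norm (I - complex_of_real (measure torus (A y)) *\<^sub>C y) \<le> (LINT \<omega>|torus. indicat_real (A y) \<omega> * norm (E \<omega> - s \<omega>))"
        using has_strong_integral_norm_le[OF has_strong_integral_diff[OF I(2) J]] ib[OF bochner_L1_diff[OF E s(2)]]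
        by (simp add: L1_norm_def flip: scaleR_diff_right)
      have "(LINT \<omega>|torus. indicat_real (A y) \<omega> * norm (s \<omega>)) = (LINT \<omega>|torus. indicat_real (A y) \<omega> * norm y)"
        by (rule Bochner_Integration.integral_cong) (auto simp: indicator_def A_def)
      also have "\<dots> = norm (complex_of_real (measure torus (A y)) *\<^sub>C y)"
        using sets.sets_into_space[OF At[of y]] by (simp add: norm_scaleC Int_absorb2 At)
      also have "\<dots> \<le> norm I + norm (I - complex_of_real (measure torus (A y)) *\<^sub>C y)"
        using norm_triangle_ineq4[of I "I - complex_of_real (measure torus (A y)) *\<^sub>C y"] by simp
      finally show ?thesis using n1 n2 by linarith
    qed
    have "L1_norm torus s = (\<Sum>y\<in>Y. LINT \<omega>|torus. indicat_real (A y) \<omega> * norm (s \<omega>))" by (rule split[OF s(2), symmetric])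
    also have "\<dots> \<le> (\<Sum>y\<in>Y. (LINT \<omega>|torus. indicat_real (A y) \<omega> * norm (D \<omega>)) + (LINT \<omega>|torus. indicat_real (A y) \<omega> * norm (E \<omega> - s \<omega>)))"
      by (intro sum_mono piece)
    also have "\<dots> = L1_norm torus D + L1_norm torus (\<lambda>\<omega>. E \<omega> - s \<omega>)"
      unfolding sum.distrib split[OF D] split[OF bochner_L1_diff[OF E s(2)]] ..
    finally show "L1_norm torus E \<le> L1_norm torus D + e"
      using s(3) L1_norm_le_add_diff[OF E s(2)] by linarith
  qed
  then show ?thesis unfolding D_def E_def G_def H_def .
qed

lemma freqs_add: "a \<in> freqs m \<Longrightarrow> b \<in> freqs m \<Longrightarrow> (\<lambda>j. a j + b j) \<in> freqs m"
  by (simp add: freqs_def)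

lemma freqs_diff: "a \<in> freqs m \<Longrightarrow> b \<in> freqs m \<Longrightarrow> (\<lambda>j. a j - b j) \<in> freqs m"
  by (simp add: freqs_def)

lemma freqs_fun_upd_0: "a \<in> freqs m \<Longrightarrow> fun_upd a n 0 \<in> freqs m"
  by (simp add: freqs_def)

text \<open>The frequencies of the Hardy martingales stopped at time \<open>m\<close>.\<close>

definition hardy_freqs :: "nat \<Rightarrow> (nat \<Rightarrow> int) set" where
  "hardy_freqs m = (\<Union>n\<in>{..m}. lead_freqs n)"

lemma hardy_freqs_subset: "hardy_freqs m \<subseteq> freqs m"
  unfolding hardy_freqs_def lead_freqs_def using freqs_mono by blast

lemma not_hardy_freq_last_negative:
  assumes b: "b \<in> freqs m" "b \<notin> hardy_freqs m"
  obtains n where "1 \<le> n" "n \<le> m" "b \<in> freqs n" "b n < 0"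
proof -
  define n where "n = (LEAST n. b \<in> freqs n)"
  have n: "b \<in> freqs n" unfolding n_def by (rule LeastI[of _ m]) (rule b(1))
  have nm: "n \<le> m" unfolding n_def by (rule Least_le) (rule b(1))
  have nl: "b \<notin> lead_freqs n" using b(2) nm by (auto simp: hardy_freqs_def)
  then have n1: "1 \<le> n" using n by (cases n) (auto simp: lead_freqs_def)
  have "b n \<noteq> 0"
  proof
    assume "b n = 0"
    have "b \<in> freqs (n - 1)"
      unfolding freqs_def
    proof (intro CollectI allI impI)
      fix j assume j: "j \<notin> {1..n - 1}"
      show "b j = 0"
      proof (cases "j = n")
        case False
        then have "j \<notin> {1..n}" using j by auto
        then show ?thesis using n by (simp add: freqs_def)
      qed (simp add: \<open>b n = 0\<close>)
    qed
    from Least_le[of "\<lambda>n. b \<in> freqs n", OF this] show False using n1 by (simp add: n_def[symmetric])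
  qed
  moreover have "\<not> 0 < b n" using nl n by (auto simp: lead_freqs_def)
  ultimately show ?thesis using that[OF n1 nm n] by simp
qed

lemma has_strong_integral_cong:
  assumes "\<And>\<omega>. \<omega> \<in> space M \<Longrightarrow> f \<omega> = g \<omega>" "has_strong_integral M f I"
  shows "has_strong_integral M g I"
proof -
  have 1: "strongly_measurable M f \<longleftrightarrow> strongly_measurable M g"
    unfolding strongly_measurable_def using assms(1) by simp
  have 2: "(\<integral>\<^sup>+ \<omega>. ennreal (norm (f \<omega> - s \<omega>)) \<partial>M) = (\<integral>\<^sup>+ \<omega>. ennreal (norm (g \<omega> - s \<omega>)) \<partial>M)" for s
    by (rule nn_integral_cong) (simp add: assms(1))
  show ?thesis using assms(2) unfolding has_strong_integral_def 1 2 .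
qed

lemma integrable_circle_power_int: "integrable circle (\<lambda>z. z powi k)"
  by (rule integrable_circle_bounded[where B=1]) (auto simp: norm_power_int)

lemma has_strong_integral_circle_powers:
  fixes x :: "'i \<Rightarrow> 'x::complex_banach"
  assumes "finite I"
  shows "has_strong_integral circle (\<lambda>z. z powi k *\<^sub>C (\<Sum>i\<in>I. z powi p i *\<^sub>C x i)) (\<Sum>i\<in>{i\<in>I. p i = - k}. x i)"
proof (rule has_strong_integral_cong)
  have "has_strong_integral circle (\<lambda>z. \<Sum>i\<in>I. z powi (k + p i) *\<^sub>C x i) (\<Sum>i\<in>I. (LINT z|circle. z powi (k + p i)) *\<^sub>C x i)"
    by (intro has_strong_integral_sum has_strong_integral_scaleC_const integrable_circle_power_int)
  also have "(\<Sum>i\<in>I. (LINT z|circle. z powi (k + p i)) *\<^sub>C x i) = (\<Sum>i\<in>I. if p i = - k then x i else 0)"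
  proof (rule sum.cong[OF HOL.refl])
    fix i 
    show "(LINT z|circle. z powi (k + p i)) *\<^sub>C x i = (if p i = - k then x i else 0)"
    proof (cases "p i = - k")
      case True
      then show ?thesis by (simp add: circle.prob_space)
    next
      case False
      then have "k + p i \<noteq> 0" by simp
      then show ?thesis using False by (simp add: integral_circle_power_int)
    qed
  qed
  also have "\<dots> = (\<Sum>i\<in>{i\<in>I. p i = - k}. x i)"
    using assms by (simp add: sum.inter_filter)
  finally show "has_strong_integral circle (\<lambda>z. \<Sum>i\<in>I. z powi (k + p i) *\<^sub>C x i) (\<Sum>i\<in>{i\<in>I. p i = - k}. x i)" .
  fix z assume "z \<in> space circle"
  then have "z \<noteq> 0" by (auto simp: space_circle)
  then show "(\<Sum>i\<in>I. z powi (k + p i) *\<^sub>C x i) = z powi k *\<^sub>C (\<Sum>i\<in>I. z powi p i *\<^sub>C x i)"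
    by (simp add: scaleC_sum_right scaleC_scaleC power_int_add)
qed

lemma H1_tilde_bochner_L1: "F \<in> H1_tilde \<Longrightarrow> F \<in> bochner_L1 circle"
  by (simp add: H1_tilde_def)

lemma bochner_L1_powers: "(\<lambda>z. \<Sum>i\<in>I. z powi p i *\<^sub>C x i) \<in> bochner_L1 circle"
  by (rule bochner_L1_sum, rule bochner_L1_scaleC_const, rule integrable_circle_power_int)

text \<open>The Fourier coefficients of negative index of a function in \<open>H1_tilde\<close> vanish; hence those of a
  trigonometric polynomial are bounded by its distance to \<open>H1_tilde\<close>.\<close>

lemma negative_coefficient_le_dist_H1:
  fixes x :: "'i \<Rightarrow> 'x::complex_banach"
  assumes h: "h \<in> H1_tilde" and I: "finite I" and k: "k < 0"
  shows "norm (\<Sum>i\<in>{i\<in>I. p i = k}. x i) \<le> L1_norm circle (\<lambda>z. h z - (\<Sum>i\<in>I. z powi p i *\<^sub>C x i))"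
proof (rule field_le_epsilon)
  define g where "g z = (\<Sum>i\<in>I. z powi p i *\<^sub>C x i)" for z
  have g: "g \<in> bochner_L1 circle" unfolding g_def by (rule bochner_L1_powers)
  fix e :: real assume "e > 0"
  then obtain q where "q \<in> analytic_polynomials" and hq: "L1_norm circle (\<lambda>z. h z - q z) < e"
    using h unfolding H1_tilde_def by blast
  then obtain N y where q: "q = (\<lambda>z. \<Sum>n\<le>N. z ^ n *\<^sub>C y n)" unfolding analytic_polynomials_def by blast
  have q': "q = (\<lambda>z. \<Sum>n\<in>{..N}. z powi int n *\<^sub>C y n)" unfolding q by simp
  have qL: "q \<in> bochner_L1 circle" unfolding q' by (rule bochner_L1_powers)
  have "{n\<in>{..N}. int n = - (- k)} = {}" using k by auto
  then have "has_strong_integral circle (\<lambda>z. z powi (-k) *\<^sub>C q z) 0"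
    using has_strong_integral_circle_powers[where I="{..N}" and k="- k" and p=int and x=y] 
    unfolding q' by (simp only: finite_atMost sum.empty)
  moreover have "has_strong_integral circle (\<lambda>z. z powi (-k) *\<^sub>C g z) (\<Sum>i\<in>{i\<in>I. p i = k}. x i)"
    using has_strong_integral_circle_powers[OF I, of "- k" p x] unfolding g_def by simp
  ultimately have hs: "has_strong_integral circle (\<lambda>z. z powi (-k) *\<^sub>C (g z - q z)) (\<Sum>i\<in>{i\<in>I. p i = k}. x i)"
    using has_strong_integral_diff[of circle "\<lambda>z. z powi (-k) *\<^sub>C g z" _ "\<lambda>z. z powi (-k) *\<^sub>C q z" 0] 
    by (simp add: scaleC_diff_right)
  have eq: "norm (z powi (-k) *\<^sub>C (g z - q z)) = norm (g z - q z)" if "z \<in> space circle" for z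
    using that by (simp add: norm_scaleC norm_power_int space_circle)
  have i: "integrable circle (\<lambda>z. norm (g z - q z))" using bochner_L1_diff[OF g qL] by (simp add: bochner_L1_def)
  have "norm (\<Sum>i\<in>{i\<in>I. p i = k}. x i) \<le> L1_norm circle (\<lambda>z. z powi (-k) *\<^sub>C (g z - q z))"
    by (rule has_strong_integral_norm_le[OF hs]) (rule iffD2[OF Bochner_Integration.integrable_cong[OF HOL.refl eq] i])
  also have "\<dots> = L1_norm circle (\<lambda>z. g z - q z)"
    unfolding L1_norm_def by (rule Bochner_Integration.integral_cong[OF HOL.refl eq])
  also have "\<dots> \<le> L1_norm circle (\<lambda>z. g z - h z) + L1_norm circle (\<lambda>z. h z - q z)"
    by (rule L1_norm_triangle[OF g H1_tilde_bochner_L1[OF h] qL])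
  also have "\<dots> \<le> L1_norm circle (\<lambda>z. h z - g z) + e"
    using hq L1_norm_minus_commute[of circle g h] by simp
  finally show "norm (\<Sum>i\<in>{i\<in>I. p i = k}. x i) \<le> L1_norm circle (\<lambda>z. h z - (\<Sum>i\<in>I. z powi p i *\<^sub>C x i)) + e"
    unfolding g_def .
qed

text \<open>A Hardy martingale has vanishing Fourier coefficients outside \<open>hardy_freqs m\<close>, in a quantitative
  form that avoids defining its coefficients: those of a polynomial at such frequencies are
  bounded by its distance to the martingale.\<close>

lemma hardy_martingale_coefficient_le:
  fixes M :: "nat \<Rightarrow> (nat \<Rightarrow> complex) \<Rightarrow> 'x::complex_banach"
  assumes M: "hardy_martingale M" and S: "finite S" "S \<subseteq> freqs m" and b: "b \<in> S" "b \<notin> hardy_freqs m"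
  shows "norm (x b) \<le> L1_norm torus (\<lambda>\<omega>. M m \<omega> - (\<Sum>a\<in>S. chi m a \<omega> *\<^sub>C x a))"
proof -
  obtain n where n: "1 \<le> n" "n \<le> m" "b \<in> freqs n" "b n < 0"
    by (rule not_hardy_freq_last_negative[of b m]) (use b S in auto)
  have L1M: "M k \<in> bochner_L1 torus" for k using M by (auto simp: hardy_martingale_def torus_martingale_def)
  have ce: "is_cond_exp torus (coord_algebra n) (M m) (M n)" 
    using M n(2) by (auto simp: hardy_martingale_def torus_martingale_def)
  define T where "T = S \<inter> freqs n"
  have T: "finite T" using S by (simp add: T_def)
  define G where "G \<omega> = (\<Sum>a\<in>T. chi m a \<omega> *\<^sub>C x a)" for \<omega>
  have G: "G \<in> bochner_L1 torus" unfolding G_def by (rule bochner_L1_chi_sum)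
  \<comment> \<open>The coefficient of \<open>G\<close> of index \<open>b n\<close> with respect to the \<open>n\<close>-th coordinate.\<close>
  define y where "y \<omega> = (\<Sum>a\<in>{a\<in>T. a n = b n}. chi m (fun_upd a n 0) \<omega> *\<^sub>C x a)" for \<omega>
  have yL: "y \<in> bochner_L1 torus" 
    unfolding y_def by (rule bochner_L1_sum, rule bochner_L1_scaleC_const, rule integrable_chi)
  have d: "integrable torus (\<lambda>\<omega>. norm (M n \<omega> - G \<omega>))"
    using bochner_L1_diff[OF L1M G] by (simp add: bochner_L1_def)
  have "AE \<omega> in torus. (\<lambda>\<theta>. M n (fun_upd \<omega> n \<theta>)) \<in> H1_tilde"
    using M n(1) by (auto simp: hardy_martingale_def)
  then have AE: "AE \<omega> in torus. norm (y \<omega>) \<le> (LINT u|circle. norm (M n (fun_upd \<omega> n u) - G (fun_upd \<omega> n u)))"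
  proof eventually_elim
    fix \<omega> assume h: "(\<lambda>\<theta>. M n (fun_upd \<omega> n \<theta>)) \<in> H1_tilde"
    have "G (fun_upd \<omega> n u) = (\<Sum>a\<in>T. u powi a n *\<^sub>C (chi m (fun_upd a n 0) \<omega> *\<^sub>C x a))" for u
      unfolding G_def chi_fun_upd[OF n(1,2)] by (simp add: scaleC_scaleC mult.commute)
    then show "norm (y \<omega>) \<le> (LINT u|circle. norm (M n (fun_upd \<omega> n u) - G (fun_upd \<omega> n u)))"
      using negative_coefficient_le_dist_H1[OF h T n(4), where p="\<lambda>a. a n" and x="\<lambda>a. chi m (fun_upd a n 0) \<omega> *\<^sub>C x a"]
      unfolding y_def L1_norm_def by simp
  qed
  have "norm (x b) \<le> L1_norm torus y"
  proof -
    define b' where "b' = fun_upd b n 0"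
    define F where "F a \<omega> = cnj (chi m b' \<omega>) * chi m (fun_upd a n 0) \<omega>" for a \<omega>
    have FL: "integrable torus (F a)" for a
    proof (rule integrable_torus_bounded[where B=1])
      have "(\<lambda>\<omega>. cnj (chi m b' \<omega>)) \<in> borel_measurable torus"
        by (rule measurable_compose[OF measurable_chi borel_measurable_continuous_onI]) (intro continuous_intros)
      then show "F a \<in> borel_measurable torus" unfolding F_def by measurable
    qed (simp add: F_def norm_mult)
    have int: "integral\<^sup>L torus (F a) = (if a = b then 1 else 0)" if a: "a \<in> T" "a n = b n" for a
    proof -
      have "integral\<^sup>L torus (F a) = (LINT \<omega>|torus. chi m (\<lambda>j. fun_upd a n 0 j - b' j) \<omega>)"
        by (rule Bochner_Integration.integral_cong[OF HOL.refl])
           (subst chi_diff, auto simp: F_def norm_torus_coordinate)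
      also have "\<dots> = (if (\<lambda>j. fun_upd a n 0 j - b' j) = (\<lambda>_. 0) then 1 else 0)"
        unfolding b'_def by (rule integral_chi, intro freqs_diff freqs_fun_upd_0) (use a(1) b(1) S(2) in \<open>auto simp: T_def\<close>)
      also have "(\<lambda>j. fun_upd a n 0 j - b' j) = (\<lambda>_. 0) \<longleftrightarrow> a = b"
        using a(2) by (auto simp: b'_def fun_eq_iff)
      finally show ?thesis .
    qed
    have "(\<Sum>a\<in>{a\<in>T. a n = b n}. integral\<^sup>L torus (F a) *\<^sub>C x a) = (\<Sum>a\<in>{a\<in>T. a n = b n}. if a = b then x b else 0)"
      by (rule sum.cong) (auto simp: int)
    also have "\<dots> = x b"
    proof -
      have "b \<in> T" using b n by (simp add: T_def)
      then show ?thesis using T by simp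
    qed
    finally have "norm (x b) \<le> L1_norm torus (\<lambda>\<omega>. \<Sum>a\<in>{a\<in>T. a n = b n}. F a \<omega> *\<^sub>C x a)"
      using norm_sum_integral_scaleC_le[of "{a\<in>T. a n = b n}" torus F x] FL by simp
    also have "(\<lambda>\<omega>. \<Sum>a\<in>{a\<in>T. a n = b n}. F a \<omega> *\<^sub>C x a) = (\<lambda>\<omega>. cnj (chi m b' \<omega>) *\<^sub>C y \<omega>)"
      unfolding F_def y_def by (simp add: scaleC_sum_right scaleC_scaleC)
    also have "L1_norm torus \<dots> = L1_norm torus y"
      unfolding L1_norm_def by (rule Bochner_Integration.integral_cong[OF HOL.refl]) (simp add: norm_scaleC)
    finally show ?thesis .
  qed
  also have "\<dots> \<le> (LINT \<omega>|torus. LINT u|circle. norm (M n (fun_upd \<omega> n u) - G (fun_upd \<omega> n u)))"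
    unfolding L1_norm_def
    by (rule integral_mono_AE[OF _ integral_torus_update(1)[OF n(1) d] AE]) (use yL in \<open>simp add: bochner_L1_def\<close>)
  also have "\<dots> = L1_norm torus (\<lambda>\<omega>. M n \<omega> - G \<omega>)"
    unfolding L1_norm_def by (rule integral_torus_update(2)[OF n(1) d])
  also have "\<dots> \<le> L1_norm torus (\<lambda>\<omega>. M m \<omega> - (\<Sum>a\<in>S. chi m a \<omega> *\<^sub>C x a))"
    unfolding G_def T_def by (rule cond_exp_trig_contraction[OF ce L1M n(2) S])
  finally show ?thesis .
qed

section \<open>Fejer means\<close>

text \<open>The Fejer kernel below is the squared modulus of the Dirichlet kernel of this cube, divided by the
  number of its points; \<open>fejer_weight\<close> gives its Fourier coefficients.\<close>

definition cube :: "nat \<Rightarrow> nat \<Rightarrow> (nat \<Rightarrow> int) set" where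
  "cube m D = PiE_dflt {1..m} 0 (\<lambda>_. {0..int D})"

definition fejer_weight :: "nat \<Rightarrow> nat \<Rightarrow> (nat \<Rightarrow> int) \<Rightarrow> real" where
  "fejer_weight m D a = card {c \<in> cube m D. (\<lambda>j. c j - a j) \<in> cube m D} / card (cube m D)"

definition fejer_kernel :: "nat \<Rightarrow> nat \<Rightarrow> (nat \<Rightarrow> complex) \<Rightarrow> real" where
  "fejer_kernel m D \<omega> = (cmod (\<Sum>c\<in>cube m D. chi m c \<omega>))\<^sup>2 / card (cube m D)"

lemma finite_cube [simp]: "finite (cube m D)"
  unfolding cube_def by (rule finite_PiE_dflt) auto

lemma card_cube: "card (cube m D) = (D + 1) ^ m"
  unfolding cube_def by (subst card_PiE_dflt) (auto simp: nat_add_distrib)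

lemma cube_subset_freqs: "cube m D \<subseteq> freqs m"
  by (auto simp: cube_def PiE_dflt_def freqs_def)

lemma fejer_kernel_nonneg [simp]: "0 \<le> fejer_kernel m D \<omega>"
  by (simp add: fejer_kernel_def)

lemma fejer_weight_nonneg [simp]: "0 \<le> fejer_weight m D a"
  by (simp add: fejer_weight_def)

lemma fejer_weight_le_1: "fejer_weight m D a \<le> 1"
proof -
  have "card {c \<in> cube m D. (\<lambda>j. c j - a j) \<in> cube m D} \<le> card (cube m D)"
    by (rule card_mono) auto
  moreover have "0 < card (cube m D)" by (simp add: card_cube)
  ultimately show ?thesis unfolding fejer_weight_def by (simp add: divide_le_eq)
qed

lemma fejer_kernel_expand:
  assumes "\<And>j. 1 \<le> j \<Longrightarrow> norm (\<omega> j) = 1"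
  shows "complex_of_real (fejer_kernel m D \<omega>) = 
    (\<Sum>c\<in>cube m D. \<Sum>c'\<in>cube m D. chi m (\<lambda>j. c j - c' j) \<omega>) / of_nat (card (cube m D))"
proof -
  define s where "s = (\<Sum>c\<in>cube m D. chi m c \<omega>)"
  have "complex_of_real ((cmod s)\<^sup>2) = s * cnj s" by (rule complex_norm_square)
  also have "\<dots> = (\<Sum>c\<in>cube m D. \<Sum>c'\<in>cube m D. chi m c \<omega> * cnj (chi m c' \<omega>))"
    unfolding s_def cnj_sum by (rule sum_product)
  also have "\<dots> = (\<Sum>c\<in>cube m D. \<Sum>c'\<in>cube m D. chi m (\<lambda>j. c j - c' j) \<omega>)"
    by (intro sum.cong HOL.refl chi_diff[symmetric] assms)
  finally show ?thesis unfolding fejer_kernel_def s_def by simp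
qed

lemma measurable_fejer_kernel [measurable]: "fejer_kernel m D \<in> borel_measurable torus"
  unfolding fejer_kernel_def by measurable

lemma fejer_kernel_bounded:
  assumes "\<And>j. 1 \<le> j \<Longrightarrow> norm (\<omega> j) = 1"
  shows "fejer_kernel m D \<omega> \<le> card (cube m D)"
proof -
  have "cmod (\<Sum>c\<in>cube m D. chi m c \<omega>) \<le> (\<Sum>c\<in>cube m D. 1)"
    by (rule sum_norm_le) (simp add: norm_chi assms)
  then have "(cmod (\<Sum>c\<in>cube m D. chi m c \<omega>))\<^sup>2 \<le> (real (card (cube m D)))\<^sup>2"
    by (intro power_mono) auto
  then show ?thesis unfolding fejer_kernel_def 
    by (simp add: divide_le_eq power2_eq_square card_cube)
qed

lemma integral_fejer_kernel_chi:
  assumes a: "a \<in> freqs m"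
  shows "(LINT \<omega>|torus. complex_of_real (fejer_kernel m D \<omega>) * chi m a \<omega>) = complex_of_real (fejer_weight m D a)"
proof -
  let ?C = "cube m D" and ?N = "of_nat (card (cube m D)) :: complex"
  have "(LINT \<omega>|torus. complex_of_real (fejer_kernel m D \<omega>) * chi m a \<omega>) = 
    (LINT \<omega>|torus. (\<Sum>c\<in>?C. \<Sum>c'\<in>?C. chi m (\<lambda>j. (c j - c' j) + a j) \<omega>) / ?N)"
  proof (rule Bochner_Integration.integral_cong[OF HOL.refl])
    fix \<omega> assume \<omega>: "\<omega> \<in> space torus"
    have n1: "norm (\<omega> j) = 1" if "1 \<le> j" for j using norm_torus_coordinate[OF \<omega> that] .
    have nz: "\<omega> j \<noteq> 0" if "1 \<le> j" for j using n1[OF that] by auto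
    have exp: "complex_of_real (fejer_kernel m D \<omega>) = (\<Sum>c\<in>?C. \<Sum>c'\<in>?C. chi m (\<lambda>j. c j - c' j) \<omega>) / ?N"
      by (rule fejer_kernel_expand) (rule n1)
    have chi: "chi m (\<lambda>j. (c j - c' j) + a j) \<omega> = chi m (\<lambda>j. c j - c' j) \<omega> * chi m a \<omega>" for c c'
      by (rule chi_add) (rule nz)
    show "complex_of_real (fejer_kernel m D \<omega>) * chi m a \<omega> = 
        (\<Sum>c\<in>?C. \<Sum>c'\<in>?C. chi m (\<lambda>j. (c j - c' j) + a j) \<omega>) / ?N"
      unfolding exp chi times_divide_eq_left sum_distrib_right ..
  qed
  also have "\<dots> = (\<Sum>c\<in>?C. \<Sum>c'\<in>?C. (LINT \<omega>|torus. chi m (\<lambda>j. (c j - c' j) + a j) \<omega>)) / ?N"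
    by (simp add: Bochner_Integration.integral_sum Bochner_Integration.integrable_sum integrable_chi)
  also have "(\<Sum>c\<in>?C. \<Sum>c'\<in>?C. (LINT \<omega>|torus. chi m (\<lambda>j. (c j - c' j) + a j) \<omega>)) = 
      (\<Sum>c\<in>?C. \<Sum>c'\<in>?C. if c = (\<lambda>j. c' j - a j) then 1 else 0)"
  proof (intro sum.cong HOL.refl)
    fix c c' assume "c \<in> ?C" "c' \<in> ?C"
    then have "(\<lambda>j. (c j - c' j) + a j) \<in> freqs m"
      using a cube_subset_freqs[of m D] by (intro freqs_add freqs_diff) auto
    moreover have "(\<lambda>j. (c j - c' j) + a j) = (\<lambda>_. 0) \<longleftrightarrow> c = (\<lambda>j. c' j - a j)"
      by (auto simp: fun_eq_iff algebra_simps)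
    ultimately show "(LINT \<omega>|torus. chi m (\<lambda>j. (c j - c' j) + a j) \<omega>) = (if c = (\<lambda>j. c' j - a j) then 1 else 0)"
      using integral_chi by metis
  qed
  also have "\<dots> = (\<Sum>c'\<in>?C. if (\<lambda>j. c' j - a j) \<in> ?C then 1 else 0)"
    by (subst sum.swap) simp
  also have "\<dots> = of_nat (card {c \<in> ?C. (\<lambda>j. c j - a j) \<in> ?C})"
    by (simp flip: sum.inter_filter)
  finally show ?thesis unfolding fejer_weight_def by simp
qed

lemma integral_fejer_kernel: "(LINT \<omega>|torus. fejer_kernel m D \<omega>) = 1"
proof -
  have "complex_of_real (LINT \<omega>|torus. fejer_kernel m D \<omega>) = complex_of_real (fejer_weight m D (\<lambda>_. 0))"
    using integral_fejer_kernel_chi[OF zero_freq, of m D] by simp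
  also have "fejer_weight m D (\<lambda>_. 0) = 1" by (simp add: fejer_weight_def card_cube)
  finally show ?thesis by simp
qed

interpretation pair_torus: pair_prob_space torus torus ..

text \<open>Convolution with the Fejer kernel is a contraction.\<close>

lemma L1_norm_fejer_mean_le:
  fixes x :: "(nat \<Rightarrow> int) \<Rightarrow> 'x::complex_banach"
  assumes S: "S \<subseteq> freqs m"
  shows "L1_norm torus (\<lambda>\<omega>. \<Sum>a\<in>S. chi m a \<omega> *\<^sub>C (fejer_weight m D a *\<^sub>R x a)) \<le> L1_norm torus (\<lambda>\<omega>. \<Sum>a\<in>S. chi m a \<omega> *\<^sub>C x a)"
proof -
  define G where "G \<omega> = (\<Sum>a\<in>S. chi m a \<omega> *\<^sub>C x a)" for \<omega>
  have G: "G \<in> bochner_L1 torus" unfolding G_def by (rule bochner_L1_chi_sum)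
  define H where "H \<omega> \<theta> = fejer_kernel m D \<omega> * norm (G (rotate_torus \<omega> \<theta>))" for \<omega> \<theta>
  have Gr: "G (rotate_torus \<omega> \<theta>) = (\<Sum>a\<in>S. (chi m a \<omega> * chi m a \<theta>) *\<^sub>C x a)" for \<omega> \<theta>
    unfolding G_def chi_rotate ..
  have Gb: "norm (G (rotate_torus \<omega> \<theta>)) \<le> (\<Sum>a\<in>S. norm (x a))" if "\<omega> \<in> space torus" "\<theta> \<in> space torus" for \<omega> \<theta>
    unfolding Gr using that by (intro sum_norm_le) (simp add: norm_scaleC norm_mult)
  have Hm: "(\<lambda>(\<omega>, \<theta>). H \<omega> \<theta>) \<in> borel_measurable (torus \<Otimes>\<^sub>M torus)"
  proof -
    have "(\<lambda>p. norm (\<Sum>a\<in>S. (chi m a (fst p) * chi m a (snd p)) *\<^sub>C x a)) \<in> borel_measurable (torus \<Otimes>\<^sub>M torus)"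
      by (intro strongly_measurable_norm strongly_measurable_sum strongly_measurable_scaleC_const) measurable
    then show ?thesis unfolding H_def Gr case_prod_beta' by measurable
  qed
  have Hi: "integrable (torus \<Otimes>\<^sub>M torus) (\<lambda>(\<omega>, \<theta>). H \<omega> \<theta>)"
  proof (rule pair_torus.P.integrable_const_bound[OF _ Hm])
    have "norm (H \<omega> \<theta>) \<le> card (cube m D) * (\<Sum>a\<in>S. norm (x a))" if "\<omega> \<in> space torus" "\<theta> \<in> space torus" for \<omega> \<theta>
    proof -
      have "norm (H \<omega> \<theta>) = fejer_kernel m D \<omega> * norm (G (rotate_torus \<omega> \<theta>))"
        unfolding H_def by (simp add: abs_mult)
      also have "\<dots> \<le> card (cube m D) * (\<Sum>a\<in>S. norm (x a))"
        by (rule mult_mono[OF fejer_kernel_bounded Gb[OF that]]) (use norm_torus_coordinate[OF that(1)] in auto)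
      finally show ?thesis .
    qed
    then show "AE p in torus \<Otimes>\<^sub>M torus. norm (case p of (\<omega>, \<theta>) \<Rightarrow> H \<omega> \<theta>) \<le> card (cube m D) * (\<Sum>a\<in>S. norm (x a))"
      by (intro AE_I2) (auto simp: space_pair_measure)
  qed
  have pt: "norm (\<Sum>a\<in>S. chi m a \<theta> *\<^sub>C (fejer_weight m D a *\<^sub>R x a)) \<le> (LINT \<omega>|torus. H \<omega> \<theta>)" if \<theta>: "\<theta> \<in> space torus" for \<theta>
  proof -
    define F where "F a \<omega> = complex_of_real (fejer_kernel m D \<omega>) * chi m a \<omega>" for a \<omega>
    have F: "integrable torus (F a)" for a
    proof (rule integrable_torus_bounded[where B="card (cube m D)"])
      show "F a \<in> borel_measurable torus" unfolding F_def by measurable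
      show "norm (F a \<omega>) \<le> card (cube m D)" if "\<omega> \<in> space torus" for \<omega>
        unfolding F_def using that fejer_kernel_bounded[of \<omega> m D] norm_torus_coordinate[OF that] by (simp add: norm_mult)
    qed
    have "(\<Sum>a\<in>S. chi m a \<theta> *\<^sub>C (fejer_weight m D a *\<^sub>R x a)) = (\<Sum>a\<in>S. integral\<^sup>L torus (F a) *\<^sub>C (chi m a \<theta> *\<^sub>C x a))"
    proof (rule sum.cong[OF HOL.refl])
      fix a assume "a \<in> S"
      then have "integral\<^sup>L torus (F a) = complex_of_real (fejer_weight m D a)"
        unfolding F_def using S by (intro integral_fejer_kernel_chi) auto
      then show "chi m a \<theta> *\<^sub>C (fejer_weight m D a *\<^sub>R x a) = integral\<^sup>L torus (F a) *\<^sub>C (chi m a \<theta> *\<^sub>C x a)"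
        by (simp add: scaleR_eq_scaleC scaleC_scaleC mult.commute)
    qed
    also have "norm \<dots> \<le> L1_norm torus (\<lambda>\<omega>. \<Sum>a\<in>S. F a \<omega> *\<^sub>C (chi m a \<theta> *\<^sub>C x a))"
      by (rule norm_sum_integral_scaleC_le) (rule F)
    also have "\<dots> = (LINT \<omega>|torus. H \<omega> \<theta>)"
      unfolding L1_norm_def
    proof (rule Bochner_Integration.integral_cong[OF HOL.refl])
      fix \<omega>
      have "(\<Sum>a\<in>S. F a \<omega> *\<^sub>C (chi m a \<theta> *\<^sub>C x a)) = complex_of_real (fejer_kernel m D \<omega>) *\<^sub>C G (rotate_torus \<omega> \<theta>)"
        unfolding F_def Gr scaleC_sum_right scaleC_scaleC by (simp add: mult.assoc)
      then show "norm (\<Sum>a\<in>S. F a \<omega> *\<^sub>C (chi m a \<theta> *\<^sub>C x a)) = H \<omega> \<theta>"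
        unfolding H_def by (simp add: norm_scaleC)
    qed
    finally show ?thesis .
  qed
  have "L1_norm torus (\<lambda>\<omega>. \<Sum>a\<in>S. chi m a \<omega> *\<^sub>C (fejer_weight m D a *\<^sub>R x a)) \<le> (LINT \<theta>|torus. LINT \<omega>|torus. H \<omega> \<theta>)"
    unfolding L1_norm_def
  proof (rule integral_mono[OF _ _ pt])
    show "integrable torus (\<lambda>\<omega>. norm (\<Sum>a\<in>S. chi m a \<omega> *\<^sub>C (fejer_weight m D a *\<^sub>R x a)))"
      using bochner_L1_chi_sum[of m "\<lambda>a. fejer_weight m D a *\<^sub>R x a" S] by (simp add: bochner_L1_def)
    show "integrable torus (\<lambda>\<theta>. LINT \<omega>|torus. H \<omega> \<theta>)"
      using pair_torus.integrable_snd[OF Hi] .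
  qed
  also have "\<dots> = (LINT \<omega>|torus. LINT \<theta>|torus. H \<omega> \<theta>)"
    using pair_torus.Fubini_integral[OF Hi] .
  also have "\<dots> = (LINT \<omega>|torus. fejer_kernel m D \<omega> * L1_norm torus G)"
  proof (rule Bochner_Integration.integral_cong[OF HOL.refl])
    fix \<omega> assume \<omega>: "\<omega> \<in> space torus"
    have "(LINT \<theta>|torus. norm (G (rotate_torus \<omega> \<theta>))) = L1_norm torus G"
      unfolding L1_norm_def 
      by (rule integral_rotate_torus[OF norm_torus_coordinate[OF \<omega>]]) (use G in \<open>auto simp: bochner_L1_def\<close>)
    then show "(LINT \<theta>|torus. H \<omega> \<theta>) = fejer_kernel m D \<omega> * L1_norm torus G"
      unfolding H_def by simp
  qed
  also have "\<dots> = L1_norm torus G" by (simp add: integral_fejer_kernel)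
  finally show ?thesis unfolding G_def .
qed

lemma fejer_weight_ge:
  assumes a: "a \<in> freqs m" "\<And>j. \<bar>a j\<bar> \<le> int d" and D: "d \<le> D"
  shows "1 - real m * real d / real (D + 1) \<le> fejer_weight m D a"
proof -
  define B where "B j = {max 0 (a j)..min (int D) (int D + a j)}" for j
  have "PiE_dflt {1..m} 0 B \<subseteq> {c \<in> cube m D. (\<lambda>j. c j - a j) \<in> cube m D}"
    using a(1) by (fastforce simp: PiE_dflt_def cube_def B_def freqs_def)
  then have "card (PiE_dflt {1..m} 0 B) \<le> card {c \<in> cube m D. (\<lambda>j. c j - a j) \<in> cube m D}"
    by (rule card_mono[rotated]) auto
  moreover have "card (PiE_dflt {1..m} 0 B) = (\<Prod>j\<in>{1..m}. card (B j))"
    by (rule card_PiE_dflt) (auto simp: B_def)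
  moreover have "(\<Prod>j\<in>{1..m}. D + 1 - d) \<le> (\<Prod>j\<in>{1..m}. card (B j))"
  proof (rule prod_mono)
    fix j
    show "0 \<le> D + 1 - d \<and> D + 1 - d \<le> card (B j)"
      using a(2)[of j] D unfolding B_def by (auto simp: max_def min_def)
  qed
  ultimately have "(D + 1 - d) ^ m \<le> card {c \<in> cube m D. (\<lambda>j. c j - a j) \<in> cube m D}" by simp
  then have "real ((D + 1 - d) ^ m) / real ((D + 1) ^ m) \<le> fejer_weight m D a"
    unfolding fejer_weight_def card_cube by (intro divide_right_mono) (simp_all only: of_nat_le_iff of_nat_0_le_iff)
  moreover have "real ((D + 1 - d) ^ m) / real ((D + 1) ^ m) = (1 + (- (real d / real (D + 1)))) ^ m"
    using D by (simp add: of_nat_diff power_divide[symmetric] diff_divide_distrib add_divide_distrib[symmetric])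
  moreover have "1 + real m * (- (real d / real (D + 1))) \<le> (1 + (- (real d / real (D + 1)))) ^ m"
    by (rule Bernoulli_inequality) (use D in \<open>simp add: divide_le_eq\<close>)
  ultimately show ?thesis by simp
qed

lemma fejer_weight_near_1:
  assumes S: "finite S" "S \<subseteq> freqs m" and e: "e > 0"
  obtains D where "\<And>a. a \<in> S \<Longrightarrow> 1 - e \<le> fejer_weight m D a" "\<And>a j. a \<in> S \<Longrightarrow> \<bar>a j\<bar> \<le> int D"
proof -
  have fin: "finite ((\<lambda>(a, j). nat \<bar>a j\<bar>) ` (S \<times> {1..m}))" using S by auto
  define d where "d = Max (insert 0 ((\<lambda>(a, j). nat \<bar>a j\<bar>) ` (S \<times> {1..m})))"
  have d: "\<bar>a j\<bar> \<le> int d" if "a \<in> S" for a j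
  proof (cases "j \<in> {1..m}")
    case True
    have "nat \<bar>a j\<bar> \<le> d" unfolding d_def by (rule Max_ge) (use fin that True in force)+
    then show ?thesis by linarith
  next
    case False
    then show ?thesis using that S by (auto simp: freqs_def subset_iff)
  qed
  obtain k :: nat where k: "real m * real d / e \<le> real k" using real_arch_simple by blast
  define D where "D = max d k"
  have "real m * real d / real (D + 1) \<le> e"
  proof -
    have "real m * real d \<le> e * real k" using k e by (simp add: field_simps)
    also have "\<dots> \<le> e * real (D + 1)" using e by (intro mult_left_mono) (auto simp: D_def)
    finally show ?thesis by (simp add: divide_le_eq)
  qed
  then have "1 - e \<le> fejer_weight m D a" if "a \<in> S" for a
    using fejer_weight_ge[of a m d D] that S(2) d[OF that] by (force simp: D_def)
  moreover have "\<bar>a j\<bar> \<le> int D" if "a \<in> S" for a j using d[OF that, of j] by (simp add: D_def)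
  ultimately show ?thesis using that by blast
qed


section \<open>Approximation of Hardy martingales by polynomials\<close>

lemma card_fejer_weight_support:
  assumes "finite S" shows "card {a\<in>S. fejer_weight m D a \<noteq> 0} \<le> card (cube m D) * card (cube m D)"
proof -
  have "{a\<in>S. fejer_weight m D a \<noteq> 0} \<subseteq> (\<lambda>(c, c'). (\<lambda>j. c j - c' j)) ` (cube m D \<times> cube m D)"
  proof
    fix a assume "a \<in> {a\<in>S. fejer_weight m D a \<noteq> 0}"
    then have "{c \<in> cube m D. (\<lambda>j. c j - a j) \<in> cube m D} \<noteq> {}" unfolding fejer_weight_def by force
    then obtain c where "c \<in> cube m D" "(\<lambda>j. c j - a j) \<in> cube m D" by blast
    then show "a \<in> (\<lambda>(c, c'). (\<lambda>j. c j - c' j)) ` (cube m D \<times> cube m D)"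
      by (intro image_eqI[of _ _ "(c, \<lambda>j. c j - a j)"]) auto
  qed
  then have "card {a\<in>S. fejer_weight m D a \<noteq> 0} \<le> card ((\<lambda>(c, c'). (\<lambda>j. c j - c' j)) ` (cube m D \<times> cube m D))"
    by (intro card_mono) auto
  also have "\<dots> \<le> card (cube m D \<times> cube m D)" by (rule card_image_le) simp
  finally show ?thesis by (simp add: card_cartesian_product)
qed

lemma L1_norm_chi_sum_le: "L1_norm torus (\<lambda>\<omega>. \<Sum>a\<in>S. chi m a \<omega> *\<^sub>C x a) \<le> (\<Sum>a\<in>S. norm (x a))"
proof -
  have "L1_norm torus (\<lambda>\<omega>. \<Sum>a\<in>S. chi m a \<omega> *\<^sub>C x a) \<le> (\<Sum>a\<in>S. L1_norm torus (\<lambda>\<omega>. chi m a \<omega> *\<^sub>C x a))"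
    by (rule L1_norm_sum_le) (rule bochner_L1_scaleC_const[OF integrable_chi])
  also have "\<dots> = (\<Sum>a\<in>S. norm (x a))"
  proof (rule sum.cong[OF HOL.refl])
    fix a
    have "(LINT \<omega>|torus. norm (chi m a \<omega>)) = (LINT \<omega>|torus. 1)"
      by (rule Bochner_Integration.integral_cong) auto
    then show "L1_norm torus (\<lambda>\<omega>. chi m a \<omega> *\<^sub>C x a) = norm (x a)"
      unfolding L1_norm_scaleC_const by (simp add: L1_norm_def torus.prob_space)
  qed
  finally show ?thesis .
qed

lemma trig_approxE:
  assumes "trig_approx m f" "e > 0"
  obtains S x where "finite S" "S \<subseteq> freqs m" "L1_norm torus (\<lambda>\<omega>. f \<omega> - (\<Sum>a\<in>S. chi m a \<omega> *\<^sub>C x a)) < e"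
proof -
  obtain g where g: "trig m g" "L1_norm torus (\<lambda>\<omega>. f \<omega> - g \<omega>) < e"
    using assms unfolding trig_approx_def by blast
  obtain S x where S: "finite S" "S \<subseteq> freqs m" "\<forall>\<omega>\<in>space torus. g \<omega> = (\<Sum>a\<in>S. chi m a \<omega> *\<^sub>C x a)"
    using g(1) unfolding trig_def by blast
  have "L1_norm torus (\<lambda>\<omega>. f \<omega> - g \<omega>) = L1_norm torus (\<lambda>\<omega>. f \<omega> - (\<Sum>a\<in>S. chi m a \<omega> *\<^sub>C x a))"
    by (rule L1_norm_cong) (simp add: S(3))
  then show ?thesis using that[OF S(1,2)] g(2) by simp
qed

lemma chi_sum_extend:
  assumes "finite U" "S \<subseteq> U"
  shows "(\<Sum>a\<in>S. chi m a \<omega> *\<^sub>C x a) = (\<Sum>a\<in>U. chi m a \<omega> *\<^sub>C (if a \<in> S then x a else 0))"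
proof -
  have "(\<Sum>a\<in>S. chi m a \<omega> *\<^sub>C x a) = (\<Sum>a\<in>S. chi m a \<omega> *\<^sub>C (if a \<in> S then x a else 0))"
    by (rule sum.cong) auto
  also have "\<dots> = (\<Sum>a\<in>U. chi m a \<omega> *\<^sub>C (if a \<in> S then x a else 0))"
    by (rule sum.mono_neutral_left) (use assms in auto)
  finally show ?thesis .
qed

lemma L1_norm_fejer_mean_diff_le:
  fixes x y :: "(nat \<Rightarrow> int) \<Rightarrow> 'x::complex_banach"
  assumes S: "finite S" "S \<subseteq> freqs m" and T: "finite T" "T \<subseteq> freqs m"
  shows "L1_norm torus (\<lambda>\<omega>. (\<Sum>a\<in>S. chi m a \<omega> *\<^sub>C (fejer_weight m D a *\<^sub>R x a)) - (\<Sum>a\<in>T. chi m a \<omega> *\<^sub>C (fejer_weight m D a *\<^sub>R y a)))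
     \<le> L1_norm torus (\<lambda>\<omega>. (\<Sum>a\<in>S. chi m a \<omega> *\<^sub>C x a) - (\<Sum>a\<in>T. chi m a \<omega> *\<^sub>C y a))"
proof -
  define U where "U = S \<union> T"
  define z where "z a = (if a \<in> S then x a else 0) - (if a \<in> T then y a else 0)" for a
  have U: "finite U" "U \<subseteq> freqs m" "S \<subseteq> U" "T \<subseteq> U" using S T by (auto simp: U_def)
  have 1: "(\<Sum>a\<in>S. chi m a \<omega> *\<^sub>C x a) - (\<Sum>a\<in>T. chi m a \<omega> *\<^sub>C y a) = (\<Sum>a\<in>U. chi m a \<omega> *\<^sub>C z a)" for \<omega>
    unfolding chi_sum_extend[OF U(1,3)] chi_sum_extend[OF U(1,4)] z_def scaleC_diff_right sum_subtractf ..
  have 2: "(\<Sum>a\<in>S. chi m a \<omega> *\<^sub>C (fejer_weight m D a *\<^sub>R x a)) - (\<Sum>a\<in>T. chi m a \<omega> *\<^sub>C (fejer_weight m D a *\<^sub>R y a)) =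
      (\<Sum>a\<in>U. chi m a \<omega> *\<^sub>C (fejer_weight m D a *\<^sub>R z a))" for \<omega>
    unfolding chi_sum_extend[OF U(1,3)] chi_sum_extend[OF U(1,4)] sum_subtractf[symmetric] scaleC_diff_right[symmetric]
    by (rule sum.cong) (auto simp: z_def scaleR_diff_right)
  show ?thesis unfolding 1 2 by (rule L1_norm_fejer_mean_le[OF U(2)])
qed

text \<open>Let \<open>G0\<close> be a trigonometric polynomial close to \<open>M m\<close>, and let its Fejer mean of order \<open>D\<close> be close to
  \<open>G0\<close>. Take a second polynomial \<open>G1\<close>, so close to \<open>M m\<close> that the few coefficients of its Fejer mean
  outside \<open>hardy_freqs m\<close> are negligible in total: their number is bounded in terms of \<open>D\<close>, and
  each is at most the distance from \<open>G1\<close> to \<open>M m\<close>. Dropping them leaves the required polynomial.\<close>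

lemma hardy_martingale_approx:
  fixes M :: "nat \<Rightarrow> (nat \<Rightarrow> complex) \<Rightarrow> 'x::complex_banach"
  assumes M: "hardy_martingale M" and e: "e > 0"
  obtains S x where "finite S" "S \<subseteq> hardy_freqs m" "L1_norm torus (\<lambda>\<omega>. M m \<omega> - (\<Sum>a\<in>S. chi m a \<omega> *\<^sub>C x a)) < e"
proof -
  define d where "d = e / 6"
  have d: "d > 0" using e by (simp add: d_def)
  have MM: "M m \<in> bochner_L1 torus" "strongly_measurable (coord_algebra m) (M m)"
    using M by (auto simp: hardy_martingale_def torus_martingale_def)
  have ap: "trig_approx m (M m)" by (rule trig_approx_bochner_L1[OF MM])
  obtain S0 x0 where S0: "finite S0" "S0 \<subseteq> freqs m" and
      G0: "L1_norm torus (\<lambda>\<omega>. M m \<omega> - (\<Sum>a\<in>S0. chi m a \<omega> *\<^sub>C x0 a)) < d"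
    by (rule trig_approxE[OF ap d])
  define c where "c = (\<Sum>a\<in>S0. norm (x0 a)) + 1"
  have c: "c > 0" unfolding c_def by (intro add_nonneg_pos sum_nonneg) auto
  have dc: "d / c > 0" using c d by simp
  obtain D where D: "\<And>a. a \<in> S0 \<Longrightarrow> 1 - d / c \<le> fejer_weight m D a"
    using fejer_weight_near_1[OF S0 dc] by metis
  let ?w = "fejer_weight m D"
  define N where "N = card (cube m D) * card (cube m D)"
  have N: "1 \<le> N" by (simp add: N_def card_cube)
  have dN: "d / real N > 0" using d N by simp
  obtain S1 x1 where S1: "finite S1" "S1 \<subseteq> freqs m" and
      G1: "L1_norm torus (\<lambda>\<omega>. M m \<omega> - (\<Sum>a\<in>S1. chi m a \<omega> *\<^sub>C x1 a)) < d / real N"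
    by (rule trig_approxE[OF ap dN])
  have dN_le: "d / real N \<le> d" using N d by (simp add: divide_le_eq)
  define g0 where "g0 \<omega> = (\<Sum>a\<in>S0. chi m a \<omega> *\<^sub>C x0 a)" for \<omega>
  define g1 where "g1 \<omega> = (\<Sum>a\<in>S1. chi m a \<omega> *\<^sub>C x1 a)" for \<omega>
  define f0 where "f0 \<omega> = (\<Sum>a\<in>S0. chi m a \<omega> *\<^sub>C (?w a *\<^sub>R x0 a))" for \<omega>
  define f1 where "f1 \<omega> = (\<Sum>a\<in>S1. chi m a \<omega> *\<^sub>C (?w a *\<^sub>R x1 a))" for \<omega>
  define S where "S = S1 \<inter> hardy_freqs m"
  define p where "p \<omega> = (\<Sum>a\<in>S. chi m a \<omega> *\<^sub>C (?w a *\<^sub>R x1 a))" for \<omega>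
  have L: "g0 \<in> bochner_L1 torus" "g1 \<in> bochner_L1 torus" "f0 \<in> bochner_L1 torus" "f1 \<in> bochner_L1 torus" "p \<in> bochner_L1 torus"
    unfolding g0_def g1_def f0_def f1_def p_def by (rule bochner_L1_chi_sum)+
  have 1: "L1_norm torus (\<lambda>\<omega>. M m \<omega> - g0 \<omega>) < d" using G0 by (simp add: g0_def)
  have 2: "L1_norm torus (\<lambda>\<omega>. g0 \<omega> - f0 \<omega>) \<le> d"
  proof -
    have eq: "g0 \<omega> - f0 \<omega> = (\<Sum>a\<in>S0. chi m a \<omega> *\<^sub>C ((1 - ?w a) *\<^sub>R x0 a))" for \<omega>
      unfolding g0_def f0_def sum_subtractf[symmetric] scaleC_diff_right[symmetric] by (simp add: scaleR_diff_left)
    have "L1_norm torus (\<lambda>\<omega>. g0 \<omega> - f0 \<omega>) \<le> (\<Sum>a\<in>S0. norm ((1 - ?w a) *\<^sub>R x0 a))"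
      unfolding eq by (rule L1_norm_chi_sum_le)
    also have "\<dots> \<le> (\<Sum>a\<in>S0. (d / c) * norm (x0 a))"
    proof (rule sum_mono)
      fix a assume "a \<in> S0"
      then have "\<bar>1 - ?w a\<bar> \<le> d / c" using D[of a] fejer_weight_le_1[of m D a] by simp
      then show "norm ((1 - ?w a) *\<^sub>R x0 a) \<le> (d / c) * norm (x0 a)"
        unfolding norm_scaleR real_norm_def by (rule mult_right_mono) simp
    qed
    also have "\<dots> = (d / c) * (c - 1)" by (simp add: c_def sum_distrib_left)
    also have "\<dots> \<le> (d / c) * c" using dc by (intro mult_left_mono) auto
    also have "\<dots> = d" using c by simp
    finally show ?thesis .
  qed
  have 3: "L1_norm torus (\<lambda>\<omega>. f0 \<omega> - f1 \<omega>) \<le> 2 * d"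
  proof -
    have "L1_norm torus (\<lambda>\<omega>. f0 \<omega> - f1 \<omega>) \<le> L1_norm torus (\<lambda>\<omega>. g0 \<omega> - g1 \<omega>)"
      unfolding f0_def f1_def g0_def g1_def by (rule L1_norm_fejer_mean_diff_le[OF S0 S1])
    also have "\<dots> \<le> L1_norm torus (\<lambda>\<omega>. g0 \<omega> - M m \<omega>) + L1_norm torus (\<lambda>\<omega>. M m \<omega> - g1 \<omega>)"
      by (rule L1_norm_triangle[OF L(1) MM(1) L(2)])
    finally show ?thesis
      using 1 G1 dN_le unfolding L1_norm_minus_commute[of torus g0] g1_def by linarith
  qed
  have 4: "L1_norm torus (\<lambda>\<omega>. f1 \<omega> - p \<omega>) \<le> d"
  proof -
    define R where "R = {a \<in> S1 - hardy_freqs m. ?w a \<noteq> 0}"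
    have eq: "f1 \<omega> - p \<omega> = (\<Sum>a\<in>R. chi m a \<omega> *\<^sub>C (?w a *\<^sub>R x1 a))" for \<omega>
    proof -
      have "f1 \<omega> = p \<omega> + (\<Sum>a\<in>S1 - hardy_freqs m. chi m a \<omega> *\<^sub>C (?w a *\<^sub>R x1 a))"
        unfolding f1_def p_def S_def using S1(1) by (subst sum.Int_Diff[of _ _ "hardy_freqs m"]) auto
      also have "(\<Sum>a\<in>S1 - hardy_freqs m. chi m a \<omega> *\<^sub>C (?w a *\<^sub>R x1 a)) = (\<Sum>a\<in>R. chi m a \<omega> *\<^sub>C (?w a *\<^sub>R x1 a))"
        by (rule sum.mono_neutral_right) (use S1(1) in \<open>auto simp: R_def\<close>)
      finally show ?thesis by simp
    qed
    have "L1_norm torus (\<lambda>\<omega>. f1 \<omega> - p \<omega>) \<le> (\<Sum>a\<in>R. norm (?w a *\<^sub>R x1 a))"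
      unfolding eq by (rule L1_norm_chi_sum_le)
    also have "\<dots> \<le> (\<Sum>a\<in>R. d / real N)"
    proof (rule sum_mono)
      fix a assume a: "a \<in> R"
      have "norm (?w a *\<^sub>R x1 a) \<le> 1 * norm (x1 a)"
        unfolding norm_scaleR real_norm_def using fejer_weight_le_1[of m D a] by (intro mult_right_mono) auto
      also have "norm (x1 a) \<le> L1_norm torus (\<lambda>\<omega>. M m \<omega> - (\<Sum>a\<in>S1. chi m a \<omega> *\<^sub>C x1 a))"
        by (rule hardy_martingale_coefficient_le[OF M S1]) (use a in \<open>auto simp: R_def\<close>)
      finally show "norm (?w a *\<^sub>R x1 a) \<le> d / real N" using G1 by simp
    qed
    also have "\<dots> = real (card R) * (d / real N)" by simp
    also have "\<dots> \<le> real N * (d / real N)"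
    proof (rule mult_right_mono)
      have "card R \<le> N" unfolding R_def N_def by (rule card_fejer_weight_support) (use S1 in auto)
      then show "real (card R) \<le> real N" by simp
    qed (use d in simp)
    also have "\<dots> = d" using N by simp
    finally show ?thesis .
  qed
  have "L1_norm torus (\<lambda>\<omega>. M m \<omega> - p \<omega>) < 6 * d"
    using 1 2 3 4 L1_norm_triangle[OF MM(1) L(1) L(5)] L1_norm_triangle[OF L(1) L(3) L(5)] L1_norm_triangle[OF L(3) L(4) L(5)] d
    by linarith
  then show ?thesis
    using that[of S "\<lambda>a. ?w a *\<^sub>R x1 a"] S1 unfolding p_def by (simp add: S_def d_def)
qed

section \<open>A bound from projectivity\<close>

lemma analytic_polynomialsI: "p = (\<lambda>z. \<Sum>k\<le>n. z ^ k *\<^sub>C x k) \<Longrightarrow> p \<in> analytic_polynomials"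
  unfolding analytic_polynomials_def by auto

lemma analytic_polynomials_extend:
  assumes "n \<le> N"
  shows "(\<Sum>k\<le>n. z ^ k *\<^sub>C x k) = (\<Sum>k\<le>N. z ^ k *\<^sub>C (if k \<le> n then x k else 0 :: 'x::complex_banach))"
proof -
  have "(\<Sum>k\<le>n. z ^ k *\<^sub>C x k) = (\<Sum>k\<le>n. z ^ k *\<^sub>C (if k \<le> n then x k else 0))"
    by (rule sum.cong) auto
  also have "\<dots> = (\<Sum>k\<le>N. z ^ k *\<^sub>C (if k \<le> n then x k else 0))"
    by (rule sum.mono_neutral_left) (use assms in auto)
  finally show ?thesis .
qed

lemma analytic_polynomials_add:
  assumes "p \<in> analytic_polynomials" "q \<in> analytic_polynomials"
  shows "(\<lambda>z. p z + q z) \<in> analytic_polynomials"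
proof -
  obtain n x where p: "p = (\<lambda>z. \<Sum>k\<le>n. z ^ k *\<^sub>C x k)" using assms unfolding analytic_polynomials_def by blast
  obtain l y where q: "q = (\<lambda>z. \<Sum>k\<le>l. z ^ k *\<^sub>C y k)" using assms unfolding analytic_polynomials_def by blast
  have "(\<lambda>z. p z + q z) = (\<lambda>z. \<Sum>k\<le>max n l. z ^ k *\<^sub>C ((if k \<le> n then x k else 0) + (if k \<le> l then y k else 0)))"
    unfolding p q analytic_polynomials_extend[of n "max n l", OF max.cobounded1]
      analytic_polynomials_extend[of l "max n l", OF max.cobounded2] scaleC_add_right sum.distrib ..
  then show ?thesis by (rule analytic_polynomialsI)
qed

lemma analytic_polynomials_scaleC:
  assumes "p \<in> analytic_polynomials" shows "(\<lambda>z. c *\<^sub>C p z) \<in> analytic_polynomials"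
proof -
  obtain n x where p: "p = (\<lambda>z. \<Sum>k\<le>n. z ^ k *\<^sub>C x k)" using assms unfolding analytic_polynomials_def by blast
  have "(\<lambda>z. c *\<^sub>C p z) = (\<lambda>z. \<Sum>k\<le>n. z ^ k *\<^sub>C (c *\<^sub>C x k))"
    unfolding p by (simp add: scaleC_sum_right scaleC_scaleC mult.commute)
  then show ?thesis by (rule analytic_polynomialsI)
qed

lemma analytic_polynomials_diff:
  assumes "p \<in> analytic_polynomials" "q \<in> analytic_polynomials"
  shows "(\<lambda>z. p z - q z) \<in> analytic_polynomials"
  using analytic_polynomials_add[OF assms(1) analytic_polynomials_scaleC[OF assms(2), of "-1"]]
  by (simp add: scaleC_minus_left)

lemma analytic_polynomial_monom: "(\<lambda>z. z ^ k *\<^sub>C x) \<in> analytic_polynomials"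
proof -
  have "(\<Sum>j\<le>k. z ^ j *\<^sub>C (if j = k then x else 0)) = z ^ k *\<^sub>C x" for z
  proof -
    have "(\<Sum>j\<le>k. z ^ j *\<^sub>C (if j = k then x else 0)) = (\<Sum>j\<le>k. if j = k then z ^ k *\<^sub>C x else 0)"
      by (rule sum.cong) auto
    then show ?thesis by simp
  qed
  then have "(\<lambda>z. z ^ k *\<^sub>C x) = (\<lambda>z. \<Sum>j\<le>k. z ^ j *\<^sub>C (if j = k then x else 0))" by simp
  then show ?thesis by (rule analytic_polynomialsI)
qed

lemma analytic_polynomial_zero: "(\<lambda>z. 0) \<in> analytic_polynomials"
  using analytic_polynomial_monom[of 0 0] by simp

lemma analytic_polynomials_sum:
  "(\<And>i. i \<in> I \<Longrightarrow> p i \<in> analytic_polynomials) \<Longrightarrow> (\<lambda>z. \<Sum>i\<in>I. p i z) \<in> analytic_polynomials"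
  by (induction I rule: infinite_finite_induct) (auto intro: analytic_polynomial_zero analytic_polynomials_add)

lemma analytic_polynomial_bochner_L1:
  assumes "p \<in> analytic_polynomials" shows "p \<in> bochner_L1 circle"
proof -
  obtain n x where p: "p = (\<lambda>z. \<Sum>k\<le>n. z ^ k *\<^sub>C x k)" using assms unfolding analytic_polynomials_def by blast
  show ?thesis using bochner_L1_powers[of int x "{..n}"] unfolding p by simp
qed

lemma H1_tilde_scaleC:
  assumes "F \<in> H1_tilde" shows "(\<lambda>z. c *\<^sub>C F z) \<in> H1_tilde"
  unfolding H1_tilde_def
proof (intro CollectI conjI allI impI)
  have F: "F \<in> bochner_L1 circle" by (rule H1_tilde_bochner_L1[OF assms])
  show "(\<lambda>z. c *\<^sub>C F z) \<in> bochner_L1 circle" by (rule bochner_L1_scaleC[OF F])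
  fix e :: real assume e: "e > 0"
  define d where "d = e / (norm c + 1)"
  have c1: "norm c + 1 > 0" by (simp add: add_nonneg_pos)
  have d: "d > 0" using e c1 by (simp add: d_def)
  then obtain p where p: "p \<in> analytic_polynomials" "L1_norm circle (\<lambda>z. F z - p z) < d"
    using assms unfolding H1_tilde_def by blast
  have "L1_norm circle (\<lambda>z. c *\<^sub>C F z - c *\<^sub>C p z) = norm c * L1_norm circle (\<lambda>z. F z - p z)"
    by (simp add: L1_norm_scaleC flip: scaleC_diff_right)
  also have "\<dots> \<le> norm c * d" using p(2) by (intro mult_left_mono) auto
  also have "\<dots> < (norm c + 1) * d" using d by simp
  also have "\<dots> = e" using c1 by (simp add: d_def)
  finally show "\<exists>q\<in>analytic_polynomials. L1_norm circle (\<lambda>z. c *\<^sub>C F z - q z) < e"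
    by (rule bexI[OF _ analytic_polynomials_scaleC[OF p(1)]])
qed

lemma H1_tilde_add:
  assumes "F \<in> H1_tilde" "G \<in> H1_tilde" shows "(\<lambda>z. F z + G z) \<in> H1_tilde"
  unfolding H1_tilde_def
proof (intro CollectI conjI allI impI)
  have FG: "F \<in> bochner_L1 circle" "G \<in> bochner_L1 circle" by (intro H1_tilde_bochner_L1 assms)+
  show "(\<lambda>z. F z + G z) \<in> bochner_L1 circle" by (rule bochner_L1_add[OF FG])
  fix e :: real assume "e > 0"
  then have e2: "e / 2 > 0" by simp
  obtain p where p: "p \<in> analytic_polynomials" "L1_norm circle (\<lambda>z. F z - p z) < e / 2"
    using assms(1) e2 unfolding H1_tilde_def by blast
  obtain q where q: "q \<in> analytic_polynomials" "L1_norm circle (\<lambda>z. G z - q z) < e / 2"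
    using assms(2) e2 unfolding H1_tilde_def by blast
  have "L1_norm circle (\<lambda>z. (F z - p z) + (G z - q z)) < e"
    using L1_norm_add_le[OF bochner_L1_diff[OF FG(1) analytic_polynomial_bochner_L1[OF p(1)]]
       bochner_L1_diff[OF FG(2) analytic_polynomial_bochner_L1[OF q(1)]]] p(2) q(2) by simp
  then show "\<exists>r\<in>analytic_polynomials. L1_norm circle (\<lambda>z. F z + G z - r z) < e"
    using analytic_polynomials_add[OF p(1) q(1)] by (intro bexI[of _ "\<lambda>z. p z + q z"]) (simp_all add: algebra_simps)
qed

text \<open>The quantity whose infimum over all representations is the projective norm.\<close>

definition formal_cost :: "'x::complex_banach formal_sum \<Rightarrow> real" where
  "formal_cost s = (\<Sum>(h, x)\<leftarrow>s. L1_norm circle h * norm x)"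

lemma tensor_fun_append: "tensor_fun (s @ t) z = tensor_fun s z + tensor_fun t z"
  by (simp add: tensor_fun_def)

lemma formal_cost_append: "formal_cost (s @ t) = formal_cost s + formal_cost t"
  by (simp add: formal_cost_def)

lemma tensor_fun_scale: "tensor_fun (map (\<lambda>(h, x). (h, c *\<^sub>C x)) s) z = c *\<^sub>C tensor_fun s z"
  by (induction s) (auto simp: tensor_fun_def scaleC_add_right scaleC_scaleC mult.commute)

lemma formal_cost_scale: "formal_cost (map (\<lambda>(h, x). (h, c *\<^sub>C x)) s) = norm c * formal_cost s"
  by (induction s) (auto simp: formal_cost_def norm_scaleC algebra_simps)

lemma formal_sums_scale: "s \<in> formal_sums \<Longrightarrow> map (\<lambda>(h, x). (h, c *\<^sub>C x)) s \<in> formal_sums"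
  by (auto simp: formal_sums_def)

lemma formal_sums_append [simp]: "s @ t \<in> formal_sums \<longleftrightarrow> s \<in> formal_sums \<and> t \<in> formal_sums"
  by (auto simp: formal_sums_def)

lemma tensor_fun_bochner_L1: "s \<in> formal_sums \<Longrightarrow> tensor_fun s \<in> bochner_L1 circle"
proof (induction s)
  case Nil
  then show ?case by (simp add: tensor_fun_def bochner_L1_zero)
next
  case (Cons hx s)
  obtain h x where hx: "hx = (h, x)" by (cases hx)
  have "h \<in> H1" "s \<in> formal_sums" using Cons.prems by (auto simp: formal_sums_def hx)
  then have "(\<lambda>z. h z *\<^sub>C x) \<in> bochner_L1 circle" 
    using H1_tilde_bochner_L1[of h] by (intro bochner_L1_scaleC_const) (simp add: bochner_L1_complex_iff)
  from bochner_L1_add[OF this Cons.IH[OF \<open>s \<in> formal_sums\<close>]] 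
  show ?case by (simp add: tensor_fun_def hx cong: bochner_L1_cong)
qed

lemma tensor_eq_imp_AE_eq:
  assumes "tensor_eq s t"
  shows "s \<in> formal_sums \<and> t \<in> formal_sums \<and> (AE z in circle. tensor_fun s z = tensor_fun t z)"
  using assms
proof (induction rule: tensor_eq.induct)
  case (sym s t)
  then show ?case by (auto elim: eventually_mono)
next
  case (trans s t u)
  have "AE z in circle. tensor_fun s z = tensor_fun u z"
    using trans.IH(1)[THEN conjunct2, THEN conjunct2] trans.IH(2)[THEN conjunct2, THEN conjunct2]
    by eventually_elim simp
  then show ?case using trans by simp
next
  case (append s s' t t')
  have "AE z in circle. tensor_fun (s @ t) z = tensor_fun (s' @ t') z"
    using append.IH(1)[THEN conjunct2, THEN conjunct2] append.IH(2)[THEN conjunct2, THEN conjunct2]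
    by eventually_elim (simp add: tensor_fun_append)
  then show ?case using append by simp
next
  case (add_left h k x)
  then show ?case by (auto simp: formal_sums_def tensor_fun_def scaleC_add_left intro: H1_tilde_add)
next
  case (scale h c x)
  have "(\<lambda>z. c * h z) \<in> H1" using H1_tilde_scaleC[OF scale, of c] by (simp add: scaleC_complex_def)
  then show ?case using scale by (auto simp: formal_sums_def tensor_fun_def scaleC_scaleC mult.commute)
next
  case (ae h k x)
  have "AE z in circle. tensor_fun [(h, x)] z = tensor_fun [(k, x)] z"
    using ae(3) by eventually_elim (simp add: tensor_fun_def)
  then show ?case using ae by (auto simp: formal_sums_def)
qed (auto simp: formal_sums_def tensor_fun_def scaleC_add_right add.commute)

text \<open>\<open>proj_approx K\<close> is the closure in the Bochner space of the image of the ball of radius \<open>K\<close>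
  for the projective norm.\<close>

definition proj_approx :: "real \<Rightarrow> (complex \<Rightarrow> 'x::complex_banach) \<Rightarrow> bool" where
  "proj_approx K F \<longleftrightarrow> (\<forall>e>0. \<exists>s\<in>formal_sums. formal_cost s \<le> K \<and> L1_norm circle (\<lambda>z. tensor_fun s z - F z) < e)"

lemma proj_approx_mono: "proj_approx K F \<Longrightarrow> K \<le> L \<Longrightarrow> proj_approx L F"
  unfolding proj_approx_def by (meson order_trans)

lemma canonical_image_imp_proj_approx:
  assumes F: "F \<in> bochner_L1 circle" and u: "u \<in> proj_tensor" "canonical_image u F"
  shows "\<exists>K. proj_approx K F"
proof -
  have uf: "u n \<in> formal_sums" for n using u(1) by (simp add: proj_tensor_def)
  obtain N where N: "\<And>m n. m \<ge> N \<Longrightarrow> n \<ge> N \<Longrightarrow> proj_norm (tensor_diff (u m) (u n)) < 1"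
    using u(1) unfolding proj_tensor_def by (auto dest!: spec[of _ "1::real"])
  have "proj_approx (1 + formal_cost (u N)) F"
    unfolding proj_approx_def
  proof (intro allI impI)
    fix e :: real assume "e > 0"
    then have "\<forall>\<^sub>F n in sequentially. L1_norm circle (\<lambda>z. tensor_fun (u n) z - F z) < e"
      using u(2) unfolding canonical_image_def by (rule order_tendstoD(2)[rotated])
    then obtain n where n: "n \<ge> N" "L1_norm circle (\<lambda>z. tensor_fun (u n) z - F z) < e"
      unfolding eventually_sequentially by (meson nle_le)
    have d: "tensor_diff (u n) (u N) \<in> formal_sums"
      using uf[of n] uf[of N] by (auto simp: tensor_diff_def formal_sums_def)
    have "proj_norm (tensor_diff (u n) (u N)) < 1" using N n(1) by simp
    then obtain t where t: "tensor_eq (tensor_diff (u n) (u N)) t" "formal_cost t < 1"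
      unfolding proj_norm_def formal_cost_def
      by (subst (asm) cInf_less_iff) (use tensor_eq.refl[OF d] in \<open>auto intro!: bdd_belowI[of _ 0] sum_list_nonneg\<close>)
    have tf: "t \<in> formal_sums" using tensor_eq_imp_AE_eq[OF t(1)] by simp
    have neg: "tensor_fun (map (\<lambda>(h, x). (h, - x)) (u N)) z = - tensor_fun (u N) z" for z
      using tensor_fun_scale[of "-1" "u N" z] by (simp add: scaleC_minus_left)
    have "AE z in circle. tensor_fun (t @ u N) z - F z = tensor_fun (u n) z - F z"
      using tensor_eq_imp_AE_eq[OF t(1), THEN conjunct2, THEN conjunct2]
      by eventually_elim (simp add: tensor_fun_append tensor_diff_def neg diff_eq_eq)
    then have "L1_norm circle (\<lambda>z. tensor_fun (t @ u N) z - F z) = L1_norm circle (\<lambda>z. tensor_fun (u n) z - F z)"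
      by (intro L1_norm_cong_AE strongly_measurable_diff)
         (use F tensor_fun_bochner_L1[of "t @ u N"] tensor_fun_bochner_L1[OF uf] tf uf in \<open>auto simp: bochner_L1_def\<close>)
    then show "\<exists>s\<in>formal_sums. formal_cost s \<le> 1 + formal_cost (u N) \<and> L1_norm circle (\<lambda>z. tensor_fun s z - F z) < e"
      using n(2) t(2) tf uf[of N] by (intro bexI[of _ "t @ u N"]) (auto simp: formal_cost_append)
  qed
  then show ?thesis by blast
qed

text \<open>By convexity and symmetry of \<open>proj_approx K\<close>: \<open>F\<close> is half the sum of \<open>G + F\<close> and \<open>- (G - F)\<close>.\<close>

lemma proj_approx_midpoint:
  assumes F: "F \<in> bochner_L1 circle" "G \<in> bochner_L1 circle"
    and "proj_approx K (\<lambda>z. G z + F z)" "proj_approx K (\<lambda>z. G z - F z)"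
  shows "proj_approx K F"
  unfolding proj_approx_def
proof (intro allI impI)
  fix e :: real assume e: "e > 0"
  obtain s where s: "s \<in> formal_sums" "formal_cost s \<le> K" "L1_norm circle (\<lambda>z. tensor_fun s z - (G z + F z)) < e"
    using assms(3) e unfolding proj_approx_def by blast
  obtain t where t: "t \<in> formal_sums" "formal_cost t \<le> K" "L1_norm circle (\<lambda>z. tensor_fun t z - (G z - F z)) < e"
    using assms(4) e unfolding proj_approx_def by blast
  define r where "r = map (\<lambda>(h, x). (h, (1/2) *\<^sub>C x)) s @ map (\<lambda>(h, x). (h, (-1/2) *\<^sub>C x)) t"
  have L: "(\<lambda>z. tensor_fun s z - (G z + F z)) \<in> bochner_L1 circle" "(\<lambda>z. tensor_fun t z - (G z - F z)) \<in> bochner_L1 circle"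
    using F s t by (auto intro!: bochner_L1_diff bochner_L1_add tensor_fun_bochner_L1)
  have "formal_cost r = (formal_cost s + formal_cost t) / 2"
    unfolding r_def formal_cost_append formal_cost_scale by (simp add: field_simps)
  then have "formal_cost r \<le> K" using s t by simp
  moreover have "r \<in> formal_sums" unfolding r_def using s(1) t(1) by (simp add: formal_sums_scale)
  moreover have "L1_norm circle (\<lambda>z. tensor_fun r z - F z) < e"
  proof -
    have eq: "tensor_fun r z - F z = (1/2) *\<^sub>C (tensor_fun s z - (G z + F z)) - (1/2) *\<^sub>C (tensor_fun t z - (G z - F z))" for z
    proof -
      have "F z = (1/2) *\<^sub>C (F z + F z)" by (simp add: scaleC_add_right flip: scaleC_add_left)
      then show ?thesis
        unfolding r_def tensor_fun_append tensor_fun_scale by (simp add: scaleC_minus_left scaleC_diff_right scaleC_add_right algebra_simps)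
    qed
    have "L1_norm circle (\<lambda>z. tensor_fun r z - F z) \<le> 
       L1_norm circle (\<lambda>z. (1/2) *\<^sub>C (tensor_fun s z - (G z + F z))) + L1_norm circle (\<lambda>z. (1/2) *\<^sub>C (tensor_fun t z - (G z - F z)))"
      unfolding eq by (rule L1_norm_diff_le) (intro bochner_L1_scaleC L)+
    also have "\<dots> < e" unfolding L1_norm_scaleC using s(3) t(3) by simp
    finally show ?thesis .
  qed
  ultimately show "\<exists>s\<in>formal_sums. formal_cost s \<le> K \<and> L1_norm circle (\<lambda>z. tensor_fun s z - F z) < e" by blast
qed


text \<open>The completeness of \<open>H1_tilde\<close>, for rapidly convergent sequences of polynomials. The limit exists
  pointwise outside a null set; approximating each \<open>P n\<close> by a simple function \<open>s n\<close>
  at the same rate makes the limit strongly measurable.\<close>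

lemma analytic_polynomials_limit:
  fixes P :: "nat \<Rightarrow> complex \<Rightarrow> 'x::complex_banach"
  assumes P: "\<And>n. P n \<in> analytic_polynomials"
    and r: "\<And>n. 0 < r n" "\<And>n. r (Suc n) \<le> r n / 2"
    and Pr: "\<And>n. L1_norm circle (\<lambda>z. P (Suc n) z - P n z) \<le> r n"
  obtains F where "F \<in> H1_tilde" "\<And>n. L1_norm circle (\<lambda>z. F z - P n z) \<le> 2 * r n"
proof -
  have PL: "P n \<in> bochner_L1 circle" for n by (rule analytic_polynomial_bochner_L1[OF P])
  have "\<exists>s. \<forall>n. simple_function circle (s n) \<and> s n \<in> bochner_L1 circle \<and> L1_norm circle (\<lambda>z. P n z - s n z) < r n"
  proof (rule choice, rule allI)
    fix n
    have Pm: "strongly_measurable circle (P n)" using PL[of n] by (simp add: bochner_L1_def)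
    show "\<exists>s. simple_function circle s \<and> s \<in> bochner_L1 circle \<and> L1_norm circle (\<lambda>z. P n z - s z) < r n"
      by (rule bochner_L1_simple_approx[OF PL[of n] Pm HOL.refl subset_refl r(1)[of n]]) blast
  qed
  then obtain s where s: "simple_function circle (s n)" "s n \<in> bochner_L1 circle" "L1_norm circle (\<lambda>z. P n z - s n z) < r n" for n
    by blast
  define d where "d n z = norm (P (Suc n) z - P n z)" for n z
  define e where "e n z = norm (P n z - s n z)" for n z
  have dm: "(\<lambda>z. ennreal (d n z)) \<in> borel_measurable circle" for n
    using bochner_L1_diff[OF PL[of "Suc n"] PL[of n]] unfolding d_def bochner_L1_def
    by (intro measurable_compose[OF _ measurable_ennreal] strongly_measurable_norm) simp
  have em: "(\<lambda>z. ennreal (e n z)) \<in> borel_measurable circle" for n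
    using bochner_L1_diff[OF PL[of n] s(2)[of n]] unfolding e_def bochner_L1_def
    by (intro measurable_compose[OF _ measurable_ennreal] strongly_measurable_norm) simp
  have dn: "(\<integral>\<^sup>+z. ennreal (d n z) \<partial>circle) \<le> ennreal (r n)" for n
    using L1_norm_eq_nn_integral[OF bochner_L1_diff[OF PL[of "Suc n"] PL[of n]]] Pr[of n]
    unfolding d_def by (metis ennreal_leI)
  have en: "(\<integral>\<^sup>+z. ennreal (e n z) \<partial>circle) \<le> ennreal (r n)" for n
    using L1_norm_eq_nn_integral[OF bochner_L1_diff[OF PL[of n] s(2)[of n]]] s(3)[of n]
    unfolding e_def by (metis ennreal_leI less_imp_le)
  \<comment> \<open>The radii decrease at least geometrically.\<close>
  have rk: "r (n + k) \<le> r n * (1/2) ^ k" for n k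
  proof (induction k)
    case (Suc k)
    then show ?case using r(2)[of "n + k"] by simp
  qed simp
  have rsum: "(\<Sum>k. ennreal (r (n + k))) \<le> ennreal (2 * r n)" for n
  proof -
    have "(\<Sum>k. ennreal (r (n + k))) \<le> (\<Sum>k. ennreal (r n * (1/2) ^ k))"
      by (intro suminf_le ennreal_leI rk) auto
    also have "\<dots> = ennreal (\<Sum>k. r n * (1/2) ^ k)"
      using r(1)[of n] by (intro suminf_ennreal2 summable_mult summable_geometric) auto
    also have "(\<Sum>k. r n * (1/2) ^ k) = 2 * r n"
      by (subst suminf_mult) (auto simp: suminf_geometric summable_geometric)
    finally show ?thesis .
  qed
  have sumint: "(\<integral>\<^sup>+z. (\<Sum>k. ennreal (f (n + k) z)) \<partial>circle) \<le> ennreal (2 * r n)"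
    if "\<And>n. (\<lambda>z. ennreal (f n z)) \<in> borel_measurable circle" "\<And>n. (\<integral>\<^sup>+z. ennreal (f n z) \<partial>circle) \<le> ennreal (r n)"
    for f n
  proof -
    have "(\<integral>\<^sup>+z. (\<Sum>k. ennreal (f (n + k) z)) \<partial>circle) = (\<Sum>k. \<integral>\<^sup>+z. ennreal (f (n + k) z) \<partial>circle)"
      by (rule nn_integral_suminf) (rule that(1))
    also have "\<dots> \<le> (\<Sum>k. ennreal (r (n + k)))"
      by (rule suminf_le) (simp_all add: that(2))
    also note rsum[of n]
    finally show ?thesis .
  qed
  define A where "A = {z \<in> space circle. (\<Sum>k. ennreal (d k z)) \<noteq> \<infinity> \<and> (\<Sum>k. ennreal (e k z)) \<noteq> \<infinity>}"
  have [measurable]: "(\<lambda>z. \<Sum>k. ennreal (d k z)) \<in> borel_measurable circle" "(\<lambda>z. \<Sum>k. ennreal (e k z)) \<in> borel_measurable circle"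
    using dm em by measurable
  have A: "A \<in> sets circle" unfolding A_def by measurable
  have fin: "AE z in circle. (\<Sum>k. ennreal (f k z)) \<noteq> \<infinity>"
    if "\<And>n. (\<lambda>z. ennreal (f n z)) \<in> borel_measurable circle" "\<And>n. (\<integral>\<^sup>+z. ennreal (f n z) \<partial>circle) \<le> ennreal (r n)" for f
  proof (rule nn_integral_noteq_infinite)
    show "(\<lambda>z. \<Sum>k. ennreal (f k z)) \<in> borel_measurable circle" using that(1) by measurable
    have "(\<integral>\<^sup>+z. (\<Sum>k. ennreal (f k z)) \<partial>circle) \<le> ennreal (2 * r 0)" using sumint[OF that, of 0] by simp
    then show "(\<integral>\<^sup>+z. (\<Sum>k. ennreal (f k z)) \<partial>circle) \<noteq> \<infinity>" using neq_top_trans[OF ennreal_neq_top] by auto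
  qed
  have AEA: "AE z in circle. z \<in> A"
    using fin[OF dm dn] fin[OF em en] AE_space by eventually_elim (simp add: A_def)
  have summ: "summable f" if "(\<Sum>k. ennreal (f k)) \<noteq> \<infinity>" "\<And>k. 0 \<le> f k" for f :: "nat \<Rightarrow> real"
    by (rule summable_suminf_not_top) (use that in auto)
  define F where "F z = (if z \<in> A then lim (\<lambda>n. P n z) else 0)" for z
  have lim: "(\<lambda>n. P n z) \<longlonglongrightarrow> F z" if z: "z \<in> A" for z
  proof -
    have "(\<Sum>k. ennreal (d k z)) \<noteq> \<infinity>" using z by (simp add: A_def)
    then have "summable (\<lambda>k. d k z)" by (rule summ) (simp add: d_def)
    then have "summable (\<lambda>k. P (Suc k) z - P k z)" unfolding d_def by (rule summable_norm_cancel)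
    then have "convergent (\<lambda>n. \<Sum>k<n. P (Suc k) z - P k z)" by (rule summable_iff_convergent[THEN iffD1])
    moreover have "(\<Sum>k<n. P (Suc k) z - P k z) = P n z - P 0 z" for n
      using sum_lessThan_telescope[of "\<lambda>k. P k z" n] by simp
    ultimately have "convergent (\<lambda>n. P n z - P 0 z)" by simp
    from convergent_add[OF this convergent_const[of "P 0 z"]] have "convergent (\<lambda>n. P n z)" by simp
    then have "(\<lambda>n. P n z) \<longlonglongrightarrow> lim (\<lambda>n. P n z)" by (rule convergent_LIMSEQ_iff[THEN iffD1])
    then show ?thesis using z by (simp only: F_def if_True)
  qed
  have lims: "(\<lambda>n. s n z) \<longlonglongrightarrow> F z" if z: "z \<in> A" for z
  proof -
    have "(\<Sum>k. ennreal (e k z)) \<noteq> \<infinity>" using z by (simp add: A_def)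
    then have "summable (\<lambda>k. e k z)" by (rule summ) (simp add: e_def)
    then have "(\<lambda>n. norm (P n z - s n z)) \<longlonglongrightarrow> 0" unfolding e_def by (rule summable_LIMSEQ_zero)
    then have "(\<lambda>n. P n z - s n z) \<longlonglongrightarrow> 0" by (rule tendsto_norm_zero_cancel)
    from tendsto_diff[OF lim[OF z] this] show ?thesis by simp
  qed
  have Fm: "strongly_measurable circle F"
    unfolding strongly_measurable_def
  proof (intro exI[of _ "\<lambda>n z. if z \<in> A then s n z else 0"] conjI allI ballI)
    show "simple_function circle (\<lambda>z. if z \<in> A then s n z else 0)" for n
    proof (rule simple_function_If[OF s(1) simple_function_const])
      have "{z \<in> space circle. z \<in> A} = A" using sets.sets_into_space[OF A] by auto
      then show "{z \<in> space circle. z \<in> A} \<in> sets circle" using A by simp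
    qed
    show "(\<lambda>n. if z \<in> A then s n z else 0) \<longlonglongrightarrow> F z" for z
      using lims[of z] by (cases "z \<in> A") (auto simp: F_def)
  qed
  have ptw: "ennreal (norm (F z - P n z)) \<le> (\<Sum>k. ennreal (d (n + k) z))" if z: "z \<in> A" for z n
  proof (rule LIMSEQ_le_const2)
    have "(\<lambda>k. P (n + k) z) \<longlonglongrightarrow> F z" using LIMSEQ_ignore_initial_segment[OF lim[OF z], of n] by (simp add: add.commute)
    then show "(\<lambda>k. ennreal (norm (P (n + k) z - P n z))) \<longlonglongrightarrow> ennreal (norm (F z - P n z))"
      by (intro tendsto_ennrealI tendsto_norm tendsto_diff tendsto_const)
    have "ennreal (norm (P (n + k) z - P n z)) \<le> (\<Sum>k. ennreal (d (n + k) z))" for k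
    proof -
      have "norm (P (n + k) z - P n z) \<le> (\<Sum>i<k. d (n + i) z)"
      proof (induction k)
        case (Suc k)
        have "norm (P (n + Suc k) z - P n z) \<le> norm (P (n + k) z - P n z) + d (n + k) z"
          using norm_triangle_ineq[of "P (n + k) z - P n z" "P (Suc (n + k)) z - P (n + k) z"] by (simp add: d_def)
        then show ?case using Suc by simp
      qed simp
      then have "ennreal (norm (P (n + k) z - P n z)) \<le> ennreal (\<Sum>i<k. d (n + i) z)" by (rule ennreal_leI)
      also have "\<dots> = (\<Sum>i<k. ennreal (d (n + i) z))" by (rule sum_ennreal[symmetric]) (simp add: d_def)
      also have "\<dots> \<le> (\<Sum>k. ennreal (d (n + k) z))" by (rule sum_le_suminf) auto
      finally show ?thesis .
    qed
    then show "\<exists>N. \<forall>k\<ge>N. ennreal (norm (P (n + k) z - P n z)) \<le> (\<Sum>k. ennreal (d (n + k) z))" by blast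
  qed
  have nnF: "(\<integral>\<^sup>+z. ennreal (norm (F z - P n z)) \<partial>circle) \<le> ennreal (2 * r n)" for n
  proof -
    have "AE z in circle. ennreal (norm (F z - P n z)) \<le> (\<Sum>k. ennreal (d (n + k) z))"
      using AEA by eventually_elim (rule ptw)
    then have "(\<integral>\<^sup>+z. ennreal (norm (F z - P n z)) \<partial>circle) \<le> (\<integral>\<^sup>+z. (\<Sum>k. ennreal (d (n + k) z)) \<partial>circle)"
      by (rule nn_integral_mono_AE)
    also have "\<dots> \<le> ennreal (2 * r n)" by (rule sumint[OF dm dn])
    finally show ?thesis .
  qed
  have FPm: "strongly_measurable circle (\<lambda>z. F z - P n z)" for n
    using PL[of n] by (intro strongly_measurable_diff Fm) (simp add: bochner_L1_def)
  have FP: "(\<lambda>z. F z - P n z) \<in> bochner_L1 circle" for n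
  proof (rule bochner_L1_I[OF FPm integrableI_bounded])
    show "(\<lambda>z. norm (F z - P n z)) \<in> borel_measurable circle" by (rule strongly_measurable_norm[OF FPm])
    show "(\<integral>\<^sup>+z. ennreal (norm (norm (F z - P n z))) \<partial>circle) < \<infinity>"
      using order_le_less_trans[OF nnF[of n] ennreal_less_top] by simp
  qed
  have FL: "F \<in> bochner_L1 circle" using bochner_L1_add[OF FP[of 0] PL[of 0]] by simp
  have Fr: "L1_norm circle (\<lambda>z. F z - P n z) \<le> 2 * r n" for n
  proof -
    have "ennreal (L1_norm circle (\<lambda>z. F z - P n z)) \<le> ennreal (2 * r n)"
      using L1_norm_eq_nn_integral[OF FP[of n]] nnF[of n] by simp
    moreover have "0 \<le> 2 * r n" using r(1)[of n] by simp
    ultimately show ?thesis by (simp only: ennreal_le_iff)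
  qed
  have "F \<in> H1_tilde"
    unfolding H1_tilde_def
  proof (intro CollectI conjI allI impI FL)
    fix \<epsilon> :: real assume "\<epsilon> > 0"
    have "(\<lambda>n. 2 * (r 0 * (1/2) ^ n)) \<longlonglongrightarrow> 2 * (r 0 * 0)"
      by (intro tendsto_mult tendsto_const LIMSEQ_realpow_zero) auto
    then have "\<forall>\<^sub>F n in sequentially. 2 * (r 0 * (1/2) ^ n) < \<epsilon>"
      using \<open>\<epsilon> > 0\<close> by (intro order_tendstoD(2)) auto
    then obtain n where "2 * (r 0 * (1/2) ^ n) < \<epsilon>" using eventually_happens'[OF sequentially_bot] by blast
    then have "L1_norm circle (\<lambda>z. F z - P n z) < \<epsilon>" using Fr[of n] rk[of 0 n] by simp
    then show "\<exists>p\<in>analytic_polynomials. L1_norm circle (\<lambda>z. F z - p z) < \<epsilon>" using P[of n] by (intro bexI[of _ "P n"])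
  qed
  then show ?thesis using that Fr by blast
qed

text \<open>Baire's argument: if no set \<open>proj_approx K\<close> contained a ball of polynomials around 0, each would be
  nowhere dense because it is convex and symmetric, and a Cauchy sequence of polynomials could be
  built whose limit is in none of them.\<close>

lemma H1_projective_imp_ball:
  assumes proj: "H1_projective TYPE('x::complex_banach)"
  shows "\<exists>K. \<exists>r>0. \<forall>F :: complex \<Rightarrow> 'x. F \<in> analytic_polynomials \<longrightarrow> L1_norm circle F < r \<longrightarrow> proj_approx K F"
proof (rule ccontr)
  assume contr: "\<not> ?thesis"
  have no: "\<exists>F :: complex \<Rightarrow> 'x. F \<in> analytic_polynomials \<and> L1_norm circle F < r \<and> \<not> proj_approx K F" 
    if "r > 0" for K r using contr that by blast
  have dense: "\<exists>Q \<in> analytic_polynomials. L1_norm circle (\<lambda>z. Q z - P z) \<le> r \<and> \<not> proj_approx K Q"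
    if r: "r > 0" and P: "P \<in> analytic_polynomials" for P :: "complex \<Rightarrow> 'x" and K r
  proof -
    obtain F :: "complex \<Rightarrow> 'x" where F: "F \<in> analytic_polynomials" "L1_norm circle F < r" "\<not> proj_approx K F" 
      using no[OF r] by blast
    have "\<not> proj_approx K (\<lambda>z. P z + F z) \<or> \<not> proj_approx K (\<lambda>z. P z - F z)"
      using proj_approx_midpoint[OF analytic_polynomial_bochner_L1[OF F(1)] analytic_polynomial_bochner_L1[OF P]] F(3) by blast
    then show ?thesis
    proof
      assume "\<not> proj_approx K (\<lambda>z. P z + F z)"
      then show ?thesis using F(2) analytic_polynomials_add[OF P F(1)] 
        by (intro bexI[of _ "\<lambda>z. P z + F z"]) auto
    next
      assume "\<not> proj_approx K (\<lambda>z. P z - F z)"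
      moreover have "L1_norm circle (\<lambda>z. (P z - F z) - P z) = L1_norm circle F" by (simp add: L1_norm_def)
      ultimately show ?thesis using F(2) analytic_polynomials_diff[OF P F(1)] 
        by (intro bexI[of _ "\<lambda>z. P z - F z"]) auto
    qed
  qed
  \<comment> \<open>A pair \<open>(P, r)\<close> is good if the closed ball of radius \<open>2 * r\<close> around \<open>P\<close> avoids \<open>proj_approx n\<close>.\<close>
  define good where "good n p \<longleftrightarrow> fst p \<in> analytic_polynomials \<and> snd p > 0 \<and>
      (\<forall>F \<in> bochner_L1 circle. L1_norm circle (\<lambda>z. F z - fst p z) \<le> 2 * snd p \<longrightarrow> \<not> proj_approx (real n) F)"
    for n :: nat and p :: "(complex \<Rightarrow> 'x) \<times> real"
  have ex: "\<exists>p'. good n p' \<and> L1_norm circle (\<lambda>z. fst p' z - P z) \<le> r \<and> snd p' \<le> r / 2"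
    if r: "r > 0" and P: "P \<in> analytic_polynomials" for n P r
  proof -
    obtain Q where Q: "Q \<in> analytic_polynomials" "L1_norm circle (\<lambda>z. Q z - P z) \<le> r" "\<not> proj_approx (real n) Q"
      using dense[OF r P] by blast
    have QL: "Q \<in> bochner_L1 circle" by (rule analytic_polynomial_bochner_L1[OF Q(1)])
    obtain e where e: "e > 0" "\<And>s. s \<in> formal_sums \<Longrightarrow> formal_cost s \<le> real n \<Longrightarrow> e \<le> L1_norm circle (\<lambda>z. tensor_fun s z - Q z)"
      using Q(3) unfolding proj_approx_def by (force simp: not_less)
    define r' where "r' = min (r / 2) (e / 4)"
    have "\<not> proj_approx (real n) F" if F: "F \<in> bochner_L1 circle" "L1_norm circle (\<lambda>z. F z - Q z) \<le> 2 * r'" for F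
    proof
      assume "proj_approx (real n) F"
      moreover have "e / 2 > 0" using e by simp
      ultimately obtain s where s: "s \<in> formal_sums" "formal_cost s \<le> real n" "L1_norm circle (\<lambda>z. tensor_fun s z - F z) < e / 2"
        unfolding proj_approx_def by blast
      have "L1_norm circle (\<lambda>z. tensor_fun s z - Q z) \<le> L1_norm circle (\<lambda>z. tensor_fun s z - F z) + L1_norm circle (\<lambda>z. F z - Q z)"
        by (rule L1_norm_triangle[OF tensor_fun_bochner_L1[OF s(1)] F(1) QL])
      moreover have "2 * r' \<le> e / 2" by (simp add: r'_def)
      ultimately show False using e(2)[OF s(1,2)] s(3) F(2) by linarith
    qed
    then have "good n (Q, r')" using Q(1) r e(1) by (simp add: good_def r'_def)
    then show ?thesis using Q(2) by (intro exI[of _ "(Q, r')"]) (simp add: r'_def)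
  qed
  have "\<exists>f. \<forall>n. good n (f n) \<and> (L1_norm circle (\<lambda>z. fst (f (Suc n)) z - fst (f n) z) \<le> snd (f n) \<and> snd (f (Suc n)) \<le> snd (f n) / 2)"
  proof (rule dependent_nat_choice)
    show "\<exists>p. good 0 p" using ex[of 1 "\<lambda>z. 0" 0] analytic_polynomial_zero by auto
    fix p n assume "good n p"
    then show "\<exists>q. good (Suc n) q \<and> (L1_norm circle (\<lambda>z. fst q z - fst p z) \<le> snd p \<and> snd q \<le> snd p / 2)"
      by (intro ex) (auto simp: good_def)
  qed
  then obtain f where f: "good n (f n)" "L1_norm circle (\<lambda>z. fst (f (Suc n)) z - fst (f n) z) \<le> snd (f n)"
      "snd (f (Suc n)) \<le> snd (f n) / 2" for n by blast
  have f': "fst (f n) \<in> analytic_polynomials" "0 < snd (f n)" for n using f(1)[of n] by (auto simp: good_def)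
  obtain F where F: "F \<in> H1_tilde" "\<And>n. L1_norm circle (\<lambda>z. F z - fst (f n) z) \<le> 2 * snd (f n)"
    using analytic_polynomials_limit[of "\<lambda>n. fst (f n)" "\<lambda>n. snd (f n)", OF f' f(3,2)] by metis
  have FL: "F \<in> bochner_L1 circle" by (rule H1_tilde_bochner_L1[OF F(1)])
  have not: "\<not> proj_approx (real n) F" for n using f(1)[of n] F(2)[of n] FL unfolding good_def by blast
  obtain u where "u \<in> proj_tensor" "canonical_image u F" using proj F(1) unfolding H1_projective_def by blast
  from canonical_image_imp_proj_approx[OF FL this] obtain K where K: "proj_approx K F" by blast
  obtain n :: nat where "K \<le> real n" using real_arch_simple by blast
  then show False using proj_approx_mono[OF K] not by blast
qed

lemma proj_approx_scale:
  assumes "proj_approx K (\<lambda>z. complex_of_real t *\<^sub>C F z)" "t > 0"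
  shows "proj_approx (K / t) F"
  unfolding proj_approx_def
proof (intro allI impI)
  fix e :: real assume "e > 0"
  then have "t * e > 0" using assms(2) by simp
  then obtain s where s: "s \<in> formal_sums" "formal_cost s \<le> K" "L1_norm circle (\<lambda>z. tensor_fun s z - complex_of_real t *\<^sub>C F z) < t * e"
    using assms(1) unfolding proj_approx_def by blast
  define s' where "s' = map (\<lambda>(h, x). (h, complex_of_real (1 / t) *\<^sub>C x)) s"
  have s': "s' \<in> formal_sums" unfolding s'_def by (rule formal_sums_scale[OF s(1)])
  have "formal_cost s' = formal_cost s / t" unfolding s'_def formal_cost_scale using assms(2) by (simp add: norm_divide)
  then have c: "formal_cost s' \<le> K / t" using s(2) assms(2) by (simp add: divide_right_mono)
  have eq: "tensor_fun s' z - F z = complex_of_real (1 / t) *\<^sub>C (tensor_fun s z - complex_of_real t *\<^sub>C F z)" for z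
    unfolding s'_def tensor_fun_scale using assms(2) by (simp add: scaleC_diff_right scaleC_scaleC)
  have "L1_norm circle (\<lambda>z. tensor_fun s' z - F z) = L1_norm circle (\<lambda>z. tensor_fun s z - complex_of_real t *\<^sub>C F z) / t"
    unfolding eq L1_norm_scaleC using assms(2) by (simp add: norm_divide)
  also have "\<dots> < e" using s(3) assms(2) by (simp add: divide_less_eq mult.commute)
  finally show "\<exists>s\<in>formal_sums. formal_cost s \<le> K / t \<and> L1_norm circle (\<lambda>z. tensor_fun s z - F z) < e"
    using s' c by blast
qed

lemma H1_projective_imp_proj_approx_norm:
  assumes proj: "H1_projective TYPE('x::complex_banach)"
  obtains c where "c > 0" 
    "\<And>(F :: complex \<Rightarrow> 'x) e. F \<in> analytic_polynomials \<Longrightarrow> e > 0 \<Longrightarrow> proj_approx (c * L1_norm circle F + e) F"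
proof -
  obtain K r where r: "r > 0" and K: "\<And>F :: complex \<Rightarrow> 'x. F \<in> analytic_polynomials \<Longrightarrow> L1_norm circle F < r \<Longrightarrow> proj_approx K F"
    using H1_projective_imp_ball[OF proj] by blast
  define c where "c = 2 * (\<bar>K\<bar> + 1) / r"
  have c: "c > 0" using r by (simp add: c_def)
  have "proj_approx (c * L1_norm circle F + e) F" if F: "F \<in> analytic_polynomials" and e: "e > 0" for F :: "complex \<Rightarrow> 'x" and e
  proof -
    define N where "N = L1_norm circle F + e / c"
    have N: "N > 0" "L1_norm circle F < N" using e c by (auto simp: N_def add_nonneg_pos)
    \<comment> \<open>This factor scales \<open>F\<close> into the ball.\<close>
    define t where "t = r / (2 * N)"
    have t: "t > 0" using r N by (simp add: t_def)
    have "L1_norm circle (\<lambda>z. complex_of_real t *\<^sub>C F z) = t * L1_norm circle F"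
      unfolding L1_norm_scaleC using t by simp
    also have "\<dots> < t * N" using N t by simp
    also have "\<dots> = r / 2" using N by (simp add: t_def)
    also have "\<dots> < r" using r by simp
    finally have "proj_approx K (\<lambda>z. complex_of_real t *\<^sub>C F z)" by (intro K analytic_polynomials_scaleC F)
    then have "proj_approx (K / t) F" by (rule proj_approx_scale[OF _ t])
    moreover have "K / t \<le> (\<bar>K\<bar> + 1) / t" using t by (intro divide_right_mono) auto
    moreover have "(\<bar>K\<bar> + 1) / t = c * N" using N r by (simp add: t_def c_def field_simps)
    moreover have "c * N = c * L1_norm circle F + e" using c by (simp add: N_def distrib_left)
    ultimately show ?thesis using proj_approx_mono by metis
  qed
  then show ?thesis using that c by blast
qed

section \<open>Transference from the circle to the torus\<close>

text \<open>The index of the difference to which the character with frequency \<open>a\<close> belongs; meaningful for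
  \<open>a\<close> in some \<open>hardy_freqs m\<close>.\<close>

definition level :: "(nat \<Rightarrow> int) \<Rightarrow> nat" where
  "level a = (THE n. a \<in> lead_freqs n)"

lemma level_eq: "a \<in> lead_freqs n \<Longrightarrow> level a = n"
  unfolding level_def using lead_freqs_unique by blast

lemma hardy_freqs_level:
  assumes "a \<in> hardy_freqs m" shows "a \<in> lead_freqs (level a)" "level a \<le> m"
  using assms level_eq by (auto simp: hardy_freqs_def)

text \<open>The integer with digits \<open>a j\<close> in base \<open>2 * D + 1\<close>. For digits of modulus at most \<open>2 * D\<close> its sign is
  that of the last nonzero digit; it follows that digits of modulus at most \<open>D\<close> are determined by
  the integer, and that the Hardy frequencies are those with a nonnegative value.\<close>

definition lacunary :: "nat \<Rightarrow> nat \<Rightarrow> (nat \<Rightarrow> int) \<Rightarrow> int" where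
  "lacunary m D a = (\<Sum>j\<in>{1..m}. a j * (2 * int D + 1) ^ j)"

lemma lacunary_diff: "lacunary m D (\<lambda>j. a j - b j) = lacunary m D a - lacunary m D b"
  by (simp add: lacunary_def left_diff_distrib sum_subtractf)

lemma lacunary_pos:
  assumes a: "a \<in> lead_freqs n" "1 \<le> n" "n \<le> m" and D: "\<And>j. \<bar>a j\<bar> \<le> 2 * int D"
  shows "0 < lacunary m D a"
proof -
  define B where "B = 2 * int D + 1"
  have geo: "(\<Sum>j\<in>{1..k}. 2 * int D * B ^ j) < B ^ Suc k" for k
  proof (induction k)
    case (Suc k)
    then have "(\<Sum>j\<in>{1..Suc k}. 2 * int D * B ^ j) < B ^ Suc k + 2 * int D * B ^ Suc k" by simp
    also have "\<dots> = B ^ Suc (Suc k)" by (simp add: B_def algebra_simps)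
    finally show ?case .
  qed (simp add: B_def)
  obtain k where k: "n = Suc k" using a(2) by (cases n) auto
  have an: "1 \<le> a n" using a(1,2) by (simp add: lead_freqs_def)
  have "lacunary m D a = (\<Sum>j\<in>{1..n}. a j * B ^ j)"
    unfolding lacunary_def B_def
    by (rule sum.mono_neutral_right) (use a in \<open>auto simp: lead_freqs_def freqs_def\<close>)
  also have "\<dots> = (\<Sum>j\<in>{1..k}. a j * B ^ j) + a n * B ^ n" by (simp add: k)
  also have "\<dots> \<ge> - (\<Sum>j\<in>{1..k}. 2 * int D * B ^ j) + B ^ Suc k"
  proof (rule add_mono)
    have "- (2 * int D * B ^ j) \<le> a j * B ^ j" for j
    proof -
      have "(- (2 * int D)) * B ^ j \<le> a j * B ^ j"
        by (rule mult_right_mono) (use D[of j] in \<open>auto simp: B_def\<close>)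
      then show ?thesis by simp
    qed
    then show "- (\<Sum>j\<in>{1..k}. 2 * int D * B ^ j) \<le> (\<Sum>j\<in>{1..k}. a j * B ^ j)"
      unfolding sum_negf[symmetric] by (intro sum_mono)
    have "1 * B ^ n \<le> a n * B ^ n" by (rule mult_right_mono) (use an in \<open>auto simp: B_def\<close>)
    then show "B ^ Suc k \<le> a n * B ^ n" by (simp add: k)
  qed
  finally show ?thesis using geo[of k] by linarith
qed

lemma lacunary_nonneg_iff:
  assumes a: "a \<in> freqs m" and D: "\<And>j. \<bar>a j\<bar> \<le> 2 * int D"
  shows "0 \<le> lacunary m D a \<longleftrightarrow> a \<in> hardy_freqs m"
proof (cases "a \<in> hardy_freqs m")
  case True
  then obtain n where n: "a \<in> lead_freqs n" "n \<le> m" by (auto simp: hardy_freqs_def)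
  have "0 \<le> lacunary m D a"
  proof (cases "n = 0")
    case True
    then show ?thesis using n(1) by (simp add: lead_freqs_0 lacunary_def)
  next
    case False
    then show ?thesis using lacunary_pos[OF n(1) _ n(2) D] by simp
  qed
  then show ?thesis using True by simp
next
  case False
  obtain n where n: "1 \<le> n" "n \<le> m" "a \<in> freqs n" "a n < 0"
    by (rule not_hardy_freq_last_negative[OF a False])
  have "(\<lambda>j. 0 - a j) \<in> lead_freqs n" using n(1,3,4) by (simp add: lead_freqs_def freqs_def)
  then have "0 < lacunary m D (\<lambda>j. 0 - a j)" by (rule lacunary_pos[OF _ n(1,2)]) (simp add: D)
  then have "lacunary m D a < 0" unfolding lacunary_diff by (simp add: lacunary_def)
  then show ?thesis using False by simp
qed

lemma lacunary_inj:
  assumes a: "a \<in> freqs m" "b \<in> freqs m" and D: "\<And>j. \<bar>a j\<bar> \<le> int D" "\<And>j. \<bar>b j\<bar> \<le> int D"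
    and eq: "lacunary m D a = lacunary m D b"
  shows "a = b"
proof -
  have D2: "\<bar>a j - b j\<bar> \<le> 2 * int D" for j using D[of j] by linarith
  have D3: "\<bar>b j - a j\<bar> \<le> 2 * int D" for j using D[of j] by linarith
  have 1: "(\<lambda>j. a j - b j) \<in> hardy_freqs m"
    using lacunary_nonneg_iff[OF freqs_diff[OF a] D2] eq by (simp add: lacunary_diff)
  then obtain n where n: "(\<lambda>j. a j - b j) \<in> lead_freqs n" "n \<le> m" by (auto simp: hardy_freqs_def)
  have "n = 0"
  proof (rule ccontr)
    assume "n \<noteq> 0"
    then have "0 < lacunary m D (\<lambda>j. a j - b j)" using lacunary_pos[OF n(1) _ n(2) D2] by simp
    then show False using eq by (simp add: lacunary_diff)
  qed
  then show ?thesis using n(1) by (auto simp: lead_freqs_0 fun_eq_iff)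
qed

text \<open>The composition of the character with frequency \<open>a\<close> with this curve is \<open>z \<mapsto> z powi lacunary m D a\<close>.\<close>

definition lacunary_curve :: "nat \<Rightarrow> complex \<Rightarrow> nat \<Rightarrow> complex" where
  "lacunary_curve D z j = z powi ((2 * int D + 1) ^ j)"

lemma norm_lacunary_curve: "norm z = 1 \<Longrightarrow> norm (lacunary_curve D z j) = 1"
  by (simp add: lacunary_curve_def norm_power_int)

lemma chi_lacunary_curve:
  assumes "z \<noteq> 0" shows "chi m a (lacunary_curve D z) = z powi lacunary m D a"
proof -
  have p: "(\<Prod>j\<in>J. z powi f j) = z powi (\<Sum>j\<in>J. f j)" if "finite J" for f and J :: "nat set"
    using that by (induction J rule: finite_induct) (auto simp: power_int_add assms)
  show ?thesis unfolding chi_def lacunary_curve_def lacunary_def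
    by (subst p[symmetric]) (simp_all add: power_int_mult[symmetric] mult.commute)
qed

definition freq_diff :: "(nat \<Rightarrow> int) \<times> (nat \<Rightarrow> int) \<Rightarrow> nat \<Rightarrow> int" where
  "freq_diff p = (\<lambda>j. fst p j - snd p j)"

text \<open>The differences of two points of the cube, listed with multiplicity, are the frequencies of the
  Fejer kernel. Those in \<open>hardy_freqs m\<close> are kept.\<close>

definition hardy_pairs :: "nat \<Rightarrow> nat \<Rightarrow> ((nat \<Rightarrow> int) \<times> (nat \<Rightarrow> int)) set" where
  "hardy_pairs m D = {p \<in> cube m D \<times> cube m D. freq_diff p \<in> hardy_freqs m}"

lemma finite_hardy_pairs [simp]: "finite (hardy_pairs m D)"
  by (simp add: hardy_pairs_def)

lemma freq_diff_cube:
  assumes "p \<in> cube m D \<times> cube m D" 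
  shows "freq_diff p \<in> freqs m" "\<bar>freq_diff p j\<bar> \<le> int D"
proof -
  show "freq_diff p \<in> freqs m"
    unfolding freq_diff_def by (rule freqs_diff) (use assms cube_subset_freqs[of m D] in auto)
  have b: "0 \<le> c j \<and> c j \<le> int D" if "c \<in> cube m D" for c
    using that by (cases "j \<in> {1..m}") (auto simp: cube_def PiE_dflt_def)
  have "0 \<le> fst p j \<and> fst p j \<le> int D" "0 \<le> snd p j \<and> snd p j \<le> int D"
    using b[of "fst p"] b[of "snd p"] assms by auto
  then show "\<bar>freq_diff p j\<bar> \<le> int D" by (simp add: freq_diff_def abs_le_iff)
qed

text \<open>The function on the torus with the Fourier coefficient \<open>\<epsilon> (level a) * fejer_weight m D a *
  v (lacunary m D a)\<close> at \<open>a\<close> in \<open>hardy_freqs m\<close>. If \<open>v\<close> is the sequence of Fourier coefficients of a function in \<open>H1\<close>,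
  this is the transform by the signs \<open>\<epsilon>\<close> of the convolution along the curve.\<close>

definition transfer :: "nat \<Rightarrow> nat \<Rightarrow> (nat \<Rightarrow> real) \<Rightarrow> (int \<Rightarrow> 'x::complex_banach) \<Rightarrow> (nat \<Rightarrow> complex) \<Rightarrow> 'x" where
  "transfer m D \<epsilon> v \<theta> = (\<Sum>p\<in>hardy_pairs m D. 
     (complex_of_real (\<epsilon> (level (freq_diff p)) / card (cube m D)) * chi m (freq_diff p) \<theta>) *\<^sub>C v (lacunary m D (freq_diff p)))"

text \<open>The Fourier coefficient of index \<open>l\<close>.\<close>

definition fourier_coeff :: "(complex \<Rightarrow> complex) \<Rightarrow> int \<Rightarrow> complex" where
  "fourier_coeff h l = (LINT z|circle. z powi (- l) * h z)"

lemma H1_integrable: "h \<in> H1 \<Longrightarrow> integrable circle h"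
  using H1_tilde_bochner_L1[of h] by (simp add: bochner_L1_complex_iff)

lemma integrable_power_int_mult:
  assumes "integrable circle h" shows "integrable circle (\<lambda>z. z powi k * h z)"
proof (rule Bochner_Integration.integrable_bound[OF integrable_norm[OF assms]])
  show "(\<lambda>z. z powi k * h z) \<in> borel_measurable circle" using assms by measurable
  show "AE z in circle. norm (z powi k * h z) \<le> norm (norm (h z))"
    by (rule AE_I2) (simp add: norm_mult norm_power_int space_circle)
qed

lemma fourier_coeff_H1_negative:
  assumes h: "h \<in> H1" and l: "l < 0" shows "fourier_coeff h l = 0"
proof -
  have hi: "integrable circle h" by (rule H1_integrable[OF h])
  have "norm (fourier_coeff h l) \<le> e" if e: "e > 0" for e
  proof -
    obtain q where "q \<in> analytic_polynomials" and hq: "L1_norm circle (\<lambda>z. h z - q z) < e"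
      using h e unfolding H1_tilde_def by blast
    then obtain N y where q: "q = (\<lambda>z. \<Sum>n\<le>N. z ^ n *\<^sub>C y n)" unfolding analytic_polynomials_def by blast
    have qL: "q \<in> bochner_L1 circle" by (rule analytic_polynomial_bochner_L1) fact
    then have qi: "integrable circle q" by (simp add: bochner_L1_complex_iff)
    have "(LINT z|circle. z powi (- l) * q z) = (LINT z|circle. (\<Sum>n\<le>N. z powi (int n - l) * y n))"
    proof (rule Bochner_Integration.integral_cong[OF HOL.refl])
      fix z assume "z \<in> space circle"
      then have "z \<noteq> 0" by (auto simp: space_circle)
      then show "z powi (- l) * q z = (\<Sum>n\<le>N. z powi (int n - l) * y n)"
        unfolding q sum_distrib_left
        by (intro sum.cong HOL.refl) (simp add: scaleC_complex_def power_int_diff power_int_minus field_simps)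
    qed
    also have "\<dots> = (\<Sum>n\<le>N. (LINT z|circle. z powi (int n - l)) * y n)"
      by (simp add: Bochner_Integration.integral_sum integrable_circle_power_int)
    also have "\<dots> = 0"
      by (rule sum.neutral) (use l in \<open>auto simp: integral_circle_power_int\<close>)
    finally have "fourier_coeff h l = (LINT z|circle. z powi (- l) * h z) - (LINT z|circle. z powi (- l) * q z)"
      by (simp add: fourier_coeff_def)
    also have "\<dots> = (LINT z|circle. z powi (- l) * (h z - q z))"
      unfolding right_diff_distrib
      by (rule Bochner_Integration.integral_diff[symmetric]) (intro integrable_power_int_mult hi qi)+
    also have "norm \<dots> \<le> (LINT z|circle. norm (z powi (- l) * (h z - q z)))" by (rule integral_norm_bound)
    also have "\<dots> = L1_norm circle (\<lambda>z. h z - q z)"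
      unfolding L1_norm_def
      by (rule Bochner_Integration.integral_cong[OF HOL.refl]) (simp add: norm_mult norm_power_int space_circle)
    finally show ?thesis using hq by simp
  qed
  from field_le_epsilon[of "norm (fourier_coeff h l)" 0] this show ?thesis by simp
qed

lemma nn_integral_fejer_kernel:
  "(\<integral>\<^sup>+\<theta>. ennreal (fejer_kernel m D \<theta>) \<partial>torus) = 1"
proof -
  have "integrable torus (fejer_kernel m D)"
    by (rule integrable_torus_bounded[where B="card (cube m D)"])
       (auto intro!: fejer_kernel_bounded norm_torus_coordinate)
  then show ?thesis using nn_integral_eq_integral[of torus "fejer_kernel m D"] by (simp add: integral_fejer_kernel)
qed

lemma nn_integral_rotate_torus:
  assumes "\<And>j. 1 \<le> j \<Longrightarrow> norm (\<eta> j) = 1" "f \<in> borel_measurable torus"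
  shows "(\<integral>\<^sup>+\<omega>. f (rotate_torus \<eta> \<omega>) \<partial>torus) = (\<integral>\<^sup>+\<omega>. f \<omega> \<partial>torus)"
proof -
  have "f \<in> borel_measurable (distr torus torus (rotate_torus \<eta>))" using assms(2) by simp
  from nn_integral_distr[OF measurable_rotate_torus this] assms(1)
  have "integral\<^sup>N (distr torus torus (rotate_torus \<eta>)) f = (\<integral>\<^sup>+\<omega>. f (rotate_torus \<eta> \<omega>) \<partial>torus)" by blast
  then show ?thesis using distr_rotate_torus[of \<eta>] assms(1) by simp
qed

text \<open>Convolution along the curve with the Fejer kernel is a contraction from the circle to the torus.\<close>

lemma L1_norm_transfer_fejer_le:
  assumes h: "integrable circle h"
  shows "L1_norm torus (\<lambda>\<theta>. \<Sum>p\<in>cube m D \<times> cube m D. 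
     fourier_coeff h (lacunary m D (freq_diff p)) / card (cube m D) * chi m (freq_diff p) \<theta>) \<le> L1_norm circle h"
proof -
  define g where "g \<theta> = (\<Sum>p\<in>cube m D \<times> cube m D. 
     fourier_coeff h (lacunary m D (freq_diff p)) / card (cube m D) * chi m (freq_diff p) \<theta>)" for \<theta>
  \<comment> \<open>The convolution is \<open>g \<theta> = (LINT z|circle. h z * K z \<theta>)\<close>.\<close>
  define \<gamma> where "\<gamma> z = lacunary_curve D (inverse z)" for z
  define K where "K z \<theta> = fejer_kernel m D (rotate_torus (\<gamma> z) \<theta>)" for z \<theta>
  have \<gamma>1: "norm (\<gamma> z j) = 1" if "z \<in> space circle" for z j
    unfolding \<gamma>_def by (rule norm_lacunary_curve) (use that in \<open>simp add: space_circle norm_inverse\<close>)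
  have chi\<gamma>: "chi m a (rotate_torus (\<gamma> z) \<theta>) = z powi (- lacunary m D a) * chi m a \<theta>" if "z \<in> space circle" for z \<theta> a
  proof -
    have "z \<noteq> 0" using that by (auto simp: space_circle)
    then show ?thesis unfolding chi_rotate \<gamma>_def by (simp add: chi_lacunary_curve power_int_inverse power_int_minus)
  qed
  have rot1: "norm (rotate_torus (\<gamma> z) \<theta> j) = 1" if "z \<in> space circle" "\<theta> \<in> space torus" "1 \<le> j" for z \<theta> j
    using that by (simp add: norm_mult \<gamma>1 norm_torus_coordinate)
  have K: "complex_of_real (K z \<theta>) = (\<Sum>p\<in>cube m D \<times> cube m D. z powi (- lacunary m D (freq_diff p)) * chi m (freq_diff p) \<theta>) / card (cube m D)"
    if "z \<in> space circle" "\<theta> \<in> space torus" for z \<theta>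
  proof -
    have "complex_of_real (K z \<theta>) = 
      (\<Sum>c\<in>cube m D. \<Sum>c'\<in>cube m D. chi m (\<lambda>j. c j - c' j) (rotate_torus (\<gamma> z) \<theta>)) / of_nat (card (cube m D))"
      unfolding K_def by (rule fejer_kernel_expand) (rule rot1[OF that])
    then show ?thesis unfolding chi\<gamma>[OF that(1)] sum.cartesian_product by (simp add: freq_diff_def case_prod_beta')
  qed
  have Km: "(\<lambda>(z, \<theta>). K z \<theta>) \<in> borel_measurable (circle \<Otimes>\<^sub>M torus)"
  proof -
    have "(\<lambda>x. cmod (\<Sum>c\<in>cube m D. fst x powi (- lacunary m D c) * chi m c (snd x))) \<in> borel_measurable (circle \<Otimes>\<^sub>M torus)"
      by measurable
    then have "(\<lambda>x. (cmod (\<Sum>c\<in>cube m D. fst x powi (- lacunary m D c) * chi m c (snd x)))\<^sup>2 / card (cube m D)) \<in> borel_measurable (circle \<Otimes>\<^sub>M torus)"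
      by measurable
    then show ?thesis
      by (rule measurable_cong[THEN iffD1, rotated]) (auto simp: K_def fejer_kernel_def chi\<gamma> space_pair_measure)
  qed
  have hm: "h \<in> borel_measurable circle" using h by simp
  have Kz: "(\<lambda>\<theta>. K z \<theta>) \<in> borel_measurable torus" if "z \<in> space circle" for z
    using measurable_Pair2[OF Km that] by simp
  have K\<theta>: "(\<lambda>z. K z \<theta>) \<in> borel_measurable circle" if "\<theta> \<in> space torus" for \<theta>
    using measurable_Pair1[OF Km that] by simp
  have pt: "ennreal (cmod (g \<theta>)) \<le> (\<integral>\<^sup>+z. ennreal (cmod (h z) * K z \<theta>) \<partial>circle)" if \<theta>: "\<theta> \<in> space torus" for \<theta>
  proof -
    have hK: "integrable circle (\<lambda>z. h z * complex_of_real (K z \<theta>))"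
    proof (rule Bochner_Integration.integrable_bound[where f="\<lambda>z. card (cube m D) * cmod (h z)"])
      have "(\<lambda>z. complex_of_real (K z \<theta>)) \<in> borel_measurable circle"
        by (rule measurable_compose[OF K\<theta>[OF \<theta>] borel_measurable_continuous_onI]) (intro continuous_intros)
      then show "(\<lambda>z. h z * complex_of_real (K z \<theta>)) \<in> borel_measurable circle" using hm by measurable
      show "AE z in circle. norm (h z * complex_of_real (K z \<theta>)) \<le> norm (card (cube m D) * cmod (h z))"
      proof (rule AE_I2)
        fix z assume "z \<in> space circle"
        then have "K z \<theta> \<le> card (cube m D)" unfolding K_def by (intro fejer_kernel_bounded rot1 \<theta>)
        then show "norm (h z * complex_of_real (K z \<theta>)) \<le> norm (card (cube m D) * cmod (h z))"
          by (simp add: norm_mult K_def mult.commute[of "cmod (h z)"] mult_right_mono)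
      qed
    qed (use h in simp)
    have "g \<theta> = (LINT z|circle. h z * complex_of_real (K z \<theta>))"
    proof -
      have "(LINT z|circle. h z * complex_of_real (K z \<theta>)) = 
        (LINT z|circle. (\<Sum>p\<in>cube m D \<times> cube m D. (z powi (- lacunary m D (freq_diff p)) * h z) * (chi m (freq_diff p) \<theta> / card (cube m D))))"
        by (rule Bochner_Integration.integral_cong[OF HOL.refl])
           (simp add: K[OF _ \<theta>] sum_distrib_left sum_divide_distrib mult_ac)
      also have "\<dots> = (\<Sum>p\<in>cube m D \<times> cube m D. fourier_coeff h (lacunary m D (freq_diff p)) * (chi m (freq_diff p) \<theta> / card (cube m D)))"
        unfolding fourier_coeff_def 
        by (subst Bochner_Integration.integral_sum) (auto intro!: integrable_power_int_mult h integrable_mult_left)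
      finally show ?thesis unfolding g_def by simp
    qed
    then have "ennreal (cmod (g \<theta>)) \<le> (\<integral>\<^sup>+z. ennreal (norm (h z * complex_of_real (K z \<theta>))) \<partial>circle)"
      using integral_norm_bound_ennreal[OF hK] by simp
    also have "\<dots> = (\<integral>\<^sup>+z. ennreal (cmod (h z) * K z \<theta>) \<partial>circle)"
      by (rule nn_integral_cong) (simp add: norm_mult K_def)
    finally show ?thesis .
  qed
  have gL: "g \<in> bochner_L1 torus"
    unfolding g_def bochner_L1_complex_iff by (intro Bochner_Integration.integrable_sum integrable_mult_right integrable_chi)
  have hKm: "(\<lambda>(z, \<theta>). ennreal (cmod (h z) * K z \<theta>)) \<in> borel_measurable (circle \<Otimes>\<^sub>M torus)"
  proof -
    have "(\<lambda>x. cmod (h (fst x))) \<in> borel_measurable (circle \<Otimes>\<^sub>M torus)" using hm by measurable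
    then have "(\<lambda>x. ennreal (cmod (h (fst x)) * (case x of (z, \<theta>) \<Rightarrow> K z \<theta>))) \<in> borel_measurable (circle \<Otimes>\<^sub>M torus)"
      using Km by (intro measurable_compose[OF borel_measurable_times measurable_ennreal])
    then show ?thesis by (simp add: case_prod_beta')
  qed
  have "ennreal (L1_norm torus g) = (\<integral>\<^sup>+\<theta>. ennreal (cmod (g \<theta>)) \<partial>torus)" by (rule L1_norm_eq_nn_integral[OF gL])
  also have "\<dots> \<le> (\<integral>\<^sup>+\<theta>. \<integral>\<^sup>+z. ennreal (cmod (h z) * K z \<theta>) \<partial>circle \<partial>torus)" by (rule nn_integral_mono) (rule pt)
  also have "\<dots> = (\<integral>\<^sup>+z. \<integral>\<^sup>+\<theta>. ennreal (cmod (h z) * K z \<theta>) \<partial>torus \<partial>circle)"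
    using pair_circle_torus.Fubini'[OF hKm] .
  also have "\<dots> = (\<integral>\<^sup>+z. ennreal (cmod (h z)) \<partial>circle)"
  proof (rule nn_integral_cong)
    fix z assume z: "z \<in> space circle"
    have "(\<integral>\<^sup>+\<theta>. ennreal (cmod (h z) * K z \<theta>) \<partial>torus) = (\<integral>\<^sup>+\<theta>. ennreal (cmod (h z)) * ennreal (K z \<theta>) \<partial>torus)"
      by (rule nn_integral_cong) (simp add: ennreal_mult K_def)
    also have "\<dots> = ennreal (cmod (h z)) * (\<integral>\<^sup>+\<theta>. ennreal (K z \<theta>) \<partial>torus)"
      by (rule nn_integral_cmult) (use Kz[OF z] in measurable)
    also have "(\<integral>\<^sup>+\<theta>. ennreal (K z \<theta>) \<partial>torus) = (\<integral>\<^sup>+\<theta>. ennreal (fejer_kernel m D \<theta>) \<partial>torus)"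
      unfolding K_def by (rule nn_integral_rotate_torus[OF \<gamma>1[OF z]]) measurable
    also have "\<dots> = 1" by (rule nn_integral_fejer_kernel)
    finally show "(\<integral>\<^sup>+\<theta>. ennreal (cmod (h z) * K z \<theta>) \<partial>torus) = ennreal (cmod (h z))" by simp
  qed
  also have "\<dots> = ennreal (L1_norm circle h)"
    using h by (intro L1_norm_eq_nn_integral[symmetric]) (simp add: bochner_L1_complex_iff)
  finally have "L1_norm torus g \<le> L1_norm circle h" by (simp add: ennreal_le_iff)
  then show ?thesis unfolding g_def .
qed

text \<open>The convolution has no frequency outside \<open>hardy_freqs m\<close>, because \<open>lacunary\<close> is negative there. So
  the scalar case applies to it.\<close>

lemma L1_norm_transfer_scalar_le:
  assumes h: "h \<in> H1" and \<epsilon>: "\<And>n. \<epsilon> n \<in> {1, -1 :: real}"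
  shows "L1_norm torus (transfer m D \<epsilon> (fourier_coeff h)) \<le> 4 * L1_norm circle h"
proof -
  define c where "c p = fourier_coeff h (lacunary m D (freq_diff p)) / card (cube m D)" for p
  have 1: "transfer m D \<epsilon> (fourier_coeff h) = (\<lambda>\<theta>. \<Sum>p\<in>hardy_pairs m D. \<epsilon> (level (freq_diff p)) *\<^sub>R (c p * chi m (freq_diff p) \<theta>))"
    unfolding transfer_def c_def
    by (intro ext sum.cong HOL.refl) (simp add: scaleC_complex_def scaleR_conv_of_real)
  have 2: "L1_norm torus (\<lambda>\<theta>. \<Sum>p\<in>hardy_pairs m D. \<epsilon> (level (freq_diff p)) *\<^sub>R (c p * chi m (freq_diff p) \<theta>))
     \<le> 4 * L1_norm torus (\<lambda>\<theta>. \<Sum>p\<in>hardy_pairs m D. c p * chi m (freq_diff p) \<theta>)"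
  proof (rule scalar_hardy_unconditional[where l="\<lambda>p. level (freq_diff p)"])
    fix p assume "p \<in> hardy_pairs m D"
    then have p: "freq_diff p \<in> hardy_freqs m" by (simp add: hardy_pairs_def)
    show "freq_diff p \<in> lead_freqs (level (freq_diff p))" "level (freq_diff p) \<le> m"
      by (rule hardy_freqs_level[OF p])+
  qed (use \<epsilon> in simp_all)
  have 3: "(\<Sum>p\<in>hardy_pairs m D. c p * chi m (freq_diff p) \<theta>) = (\<Sum>p\<in>cube m D \<times> cube m D. c p * chi m (freq_diff p) \<theta>)" for \<theta>
  proof (rule sum.mono_neutral_left)
    show "\<forall>p\<in>cube m D \<times> cube m D - hardy_pairs m D. c p * chi m (freq_diff p) \<theta> = 0"
    proof
      fix p assume p: "p \<in> cube m D \<times> cube m D - hardy_pairs m D"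
      then have pc: "p \<in> cube m D \<times> cube m D" and nh: "freq_diff p \<notin> hardy_freqs m" by (auto simp: hardy_pairs_def)
      have "\<bar>freq_diff p j\<bar> \<le> 2 * int D" for j using freq_diff_cube(2)[OF pc, of j] by simp
      from lacunary_nonneg_iff[OF freq_diff_cube(1)[OF pc] this] nh have "lacunary m D (freq_diff p) < 0" by simp
      then show "c p * chi m (freq_diff p) \<theta> = 0" by (simp add: c_def fourier_coeff_H1_negative[OF h])
    qed
  qed (auto simp: hardy_pairs_def)
  show ?thesis
    using 2 L1_norm_transfer_fejer_le[OF H1_integrable[OF h], of m D] unfolding 1 3 unfolding c_def by linarith
qed

lemma transfer_bochner_L1: "transfer m D \<epsilon> v \<in> bochner_L1 torus"
  unfolding transfer_def by (rule bochner_L1_sum, rule bochner_L1_scaleC_const) (intro integrable_mult_right integrable_chi)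

lemma transfer_diff: "transfer m D \<epsilon> (\<lambda>l. v l - w l) \<theta> = transfer m D \<epsilon> v \<theta> - transfer m D \<epsilon> w \<theta>"
  unfolding transfer_def by (simp add: scaleC_diff_right sum_subtractf)

lemma L1_norm_transfer_le:
  fixes C :: real
  assumes v: "\<And>l. norm (v l) \<le> C" and \<epsilon>: "\<And>n. \<epsilon> n \<in> {1, -1 :: real}"
  shows "L1_norm torus (transfer m D \<epsilon> v) \<le> card (cube m D) * C"
proof -
  have e1: "\<bar>\<epsilon> n\<bar> = 1" for n using \<epsilon>[of n] by auto
  have C: "0 \<le> C" using order_trans[OF norm_ge_zero v[of 0]] .
  let ?N = "real (card (cube m D))"
  have N: "?N > 0" by (simp add: card_cube)
  have eq: "transfer m D \<epsilon> v \<theta> = (\<Sum>p\<in>hardy_pairs m D. chi m (freq_diff p) \<theta> *\<^sub>C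
      (complex_of_real (\<epsilon> (level (freq_diff p)) / card (cube m D)) *\<^sub>C v (lacunary m D (freq_diff p))))" for \<theta>
    unfolding transfer_def scaleC_scaleC by (simp add: mult.commute)
  have "L1_norm torus (transfer m D \<epsilon> v) \<le> (\<Sum>p\<in>hardy_pairs m D. L1_norm torus (\<lambda>\<theta>. chi m (freq_diff p) \<theta> *\<^sub>C
      (complex_of_real (\<epsilon> (level (freq_diff p)) / card (cube m D)) *\<^sub>C v (lacunary m D (freq_diff p)))))"
    unfolding eq[abs_def] by (rule L1_norm_sum_le) (rule bochner_L1_scaleC_const[OF integrable_chi])
  also have "\<dots> \<le> (\<Sum>p\<in>hardy_pairs m D. C / ?N)"
  proof (rule sum_mono)
    fix p :: "(nat \<Rightarrow> int) \<times> (nat \<Rightarrow> int)"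
    let ?y = "complex_of_real (\<epsilon> (level (freq_diff p)) / card (cube m D)) *\<^sub>C v (lacunary m D (freq_diff p))"
    have "L1_norm torus (\<lambda>\<theta>. chi m (freq_diff p) \<theta> *\<^sub>C ?y) \<le> norm ?y"
      using L1_norm_chi_sum_le[of m "\<lambda>_. ?y" "{freq_diff p}"] by simp
    also have "\<dots> = norm (v (lacunary m D (freq_diff p))) / ?N" by (simp add: norm_scaleC norm_divide e1)
    also have "\<dots> \<le> C / ?N" by (intro divide_right_mono v) simp
    finally show "L1_norm torus (\<lambda>\<theta>. chi m (freq_diff p) \<theta> *\<^sub>C ?y) \<le> C / ?N" .
  qed
  also have "\<dots> = card (hardy_pairs m D) * (C / ?N)" by simp
  also have "\<dots> \<le> (?N * ?N) * (C / ?N)"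
  proof (rule mult_right_mono)
    have "card (hardy_pairs m D) \<le> card (cube m D \<times> cube m D)"
      by (rule card_mono) (auto simp: hardy_pairs_def)
    then show "real (card (hardy_pairs m D)) \<le> ?N * ?N" by (simp add: card_cartesian_product flip: of_nat_mult)
  qed (use C in simp)
  also have "\<dots> = ?N * C" using N by simp
  finally show ?thesis .
qed

text \<open>The Fourier coefficients of the function represented by a formal sum.\<close>

definition formal_coeff :: "'x::complex_banach formal_sum \<Rightarrow> int \<Rightarrow> 'x" where
  "formal_coeff s l = (\<Sum>(h, x)\<leftarrow>s. fourier_coeff h l *\<^sub>C x)"

lemma has_strong_integral_formal_coeff:
  "s \<in> formal_sums \<Longrightarrow> has_strong_integral circle (\<lambda>z. z powi (- l) *\<^sub>C tensor_fun s z) (formal_coeff s l)"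
proof (induction s)
  case Nil
  then show ?case by (simp add: tensor_fun_def formal_coeff_def has_strong_integral_zero)
next
  case (Cons hx s)
  obtain h x where hx: "hx = (h, x)" by (cases hx)
  have h: "h \<in> H1" and s: "s \<in> formal_sums" using Cons.prems by (auto simp: formal_sums_def hx)
  have "has_strong_integral circle (\<lambda>z. (z powi (- l) * h z) *\<^sub>C x) (fourier_coeff h l *\<^sub>C x)"
    unfolding fourier_coeff_def by (intro has_strong_integral_scaleC_const integrable_power_int_mult H1_integrable h)
  from has_strong_integral_add[OF this Cons.IH[OF s]]
  show ?case by (simp add: tensor_fun_def formal_coeff_def hx scaleC_add_right scaleC_scaleC)
qed

lemma L1_norm_transfer_formal_le:
  assumes \<epsilon>: "\<And>n. \<epsilon> n \<in> {1, -1 :: real}"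
  shows "s \<in> formal_sums \<Longrightarrow> L1_norm torus (transfer m D \<epsilon> (formal_coeff s)) \<le> 4 * formal_cost s"
proof (induction s)
  case Nil
  then show ?case by (simp add: transfer_def formal_coeff_def formal_cost_def L1_norm_def)
next
  case (Cons hx s)
  obtain h x where hx: "hx = (h, x)" by (cases hx)
  have h: "h \<in> H1" and s: "s \<in> formal_sums" using Cons.prems by (auto simp: formal_sums_def hx)
  have eq: "transfer m D \<epsilon> (formal_coeff (hx # s)) \<theta> = transfer m D \<epsilon> (fourier_coeff h) \<theta> *\<^sub>C x + transfer m D \<epsilon> (formal_coeff s) \<theta>" for \<theta>
    unfolding transfer_def formal_coeff_def 
    by (simp add: hx scaleC_add_right sum.distrib scaleC_sum_left scaleC_scaleC scaleC_complex_def)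
  have i: "integrable torus (transfer m D \<epsilon> (fourier_coeff h))"
    using transfer_bochner_L1[of m D \<epsilon> "fourier_coeff h"] by (simp add: bochner_L1_complex_iff)
  have "L1_norm torus (transfer m D \<epsilon> (formal_coeff (hx # s))) \<le> 
      L1_norm torus (\<lambda>\<theta>. transfer m D \<epsilon> (fourier_coeff h) \<theta> *\<^sub>C x) + L1_norm torus (transfer m D \<epsilon> (formal_coeff s))"
    unfolding eq[abs_def] by (rule L1_norm_add_le[OF bochner_L1_scaleC_const[OF i] transfer_bochner_L1])
  also have "\<dots> \<le> 4 * L1_norm circle h * norm x + 4 * formal_cost s"
    unfolding L1_norm_scaleC_const
    by (intro add_mono mult_right_mono L1_norm_transfer_scalar_le h \<epsilon> Cons.IH s) simp
  finally show ?case by (simp add: formal_cost_def hx)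
qed

text \<open>For a polynomial obtained by substituting the curve into a polynomial on the torus, \<open>transfer\<close>
  recovers the latter up to the Fejer weights and signs, because \<open>lacunary\<close> separates frequencies.\<close>

lemma transfer_polynomial:
  assumes S: "finite S" "S \<subseteq> hardy_freqs m" and D: "\<And>a j. a \<in> S \<Longrightarrow> \<bar>a j\<bar> \<le> int D"
  shows "transfer m D \<epsilon> (\<lambda>l. \<Sum>a\<in>{a\<in>S. lacunary m D a = l}. y a) \<theta> = 
    (\<Sum>a\<in>S. (complex_of_real (\<epsilon> (level a) * fejer_weight m D a) * chi m a \<theta>) *\<^sub>C y a)"
proof -
  let ?N = "card (cube m D)"
  define k where "k a = complex_of_real (\<epsilon> (level a) / ?N) * chi m a \<theta>" for a
  have "transfer m D \<epsilon> (\<lambda>l. \<Sum>a\<in>{a\<in>S. lacunary m D a = l}. y a) \<theta> = 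
      (\<Sum>p\<in>hardy_pairs m D. \<Sum>a\<in>S. if freq_diff p = a then k a *\<^sub>C y a else 0)"
    unfolding transfer_def
  proof (rule sum.cong[OF HOL.refl])
    fix p assume p: "p \<in> hardy_pairs m D"
    then have pc: "p \<in> cube m D \<times> cube m D" by (simp add: hardy_pairs_def)
    have "{a\<in>S. lacunary m D a = lacunary m D (freq_diff p)} = {a\<in>S. freq_diff p = a}"
    proof (intro Collect_cong conj_cong HOL.refl iffI)
      fix a assume a: "a \<in> S" "lacunary m D a = lacunary m D (freq_diff p)"
      have "a \<in> freqs m" using a(1) S(2) hardy_freqs_subset by blast
      then have "a = freq_diff p"
        by (rule lacunary_inj[OF _ freq_diff_cube(1)[OF pc] D[OF a(1)] freq_diff_cube(2)[OF pc] a(2)])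
      then show "freq_diff p = a" by simp
    qed simp
    then have "(complex_of_real (\<epsilon> (level (freq_diff p)) / ?N) * chi m (freq_diff p) \<theta>) *\<^sub>C 
        (\<Sum>a\<in>{a\<in>S. lacunary m D a = lacunary m D (freq_diff p)}. y a) = (\<Sum>a\<in>{a\<in>S. freq_diff p = a}. k a *\<^sub>C y a)"
      unfolding scaleC_sum_right by (simp only: k_def) (rule sum.cong, auto)
    also have "\<dots> = (\<Sum>a\<in>S. if freq_diff p = a then k a *\<^sub>C y a else 0)"
      by (rule sum.inter_filter[OF S(1)])
    finally show "(complex_of_real (\<epsilon> (level (freq_diff p)) / ?N) * chi m (freq_diff p) \<theta>) *\<^sub>C 
        (\<Sum>a\<in>{a\<in>S. lacunary m D a = lacunary m D (freq_diff p)}. y a) = \<dots>" .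
  qed
  also have "\<dots> = (\<Sum>a\<in>S. \<Sum>p\<in>hardy_pairs m D. if freq_diff p = a then k a *\<^sub>C y a else 0)" by (rule sum.swap)
  also have "\<dots> = (\<Sum>a\<in>S. (complex_of_real (\<epsilon> (level a) * fejer_weight m D a) * chi m a \<theta>) *\<^sub>C y a)"
  proof (rule sum.cong[OF HOL.refl])
    fix a assume "a \<in> S"
    then have ah: "a \<in> hardy_freqs m" using S by blast
    have "bij_betw (\<lambda>c. (c, \<lambda>j. c j - a j)) {c \<in> cube m D. (\<lambda>j. c j - a j) \<in> cube m D} {p \<in> hardy_pairs m D. freq_diff p = a}"
    proof (rule bij_betw_imageI)
      show "inj_on (\<lambda>c. (c, \<lambda>j. c j - a j)) {c \<in> cube m D. (\<lambda>j. c j - a j) \<in> cube m D}" by (rule inj_onI) simp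
      show "(\<lambda>c. (c, \<lambda>j. c j - a j)) ` {c \<in> cube m D. (\<lambda>j. c j - a j) \<in> cube m D} = {p \<in> hardy_pairs m D. freq_diff p = a}" (is "?L = ?R")
      proof
        show "?L \<subseteq> ?R" using ah by (auto simp: hardy_pairs_def freq_diff_def)
        show "?R \<subseteq> ?L"
        proof
          fix p assume p: "p \<in> ?R"
          obtain c c' where cc: "p = (c, c')" by (cases p)
          have c: "c \<in> cube m D" "c' \<in> cube m D" "c' = (\<lambda>j. c j - a j)"
            using p by (auto simp: cc hardy_pairs_def freq_diff_def)
          then show "p \<in> ?L" unfolding cc by (intro image_eqI[of _ _ c]) auto
        qed
      qed
    qed
    then have "card {p \<in> hardy_pairs m D. freq_diff p = a} = card {c \<in> cube m D. (\<lambda>j. c j - a j) \<in> cube m D}"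
      by (rule bij_betw_same_card[symmetric])
    then have w: "real (card {p \<in> hardy_pairs m D. freq_diff p = a}) = fejer_weight m D a * ?N"
      unfolding fejer_weight_def by (simp add: card_cube)
    have "(\<Sum>p\<in>hardy_pairs m D. if freq_diff p = a then k a *\<^sub>C y a else 0) = 
        (\<Sum>p\<in>{p \<in> hardy_pairs m D. freq_diff p = a}. k a *\<^sub>C y a)"
      by (rule sum.inter_filter[symmetric]) simp
    also have "\<dots> = real (card {p \<in> hardy_pairs m D. freq_diff p = a}) *\<^sub>R (k a *\<^sub>C y a)" by (rule sum_constant_scaleR)
    also have "\<dots> = (complex_of_real (\<epsilon> (level a) * fejer_weight m D a) * chi m a \<theta>) *\<^sub>C y a"
    proof -
      have "card (cube m D) \<noteq> 0" by (simp add: card_cube)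
      then show ?thesis unfolding w k_def scaleR_eq_scaleC scaleC_scaleC by (simp add: mult_ac)
    qed
    finally show "(\<Sum>p\<in>hardy_pairs m D. if freq_diff p = a then k a *\<^sub>C y a else 0) = \<dots>" .
  qed
  finally show ?thesis .
qed


text \<open>The transference argument. The coefficients of a formal sum close to \<open>F \<eta>\<close> are close to those of
  \<open>F \<eta>\<close>, uniformly; \<open>transfer\<close> involves finitely many of them, so an error in the Bochner norm that
  is small in terms of \<open>D\<close> is harmless.\<close>

lemma hardy_polynomial_unconditional:
  fixes x :: "(nat \<Rightarrow> int) \<Rightarrow> 'x::complex_banach"
  assumes c: "c > 0" and proj: "\<And>(F :: complex \<Rightarrow> 'x) e. F \<in> analytic_polynomials \<Longrightarrow> e > 0 \<Longrightarrow> proj_approx (c * L1_norm circle F + e) F"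
    and S: "finite S" "S \<subseteq> hardy_freqs m" and \<epsilon>: "\<And>n. \<epsilon> n \<in> {1, -1 :: real}"
  shows "L1_norm torus (\<lambda>\<omega>. \<Sum>a\<in>S. \<epsilon> (level a) *\<^sub>R (chi m a \<omega> *\<^sub>C x a)) \<le> 4 * c * L1_norm torus (\<lambda>\<omega>. \<Sum>a\<in>S. chi m a \<omega> *\<^sub>C x a)"
proof (rule field_le_epsilon)
  define f where "f \<omega> = (\<Sum>a\<in>S. chi m a \<omega> *\<^sub>C x a)" for \<omega>
  define Tf where "Tf \<omega> = (\<Sum>a\<in>S. \<epsilon> (level a) *\<^sub>R (chi m a \<omega> *\<^sub>C x a))" for \<omega>
  have fL: "f \<in> bochner_L1 torus" unfolding f_def by (rule bochner_L1_chi_sum)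
  have Tf_eq: "Tf \<omega> = (\<Sum>a\<in>S. chi m a \<omega> *\<^sub>C (\<epsilon> (level a) *\<^sub>R x a))" for \<omega>
    unfolding Tf_def by (simp add: scaleC_scaleR)
  have TL: "Tf \<in> bochner_L1 torus" unfolding Tf_eq[abs_def] by (rule bochner_L1_chi_sum)
  have e1: "\<bar>\<epsilon> n\<bar> = 1" for n using \<epsilon>[of n] by auto
  have Sf: "S \<subseteq> freqs m" using S(2) hardy_freqs_subset by blast
  fix e0 :: real assume "e0 > 0"
  define e where "e = e0 / (4 * c + 6)"
  have e: "e > 0" using \<open>e0 > 0\<close> c by (simp add: e_def)
  define X where "X = (\<Sum>a\<in>S. norm (x a)) + 1"
  have X: "X > 0" unfolding X_def by (intro add_nonneg_pos sum_nonneg) auto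
  have eX: "e / X > 0" using e X by simp
  obtain D where D: "\<And>a. a \<in> S \<Longrightarrow> 1 - e / X \<le> fejer_weight m D a" "\<And>a j. a \<in> S \<Longrightarrow> \<bar>a j\<bar> \<le> int D"
    using fejer_weight_near_1[OF S(1) Sf eX] by metis
  let ?N = "real (card (cube m D))"
  have N: "?N > 0" by (simp add: card_cube)
  have lac: "0 \<le> lacunary m D a" if "a \<in> S" for a
  proof -
    have "\<bar>a j\<bar> \<le> 2 * int D" for j using D(2)[OF that, of j] by simp
    then show ?thesis using lacunary_nonneg_iff[of a m D] that S(2) Sf by blast
  qed
  define F where "F \<eta> z = (\<Sum>a\<in>S. z powi lacunary m D a *\<^sub>C (chi m a \<eta> *\<^sub>C x a))" for \<eta> z
  have FA: "F \<eta> \<in> analytic_polynomials" for \<eta>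
  proof -
    have "F \<eta> = (\<lambda>z. \<Sum>a\<in>S. z ^ nat (lacunary m D a) *\<^sub>C (chi m a \<eta> *\<^sub>C x a))"
      unfolding F_def by (intro ext sum.cong HOL.refl) (simp add: power_int_def lac)
    then show ?thesis by (simp only:) (intro analytic_polynomials_sum analytic_polynomial_monom)
  qed
  have Ff: "F \<eta> z = f (rotate_torus (lacunary_curve D z) \<eta>)" if "z \<in> space circle" for \<eta> z
  proof -
    have "z \<noteq> 0" using that by (auto simp: space_circle)
    then show ?thesis unfolding F_def f_def chi_rotate by (simp add: chi_lacunary_curve scaleC_scaleC)
  qed
  \<comment> \<open>The average over \<open>\<eta>\<close> of the norm of \<open>F \<eta>\<close> is the norm of \<open>f\<close>.\<close>
  have "\<exists>\<eta>\<in>space torus. L1_norm circle (F \<eta>) \<le> L1_norm torus f + e"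
  proof (rule ccontr)
    assume "\<not> ?thesis"
    then have big: "L1_norm torus f + e \<le> L1_norm circle (F \<eta>)" if "\<eta> \<in> space torus" for \<eta> using that by force
    have m: "(\<lambda>(z, \<eta>). norm (F \<eta> z)) \<in> borel_measurable (circle \<Otimes>\<^sub>M torus)"
    proof -
      have "(\<lambda>p. norm (\<Sum>a\<in>S. (fst p powi lacunary m D a * chi m a (snd p)) *\<^sub>C x a)) \<in> borel_measurable (circle \<Otimes>\<^sub>M torus)"
        by (intro strongly_measurable_norm strongly_measurable_sum strongly_measurable_scaleC_const) measurable
      then show ?thesis unfolding F_def by (simp add: case_prod_beta' scaleC_scaleC)
    qed
    have b: "norm (F \<eta> z) \<le> X" if "z \<in> space circle" "\<eta> \<in> space torus" for z \<eta>
    proof -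
      have "norm (F \<eta> z) \<le> (\<Sum>a\<in>S. norm (x a))"
        unfolding F_def using that by (intro sum_norm_le) (simp add: norm_scaleC norm_power_int space_circle)
      then show ?thesis by (simp add: X_def)
    qed
    have i: "integrable (circle \<Otimes>\<^sub>M torus) (\<lambda>(z, \<eta>). norm (F \<eta> z))"
      by (rule pair_circle_torus.P.integrable_const_bound[where B=X, OF _ m])
         (use b in \<open>auto simp: space_pair_measure intro!: AE_I2\<close>)
    have "L1_norm torus f + e = (LINT \<eta>|torus. L1_norm torus f + e)" by (simp add: torus.prob_space)
    also have "\<dots> \<le> (LINT \<eta>|torus. LINT z|circle. norm (F \<eta> z))"
      using big pair_circle_torus.integrable_snd[OF i] unfolding L1_norm_def by (intro integral_mono) auto
    also have "\<dots> = (LINT z|circle. LINT \<eta>|torus. norm (F \<eta> z))"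
      using pair_circle_torus.Fubini_integral[OF i] .
    also have "\<dots> = (LINT z|circle. L1_norm torus f)"
    proof (rule Bochner_Integration.integral_cong[OF HOL.refl])
      fix z assume z: "z \<in> space circle"
      have "(LINT \<eta>|torus. norm (f (rotate_torus (lacunary_curve D z) \<eta>))) = (LINT \<eta>|torus. norm (f \<eta>))"
        by (rule integral_rotate_torus) (use z fL norm_lacunary_curve in \<open>auto simp: space_circle bochner_L1_def\<close>)
      then show "(LINT \<eta>|torus. norm (F \<eta> z)) = L1_norm torus f" unfolding Ff[OF z] L1_norm_def .
    qed
    also have "\<dots> = L1_norm torus f" by (simp add: circle.prob_space)
    finally show False using e by simp
  qed
  then obtain \<eta> where \<eta>: "\<eta> \<in> space torus" "L1_norm circle (F \<eta>) \<le> L1_norm torus f + e" by blast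
  have \<eta>1: "norm (\<eta> j) = 1" if "1 \<le> j" for j using norm_torus_coordinate[OF \<eta>(1) that] .
  have eN: "e / ?N > 0" using e N by simp
  obtain s where s: "s \<in> formal_sums" "formal_cost s \<le> c * L1_norm circle (F \<eta>) + e"
      "L1_norm circle (\<lambda>z. tensor_fun s z - F \<eta> z) < e / ?N"
    using proj[OF FA[of \<eta>] e] eN unfolding proj_approx_def by blast
  define v where "v l = (\<Sum>a\<in>{a\<in>S. lacunary m D a = l}. chi m a \<eta> *\<^sub>C x a)" for l
  have coeff: "norm (v l - formal_coeff s l) \<le> e / ?N" for l
  proof -
    have h1: "has_strong_integral circle (\<lambda>z. z powi (- l) *\<^sub>C F \<eta> z) (v l)"
      using has_strong_integral_circle_powers[OF S(1), of "- l" "lacunary m D" "\<lambda>a. chi m a \<eta> *\<^sub>C x a"]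
      unfolding F_def v_def by simp
    have h2: "has_strong_integral circle (\<lambda>z. z powi (- l) *\<^sub>C (tensor_fun s z - F \<eta> z)) (formal_coeff s l - v l)"
      using has_strong_integral_diff[OF has_strong_integral_formal_coeff[OF s(1)] h1] by (simp add: scaleC_diff_right)
    have eq: "norm (z powi (- l) *\<^sub>C (tensor_fun s z - F \<eta> z)) = norm (tensor_fun s z - F \<eta> z)" if "z \<in> space circle" for z
      using that by (simp add: norm_scaleC norm_power_int space_circle)
    have i: "integrable circle (\<lambda>z. norm (tensor_fun s z - F \<eta> z))"
      using bochner_L1_diff[OF tensor_fun_bochner_L1[OF s(1)] analytic_polynomial_bochner_L1[OF FA]] by (simp add: bochner_L1_def)
    have "norm (formal_coeff s l - v l) \<le> L1_norm circle (\<lambda>z. z powi (- l) *\<^sub>C (tensor_fun s z - F \<eta> z))"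
      by (rule has_strong_integral_norm_le[OF h2]) (rule iffD2[OF Bochner_Integration.integrable_cong[OF HOL.refl eq] i])
    also have "\<dots> = L1_norm circle (\<lambda>z. tensor_fun s z - F \<eta> z)"
      unfolding L1_norm_def by (rule Bochner_Integration.integral_cong[OF HOL.refl eq])
    finally show ?thesis using s(3) by (simp add: norm_minus_commute)
  qed
  define g where "g = transfer m D \<epsilon> v"
  define q where "q = transfer m D \<epsilon> (formal_coeff s)"
  have L: "g \<in> bochner_L1 torus" "q \<in> bochner_L1 torus" unfolding g_def q_def by (rule transfer_bochner_L1)+
  have g_eq: "g \<theta> = (\<Sum>a\<in>S. (complex_of_real (\<epsilon> (level a) * fejer_weight m D a) * chi m a \<theta>) *\<^sub>C (chi m a \<eta> *\<^sub>C x a))" for \<theta>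
    unfolding g_def v_def by (rule transfer_polynomial[OF S]) (rule D(2))
  have r1: "L1_norm torus (\<lambda>\<theta>. g \<theta> - q \<theta>) \<le> e"
  proof -
    have "L1_norm torus (transfer m D \<epsilon> (\<lambda>l. v l - formal_coeff s l)) \<le> ?N * (e / ?N)"
      by (rule L1_norm_transfer_le[OF coeff \<epsilon>])
    moreover have "k * (e / k) = e" if "0 < k" for k :: real using that by simp
    from this[OF N] have "?N * (e / ?N) = e" .
    ultimately show ?thesis unfolding g_def q_def transfer_diff[abs_def] by linarith
  qed
  have r2: "L1_norm torus q \<le> 4 * (c * (L1_norm torus f + e) + e)"
  proof -
    have "L1_norm torus q \<le> 4 * formal_cost s" unfolding q_def by (rule L1_norm_transfer_formal_le[OF \<epsilon> s(1)])
    also have "\<dots> \<le> 4 * (c * L1_norm circle (F \<eta>) + e)" using s(2) by simp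
    also have "\<dots> \<le> 4 * (c * (L1_norm torus f + e) + e)" using \<eta>(2) c by simp
    finally show ?thesis .
  qed
  define Tr where "Tr \<theta> = Tf (rotate_torus \<eta> \<theta>)" for \<theta>
  have Tr_eq: "Tr \<theta> = (\<Sum>a\<in>S. chi m a \<theta> *\<^sub>C (chi m a \<eta> *\<^sub>C (\<epsilon> (level a) *\<^sub>R x a)))" for \<theta>
    unfolding Tr_def Tf_eq chi_rotate by (simp add: scaleC_scaleC mult.commute)
  have TrL: "Tr \<in> bochner_L1 torus" unfolding Tr_eq[abs_def] by (rule bochner_L1_chi_sum)
  have r3: "L1_norm torus (\<lambda>\<theta>. Tr \<theta> - g \<theta>) \<le> e"
  proof -
    define y where "y a = chi m a \<eta> *\<^sub>C ((\<epsilon> (level a) * (1 - fejer_weight m D a)) *\<^sub>R x a)" for a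
    have "Tr \<theta> - g \<theta> = (\<Sum>a\<in>S. chi m a \<theta> *\<^sub>C y a)" for \<theta>
      unfolding Tr_eq g_eq y_def sum_subtractf[symmetric]
    proof (rule sum.cong[OF HOL.refl])
      fix a
      show "chi m a \<theta> *\<^sub>C chi m a \<eta> *\<^sub>C \<epsilon> (level a) *\<^sub>R x a - (complex_of_real (\<epsilon> (level a) * fejer_weight m D a) * chi m a \<theta>) *\<^sub>C chi m a \<eta> *\<^sub>C x a
         = chi m a \<theta> *\<^sub>C chi m a \<eta> *\<^sub>C (\<epsilon> (level a) * (1 - fejer_weight m D a)) *\<^sub>R x a"
        unfolding scaleR_eq_scaleC scaleC_scaleC scaleC_diff_left[symmetric] by (simp add: algebra_simps)
    qed
    then have "L1_norm torus (\<lambda>\<theta>. Tr \<theta> - g \<theta>) \<le> (\<Sum>a\<in>S. norm (y a))" using L1_norm_chi_sum_le[of m y S] by simp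
    also have "\<dots> \<le> (\<Sum>a\<in>S. (e / X) * norm (x a))"
    proof (rule sum_mono)
      fix a assume "a \<in> S"
      then have "\<bar>1 - fejer_weight m D a\<bar> \<le> e / X" using D(1)[of a] fejer_weight_le_1[of m D a] by simp
      moreover have "norm (y a) = \<bar>1 - fejer_weight m D a\<bar> * norm (x a)"
        unfolding y_def norm_scaleC norm_scaleR by (simp add: norm_chi \<eta>1 abs_mult e1)
      ultimately show "norm (y a) \<le> (e / X) * norm (x a)" by (simp only: mult_right_mono norm_ge_zero)
    qed
    also have "\<dots> = (e / X) * (X - 1)" by (simp add: X_def sum_distrib_left)
    also have "\<dots> \<le> (e / X) * X" using eX by (intro mult_left_mono) auto
    also have "\<dots> = e" using X by simp
    finally show ?thesis .
  qed
  have "L1_norm torus Tr = L1_norm torus Tf"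
    unfolding L1_norm_def Tr_def by (rule integral_rotate_torus[OF \<eta>1]) (use TL in \<open>auto simp: bochner_L1_def\<close>)
  moreover have "L1_norm torus Tr \<le> L1_norm torus g + L1_norm torus (\<lambda>\<theta>. Tr \<theta> - g \<theta>)"
    by (rule L1_norm_le_add_diff[OF TrL L(1)])
  moreover have "L1_norm torus g \<le> L1_norm torus q + L1_norm torus (\<lambda>\<theta>. g \<theta> - q \<theta>)"
    by (rule L1_norm_le_add_diff[OF L])
  ultimately have "L1_norm torus Tf \<le> 4 * (c * (L1_norm torus f + e) + e) + e + e"
    using r1 r2 r3 by linarith
  also have "\<dots> = 4 * c * L1_norm torus f + (4 * c + 6) * e" by (simp add: algebra_simps)
  also have "(4 * c + 6) * e = e0" using c by (simp add: e_def)
  finally show "L1_norm torus (\<lambda>\<omega>. \<Sum>a\<in>S. \<epsilon> (level a) *\<^sub>R (chi m a \<omega> *\<^sub>C x a)) \<le> 4 * c * L1_norm torus (\<lambda>\<omega>. \<Sum>a\<in>S. chi m a \<omega> *\<^sub>C x a) + e0"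
    unfolding Tf_def f_def .
qed

lemma hardy_freq_in_freqs_iff:
  assumes "a \<in> hardy_freqs m" shows "a \<in> freqs n \<longleftrightarrow> level a \<le> n"
proof
  have a: "a \<in> lead_freqs (level a)" by (rule hardy_freqs_level[OF assms])
  show "a \<in> freqs n" if "level a \<le> n" using a freqs_mono[OF that] by (auto simp: lead_freqs_def)
  show "level a \<le> n" if "a \<in> freqs n"
  proof (rule ccontr)
    assume "\<not> level a \<le> n"
    then have "a (level a) = 0" "level a \<noteq> 0" using that by (auto simp: freqs_def)
    then show False using a by (simp add: lead_freqs_def)
  qed
qed

theorem theorem3p4:
  assumes "H1_projective TYPE('x::complex_banach)"
  shows "UHMD TYPE('x)"
proof -
  obtain c where c: "c > 0" and proj: "\<And>(F :: complex \<Rightarrow> 'x) e. F \<in> analytic_polynomials \<Longrightarrow> e > 0 \<Longrightarrow> proj_approx (c * L1_norm circle F + e) F"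
    using H1_projective_imp_proj_approx_norm[OF assms] by metis
  have "L1_norm torus (\<lambda>\<omega>. \<Sum>n\<le>m. \<epsilon> n *\<^sub>R mart_diff M n \<omega>) \<le> 4 * c * L1_norm torus (M m)"
    if M: "hardy_martingale M" and \<epsilon>: "\<forall>n. \<epsilon> n \<in> {1, -1 :: real}" for M :: "nat \<Rightarrow> (nat \<Rightarrow> complex) \<Rightarrow> 'x" and \<epsilon> m
  proof (rule field_le_epsilon)
    fix e :: real assume "e > 0"
    define d where "d = e / (2 * (real m + 1) + 4 * c)"
    have d: "d > 0" using \<open>e > 0\<close> c by (simp add: d_def add_pos_pos)
    have e1: "\<bar>\<epsilon> n\<bar> = 1" for n using \<epsilon>[rule_format, of n] by auto
    have MB: "M k \<in> bochner_L1 torus" for k using M by (auto simp: hardy_martingale_def torus_martingale_def)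
    obtain S x where S: "finite S" "S \<subseteq> hardy_freqs m" and Sx: "L1_norm torus (\<lambda>\<omega>. M m \<omega> - (\<Sum>a\<in>S. chi m a \<omega> *\<^sub>C x a)) < d"
      by (rule hardy_martingale_approx[OF M d])
    define f where "f \<omega> = (\<Sum>a\<in>S. chi m a \<omega> *\<^sub>C x a)" for \<omega>
    define P where "P n \<omega> = (\<Sum>a\<in>{a\<in>S. level a \<le> n}. chi m a \<omega> *\<^sub>C x a)" for n \<omega>
    have fB: "f \<in> bochner_L1 torus" unfolding f_def by (rule bochner_L1_chi_sum)
    have PB: "P n \<in> bochner_L1 torus" for n unfolding P_def by (rule bochner_L1_chi_sum)
    have MP: "L1_norm torus (\<lambda>\<omega>. M n \<omega> - P n \<omega>) \<le> d" if n: "n \<le> m" for n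
    proof -
      have ce: "is_cond_exp torus (coord_algebra n) (M m) (M n)"
        using M n by (auto simp: hardy_martingale_def torus_martingale_def)
      have "S \<inter> freqs n = {a\<in>S. level a \<le> n}" using hardy_freq_in_freqs_iff S(2) by blast
      then show ?thesis
        using cond_exp_trig_contraction[OF ce MB n S(1) order_trans[OF S(2) hardy_freqs_subset], of x] Sx 
        unfolding P_def by simp
    qed
    have dP: "mart_diff P n \<omega> = (\<Sum>a\<in>{a\<in>S. level a = n}. chi m a \<omega> *\<^sub>C x a)" for n \<omega>
    proof (cases n)
      case (Suc k)
      have "{a\<in>S. level a \<le> Suc k} = {a\<in>S. level a \<le> k} \<union> {a\<in>S. level a = Suc k}" by auto
      then have "P (Suc k) \<omega> = P k \<omega> + (\<Sum>a\<in>{a\<in>S. level a = Suc k}. chi m a \<omega> *\<^sub>C x a)"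
        unfolding P_def using S(1) by (simp add: sum.union_disjoint disjoint_iff)
      then show ?thesis by (simp add: mart_diff_def Suc)
    qed (simp add: mart_diff_def P_def)
    have T: "(\<Sum>n\<le>m. \<epsilon> n *\<^sub>R mart_diff P n \<omega>) = (\<Sum>a\<in>S. \<epsilon> (level a) *\<^sub>R (chi m a \<omega> *\<^sub>C x a))" for \<omega>
    proof -
      have "(\<Sum>n\<le>m. \<epsilon> n *\<^sub>R mart_diff P n \<omega>) = (\<Sum>n\<le>m. \<Sum>a\<in>{a\<in>S. level a = n}. \<epsilon> (level a) *\<^sub>R (chi m a \<omega> *\<^sub>C x a))"
        unfolding dP scaleR_sum_right by (intro sum.cong HOL.refl) auto
      also have "\<dots> = (\<Sum>a\<in>S. \<epsilon> (level a) *\<^sub>R (chi m a \<omega> *\<^sub>C x a))"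
        by (rule sum.group) (use S hardy_freqs_level(2) in auto)
      finally show ?thesis .
    qed
    have dB: "mart_diff Q n \<in> bochner_L1 torus" if "\<And>k. Q k \<in> bochner_L1 torus" for Q :: "nat \<Rightarrow> (nat \<Rightarrow> complex) \<Rightarrow> 'x" and n
      using that bochner_L1_diff[OF that that] by (cases "n = 0") (auto simp: mart_diff_def[abs_def])
    have diff: "L1_norm torus (\<lambda>\<omega>. mart_diff M n \<omega> - mart_diff P n \<omega>) \<le> 2 * d" if n: "n \<le> m" for n
    proof (cases "n = 0")
      case True
      then show ?thesis using MP[of 0] d by (simp add: mart_diff_def)
    next
      case False
      have "L1_norm torus (\<lambda>\<omega>. mart_diff M n \<omega> - mart_diff P n \<omega>) = L1_norm torus (\<lambda>\<omega>. (M n \<omega> - P n \<omega>) - (M (n - 1) \<omega> - P (n - 1) \<omega>))"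
        using False by (simp add: mart_diff_def algebra_simps)
      also have "\<dots> \<le> L1_norm torus (\<lambda>\<omega>. M n \<omega> - P n \<omega>) + L1_norm torus (\<lambda>\<omega>. M (n - 1) \<omega> - P (n - 1) \<omega>)"
        by (intro L1_norm_diff_le bochner_L1_diff MB PB)
      also have "\<dots> \<le> d + d" using n by (intro add_mono MP) auto
      finally show ?thesis by simp
    qed
    define Z where "Z Q \<omega> = (\<Sum>n\<le>m. \<epsilon> n *\<^sub>R mart_diff Q n \<omega>)" for Q :: "nat \<Rightarrow> (nat \<Rightarrow> complex) \<Rightarrow> 'x" and \<omega>
    have ZB: "Z Q \<in> bochner_L1 torus" if "\<And>k. Q k \<in> bochner_L1 torus" for Q
      unfolding Z_def using dB[OF that] by (intro bochner_L1_sum bochner_L1_scaleR)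
    have ZM: "Z M \<in> bochner_L1 torus" by (rule ZB) (rule MB)
    have ZPB: "Z P \<in> bochner_L1 torus" by (rule ZB) (rule PB)
    have "L1_norm torus (\<lambda>\<omega>. Z M \<omega> - Z P \<omega>) \<le> (\<Sum>n\<le>m. L1_norm torus (\<lambda>\<omega>. \<epsilon> n *\<^sub>R (mart_diff M n \<omega> - mart_diff P n \<omega>)))"
      unfolding Z_def sum_subtractf[symmetric] scaleR_diff_right[symmetric]
      by (intro L1_norm_sum_le bochner_L1_scaleR bochner_L1_diff dB MB PB)
    also have "\<dots> \<le> (\<Sum>n\<le>m. 2 * d)"
      unfolding L1_norm_scaleR e1 by (intro sum_mono) (simp add: diff)
    also have "\<dots> = 2 * (real m + 1) * d" by simp
    finally have ZMP: "L1_norm torus (\<lambda>\<omega>. Z M \<omega> - Z P \<omega>) \<le> 2 * (real m + 1) * d" .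
    have "L1_norm torus (Z P) \<le> 4 * c * L1_norm torus f"
      unfolding Z_def T f_def by (rule hardy_polynomial_unconditional[OF c proj S]) (use \<epsilon> in auto)
    also have "\<dots> \<le> 4 * c * (L1_norm torus (M m) + d)"
    proof -
      have "L1_norm torus f \<le> L1_norm torus (M m) + d"
        using L1_norm_le_add_diff[OF fB MB[of m]] Sx L1_norm_minus_commute[of torus f "M m"] unfolding f_def by simp
      then show ?thesis using c by simp
    qed
    finally have "L1_norm torus (Z M) \<le> 4 * c * (L1_norm torus (M m) + d) + 2 * (real m + 1) * d"
      using L1_norm_le_add_diff[OF ZM ZPB] ZMP by linarith
    also have "\<dots> = 4 * c * L1_norm torus (M m) + (2 * (real m + 1) + 4 * c) * d" by (simp add: algebra_simps)
    also have "(2 * (real m + 1) + 4 * c) * d = e"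
    proof -
      have "2 * (real m + 1) + 4 * c > 0" using c by (simp add: add_pos_pos)
      then show ?thesis by (simp add: d_def)
    qed
    finally show "L1_norm torus (\<lambda>\<omega>. \<Sum>n\<le>m. \<epsilon> n *\<^sub>R mart_diff M n \<omega>) \<le> 4 * c * L1_norm torus (M m) + e"
      unfolding Z_def .
  qed
  then show ?thesis unfolding UHMD_def by blast
qed

end
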